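(* (i) For all $w\in\mathfrak{h}^0$, $Z^{RS}(\varphi(w))=-\overline{Z^{RS}(w)}$. (ii) For all $w\in\mathfrak{h}$, $Z^{RS}(\tau(w))=-\overline{Z^{RS}(w)}$. Here the bar denotes complex conjugation.
   Context: Let $\mathbb{Q}\langle e_0,e_1\rangle$ be the free noncommutative $\mathbb{Q}$-algebra on $e_0,e_1$, $\mathfrak{h}=e_0\mathbb{Q}\langle e_0,e_1\rangle\oplus e_1\mathbb{Q}\langle e_0,e_1\rangle$, $\mathfrak{h}^0=e_1\mathbb{Q}\oplus e_1\mathbb{Q}\langle e_0,e_1\rangle e_1$. $\varphi$ is the algebra automorphism of $\mathbb{Q}\langle e_0,e_1\rangle$ with $\varphi(e_0)=e_0-e_1$, $\varphi(e_1)=-e_1$; $\tau$ is the anti-automorphism with $\tau(e_0)=-e_0$, $\tau(e_1)=-e_1$. Regularized iterated integrals: a tangential base point $v_p$ is a point $p\in\mathbb{C}$ with a nonzero vector $v$; a path from $v_p$ to $w_q$ on $M$ is a continuous piecewise smooth $\gamma:[0,1]\to\mathbb{C}$ with $\gamma(0)=p,\gamma'(0)=v,\gamma(1)=q,\gamma'(1)=-w$, $\gamma((0,1))\subset M$, up to homotopy. For $a_1,\dots,a_n\in\mathbb{C}$ and such a class $\Gamma$ on $\mathbb{C}\setminus\{a_j\}$ from $x$ to $y$, $I_\Gamma(x;a_1,\dots,a_n;y)$ is the constant term $c_0$ in $\int_{t<t_1<\cdots<t_n<1-t}\prod_j\frac{d\gamma(t_j)}{\gamma(t_j)-a_j}=\sum_{k=0}^nc_k(\log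 t)^k+O(t\log^{n+1}t)$ as $t\to0$. Let $0'=1_0$, $1'=(-1)_1$, ${\rm dch}$ the straight path from $0'$ to $1'$, $\alpha$ the loop at $1'$ around $1$ once counterclockwise in $\mathbb{C}\setminus\{0,1\}$, $\beta={\rm dch}\,\alpha\,{\rm dch}^{-1}$. The linear map $Z^{RS}:\mathfrak{h}\to\mathbb{C}$ is $Z^{RS}(e_{a_1}\cdots e_{a_k})=\frac{1}{2\pi i}I_\beta(0';a_1,\dots,a_k;0')$. *)

theory Defs
  imports
    "HOL-Complex_Analysis.Complex_Analysis"
    "HOL-Library.Poly_Mapping"
    "HOL-Library.Landau_Symbols"
begin

section \<open>The free algebra on two letters\<close>

datatype letter = E0 | E1

text \<open>Lists under concatenation are the free monoid (written additively, as
  \<^theory>\<open>HOL-Library.Poly_Mapping\<close> requires). The free algebra is its monoid algebra: the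
  convolution product of finitely supported functions on words.\<close>

instantiation list :: (type) monoid_add
begin
definition zero_list_def: "0 = []"
definition plus_list_def: "xs + ys = xs @ ys"
instance by standard (simp_all add: zero_list_def plus_list_def)
end

type_synonym free_alg = "letter list \<Rightarrow>\<^sub>0 rat"

definition gen :: "letter \<Rightarrow> free_alg" where
  "gen a = Poly_Mapping.single [a] 1"

definition scalar :: "rat \<Rightarrow> free_alg" where
  "scalar c = Poly_Mapping.single [] c"

definition hom_ext :: "(letter \<Rightarrow> free_alg) \<Rightarrow> free_alg \<Rightarrow> free_alg" where
  "hom_ext g f = (\<Sum>w\<in>Poly_Mapping.keys f.
     scalar (Poly_Mapping.lookup f w) * prod_list (map g w))"

definition antihom_ext :: "(letter \<Rightarrow> free_alg) \<Rightarrow> free_alg \<Rightarrow> free_alg" where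
  "antihom_ext g f = (\<Sum>w\<in>Poly_Mapping.keys f.
     scalar (Poly_Mapping.lookup f w) * prod_list (map g (rev w)))"

definition phi :: "free_alg \<Rightarrow> free_alg" where
  "phi = hom_ext (\<lambda>a. case a of E0 \<Rightarrow> gen E0 - gen E1 | E1 \<Rightarrow> - gen E1)"

definition tau :: "free_alg \<Rightarrow> free_alg" where
  "tau = antihom_ext (\<lambda>a. - gen a)"

definition frakh :: "free_alg set" where
  "frakh = {gen E0 * u + gen E1 * v | u v. True}"

definition frakh0 :: "free_alg set" where
  "frakh0 = {gen E1 * scalar c + gen E1 * u * gen E1 | c u. True}"

subsection \<open>\<open>phi\<close> and \<open>tau\<close> are the intended (anti-)homomorphisms\<close>

lemma single_word: "Poly_Mapping.single w c = scalar c * prod_list (map gen w)"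
proof -
  have "prod_list (map gen w) = Poly_Mapping.single w 1"
    by (induction w) (simp_all add: gen_def mult_single plus_list_def
        single_one[symmetric] zero_list_def del: single_one)
  then show ?thesis by (simp add: scalar_def mult_single plus_list_def)
qed

lemma scalar_add: "scalar (a + b) = scalar a + scalar b"
  and scalar_mult: "scalar (a * b) = scalar a * scalar b"
  and scalar_0: "scalar 0 = 0"
  and scalar_1: "scalar 1 = 1"
  using single_one[where 'a = "letter list" and 'b = rat]
  by (simp_all add: scalar_def single_add mult_single plus_list_def zero_list_def)

lemma free_alg_induct [case_names single add]:
  fixes x :: free_alg
  assumes "\<And>w c. P (Poly_Mapping.single w c)" "\<And>f g. P f \<Longrightarrow> P g \<Longrightarrow> P (f + g)"
  shows "P x"
proof (induction x rule: update_induct)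
  case const
  show ?case using assms(1)[of "[]" 0] by simp
next
  case (update f w c)
  then have "Poly_Mapping.update w c f = f + Poly_Mapping.single w c"
    by (intro poly_mapping_eqI)
       (auto simp: lookup_update lookup_add lookup_single when_def in_keys_iff)
  then show ?case using assms update by simp
qed

lemma scalar_commute: "scalar c * x = x * scalar c"
proof (induction x rule: free_alg_induct)
  case (single w d)
  then show ?case by (simp add: scalar_def mult_single plus_list_def mult.commute)
next
  case (add f g)
  then show ?case by (simp add: algebra_simps)
qed

lemma scalar_mult_mult: "scalar c * x * (scalar d * y) = scalar (c * d) * (x * y)"
proof -
  have "scalar c * x * (scalar d * y) = scalar c * (x * scalar d) * y"
    by (simp only: mult.assoc)
  also have "\<dots> = scalar c * (scalar d * x) * y"
    by (simp only: scalar_commute[of d x])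
  also have "\<dots> = scalar (c * d) * (x * y)"
    by (simp only: scalar_mult mult.assoc)
  finally show ?thesis .
qed

lemma ext_superset:
  fixes F :: "letter list \<Rightarrow> free_alg"
  assumes "finite S" "Poly_Mapping.keys f \<subseteq> S"
  shows "(\<Sum>w\<in>Poly_Mapping.keys f. scalar (Poly_Mapping.lookup f w) * F w)
       = (\<Sum>w\<in>S. scalar (Poly_Mapping.lookup f w) * F w)"
  by (rule sum.mono_neutral_left) (use assms in \<open>auto simp: in_keys_iff scalar_0\<close>)

lemma ext_add:
  fixes F :: "letter list \<Rightarrow> free_alg"
  shows "(\<Sum>w\<in>Poly_Mapping.keys (f + g). scalar (Poly_Mapping.lookup (f + g) w) * F w)
       = (\<Sum>w\<in>Poly_Mapping.keys f. scalar (Poly_Mapping.lookup f w) * F w)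
       + (\<Sum>w\<in>Poly_Mapping.keys g. scalar (Poly_Mapping.lookup g w) * F w)"
proof -
  let ?S = "Poly_Mapping.keys f \<union> Poly_Mapping.keys g"
  have S: "finite ?S" by simp
  show ?thesis
    by (subst (1 2 3) ext_superset[OF S])
       (use Poly_Mapping.keys_add[of f g] in
         \<open>auto simp: lookup_add scalar_add distrib_right sum.distrib\<close>)
qed

lemma hom_ext_add: "hom_ext g (x + y) = hom_ext g x + hom_ext g y"
  and antihom_ext_add: "antihom_ext g (x + y) = antihom_ext g x + antihom_ext g y"
  unfolding hom_ext_def antihom_ext_def by (rule ext_add)+

lemma hom_ext_single:
    "hom_ext g (Poly_Mapping.single w c) = scalar c * prod_list (map g w)"
  and antihom_ext_single:
    "antihom_ext g (Poly_Mapping.single w c) = scalar c * prod_list (map g (rev w))"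
  unfolding hom_ext_def antihom_ext_def by (auto simp: scalar_0)

lemma hom_ext_gen: "hom_ext g (gen a) = g a" "hom_ext g (scalar c) = scalar c"
  and antihom_ext_gen: "antihom_ext g (gen a) = g a" "antihom_ext g (scalar c) = scalar c"
  using hom_ext_single[of g "[a]" 1] hom_ext_single[of g "[]" c]
    antihom_ext_single[of g "[a]" 1] antihom_ext_single[of g "[]" c]
  by (simp_all add: gen_def scalar_1 flip: scalar_def)

lemma hom_ext_mult: "hom_ext g (x * y) = hom_ext g x * hom_ext g y"
proof (induction x rule: free_alg_induct)
  case (single w c)
  show ?case
  proof (induction y rule: free_alg_induct)
    case (single v d)
    show ?case
      by (simp add: mult_single hom_ext_single plus_list_def scalar_mult_mult)
  qed (simp add: distrib_left hom_ext_add)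
qed (simp add: distrib_right hom_ext_add)

lemma antihom_ext_mult: "antihom_ext g (x * y) = antihom_ext g y * antihom_ext g x"
proof (induction x rule: free_alg_induct)
  case (single w c)
  show ?case
  proof (induction y rule: free_alg_induct)
    case (single v d)
    show ?case
      by (simp add: mult_single antihom_ext_single plus_list_def scalar_mult_mult
          mult.commute[of d c])
  qed (simp add: distrib_left distrib_right antihom_ext_add)
qed (simp add: distrib_left distrib_right antihom_ext_add)

section \<open>Paths between tangential base points\<close>

text \<open>A tangential base point \<open>v\<^sub>p\<close> is the pair \<open>(p, v)\<close>.\<close>

type_synonym tbp = "complex \<times> complex"

definition smooth_on_interval :: "real \<Rightarrow> real \<Rightarrow> (real \<Rightarrow> complex) \<Rightarrow> bool" where
  "smooth_on_interval a b f \<longleftrightarrow>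
     (\<exists>D :: nat \<Rightarrow> real \<Rightarrow> complex.
        (\<forall>x\<in>{a..b}. D 0 x = f x) \<and>
        (\<forall>k. \<forall>x\<in>{a..b}. (D k has_vector_derivative D (Suc k) x) (at x within {a..b})))"

text \<open>Smooth (one-sidedly at the end points) on each closed piece of some finite
  subdivision of \<open>[0,1]\<close>.\<close>

definition piecewise_smooth :: "(real \<Rightarrow> complex) \<Rightarrow> bool" where
  "piecewise_smooth \<gamma> \<longleftrightarrow>
     (\<exists>S. finite S \<and>
        (\<forall>a b. 0 \<le> a \<and> a < b \<and> b \<le> 1 \<and> {a<..<b} \<inter> S = {} \<longrightarrow> smooth_on_interval a b \<gamma>))"

definition tpath :: "complex set \<Rightarrow> tbp \<Rightarrow> tbp \<Rightarrow> (real \<Rightarrow> complex) \<Rightarrow> bool" where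
  "tpath M x y \<gamma> \<longleftrightarrow>
     snd x \<noteq> 0 \<and> snd y \<noteq> 0 \<and>
     continuous_on {0..1} \<gamma> \<and> piecewise_smooth \<gamma> \<and>
     \<gamma> 0 = fst x \<and> (\<gamma> has_vector_derivative snd x) (at 0 within {0..1}) \<and>
     \<gamma> 1 = fst y \<and> (\<gamma> has_vector_derivative - snd y) (at 1 within {0..1}) \<and>
     \<gamma> ` {0<..<1} \<subseteq> M"

text \<open>Homotopy through such paths. Uniform convergence of the paths is too weak here: a loop
  around \<open>p\<close> of radius \<open>s\<close>, traversed after leaving \<open>p\<close> in the direction \<open>v\<close>, would become
  trivial as \<open>s \<rightarrow> 0\<close>. Therefore the difference quotients at the two ends have to extend
  continuously, i.e. the paths are tangent to the base vectors uniformly in the homotopy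
  parameter \<open>s\<close> (equivalently, the homotopy lifts to the real oriented blow-up).\<close>

definition tpath_homotopic ::
  "complex set \<Rightarrow> tbp \<Rightarrow> tbp \<Rightarrow> (real \<Rightarrow> complex) \<Rightarrow> (real \<Rightarrow> complex) \<Rightarrow> bool" where
  "tpath_homotopic M x y \<gamma> \<gamma>' \<longleftrightarrow>
     tpath M x y \<gamma> \<and> tpath M x y \<gamma>' \<and>
     (\<exists>H :: real \<times> real \<Rightarrow> complex.
        continuous_on ({0..1} \<times> {0..1}) H \<and>
        (\<forall>t\<in>{0..1}. H (0, t) = \<gamma> t \<and> H (1, t) = \<gamma>' t) \<and>
        (\<forall>s\<in>{0..1}. tpath M x y (\<lambda>t. H (s, t))) \<and>
        continuous_on ({0..1} \<times> {0..1})
          (\<lambda>(s, t). if t = 0 then snd x else (H (s, t) - fst x) / of_real t) \<and>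
        continuous_on ({0..1} \<times> {0..1})
          (\<lambda>(s, t). if t = 1 then snd y else (H (s, t) - fst y) / of_real (1 - t)))"

definition tpath_class ::
  "complex set \<Rightarrow> tbp \<Rightarrow> tbp \<Rightarrow> (real \<Rightarrow> complex) \<Rightarrow> (real \<Rightarrow> complex) set" where
  "tpath_class M x y \<gamma> = {\<gamma>'. tpath_homotopic M x y \<gamma> \<gamma>'}"

section \<open>Regularized iterated integrals\<close>

text \<open>\<open>iter_int \<gamma> [a\<^sub>1,\<dots>,a\<^sub>n] s u\<close> is the integral over \<open>s < t\<^sub>1 < \<dots> < t\<^sub>n < u\<close>; the outermost
  integration variable is \<open>t\<^sub>1\<close>. The derivative of \<open>\<gamma>\<close> may fail to exist at finitely many
  points.\<close>

fun iter_int :: "(real \<Rightarrow> complex) \<Rightarrow> complex list \<Rightarrow> real \<Rightarrow> real \<Rightarrow> complex" where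
  "iter_int \<gamma> [] s u = 1"
| "iter_int \<gamma> (a # as) s u =
     integral {s..u} (\<lambda>t. vector_derivative \<gamma> (at t) / (\<gamma> t - a) * iter_int \<gamma> as t u)"

definition is_reg_value :: "(real \<Rightarrow> complex) \<Rightarrow> complex list \<Rightarrow> complex \<Rightarrow> bool" where
  "is_reg_value \<gamma> as c0 \<longleftrightarrow>
     (\<exists>c :: nat \<Rightarrow> complex. c 0 = c0 \<and>
        (\<lambda>t. iter_int \<gamma> as t (1 - t) - (\<Sum>k\<le>length as. c k * of_real (ln t ^ k)))
          \<in> O[at_right 0](\<lambda>t. of_real (t * ln t ^ (length as + 1))))"

text \<open>The value for a homotopy class \<open>\<Gamma>\<close> is the common value of all its representatives.\<close>

definition reg_iter_int :: "(real \<Rightarrow> complex) set \<Rightarrow> complex list \<Rightarrow> complex" where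
  "reg_iter_int \<Gamma> as = (THE c0. \<forall>\<gamma>\<in>\<Gamma>. is_reg_value \<gamma> as c0)"

section \<open>The loop \<open>\<beta>\<close> and the map \<open>Z\<^sup>R\<^sup>S\<close>\<close>

definition tb0 :: tbp where "tb0 = (0, 1)"

definition tb1 :: tbp where "tb1 = (1, -1)"

text \<open>Composition at a tangential base point \<open>w\<^sub>q\<close>, for paths with \<open>\<gamma>\<^sub>1 (1 - t) = q + t w\<close> and
  \<open>\<gamma>\<^sub>2 t = q + t w\<close> for \<open>t \<le> 1/4\<close>: the two cancelling straight segments at \<open>q\<close> are cut out, so
  that the composite does not pass through \<open>q\<close>. The parametrization is unchanged near \<open>0\<close> and
  \<open>1\<close>, which keeps the outer tangent vectors.\<close>

definition tcomp :: "(real \<Rightarrow> complex) \<Rightarrow> (real \<Rightarrow> complex) \<Rightarrow> real \<Rightarrow> complex" where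
  "tcomp \<gamma>\<^sub>1 \<gamma>\<^sub>2 t =
     (if t \<le> 1/4 then \<gamma>\<^sub>1 t
      else if t \<le> 1/2 then \<gamma>\<^sub>1 (2 * t - 1/4)
      else if t \<le> 3/4 then \<gamma>\<^sub>2 (2 * t - 3/4)
      else \<gamma>\<^sub>2 t)"

definition dch :: "real \<Rightarrow> complex" where
  "dch t = of_real t"

definition alpha :: "real \<Rightarrow> complex" where
  "alpha t =
     (if t \<le> 1/4 then of_real (1 - t)
      else if t \<le> 3/4 then 1 + exp (4 * of_real pi * \<i> * of_real t) / 4
      else of_real t)"

definition beta :: "(real \<Rightarrow> complex) set" where
  "beta = tpath_class (UNIV - {0, 1}) tb0 tb0 (tcomp (tcomp dch alpha) (reversepath dch))"

fun point :: "letter \<Rightarrow> complex" where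
  "point E0 = 0"
| "point E1 = 1"

definition ZRS :: "free_alg \<Rightarrow> complex" where
  "ZRS f = (\<Sum>w\<in>Poly_Mapping.keys f. of_rat (Poly_Mapping.lookup f w) *
     (1 / (2 * of_real pi * \<i>) * reg_iter_int beta (map point w)))"

end

theory Submission
  imports Defs
    "HOL-Real_Asymp.Real_Asymp"
    "HOL-Computational_Algebra.Fundamental_Theorem_Algebra"
begin

text \<open>Let \<open>G z\<close> be the generating series of the regularized iterated integrals from \<open>z\<close> to the
  tangential base point at \<open>0\<close>. It solves a linear differential equation on \<open>\<complex> - {0, 1}\<close>, it behaves like
  \<open>exp (- e\<^sub>0 log z)\<close> at \<open>0\<close>, and continuing it backwards along \<open>\<beta>\<close> turns it into \<open>G R\<close> for a constant
  series \<open>R\<close>, whose coefficients are the regularized integrals along \<open>\<beta>\<close>. Continuation is insensitive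
  to homotopies, so \<open>R\<close> can be studied through the solutions on two slit planes alone.
  Complex conjugation maps the continuation from the upper to the lower half plane (right of \<open>1\<close>) to the
  one in the opposite direction; hence the conjugate of \<open>R\<close> is its inverse, which is also its antipode:
  this is (ii). The Moebius transformation \<open>z/(z - 1)\<close> pulls the equation back to its image under
  \<open>\<phi>\<close> and also reverses the direction; since it rotates the tangent vector at \<open>0\<close> by half a turn,
  \<open>R \<circ> \<phi>\<close> equals the conjugate of \<open>R\<close> up to factors \<open>exp (l e\<^sub>0)\<close> on both sides, and these do not
  affect the coefficients of \<open>e\<^sub>1\<close> and \<open>e\<^sub>1 u e\<^sub>1\<close>: this is (i).\<close>

text \<open>Continuation runs backwards because an iterated integral satisfies a left equation in
  its lower end point. Right multiplication by a constant series preserves solutions, so monodromy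
  and changes of normalization are constant right factors. Along a representative
  \<open>\<gamma>\<close> of the loop, the integral from t to 1 - t is G at
  \<open>\<gamma> t\<close>, times R, times the inverse of G at \<open>\<gamma> (1 - t)\<close>. It
  behaves like exp(- e_0 log t) R exp(e_0 log t), whose constant term in log t is R. The obstacle is
  that the value belongs to a whole homotopy class while the integrands are singular at both ends.
  Uniform tangency confines all paths of a homotopy near the ends to a cone where the principal
  branch of G is available; only a compact middle part has to be moved. Inverse and antipode agree
  because the antipode turns the equation into its adjoint: antipode times solution is constant, and
  the expansion at 0 determines the constant. No shuffle relation enters. The minus sign in both
  claims comes from the purely imaginary factor 1/(2 pi i).\<close>

section \<open>Noncommutative series\<close>

text \<open>A function on words is read as a noncommutative formal power series; the product of series is
  the sum over all deconcatenations of a word.\<close>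

fun conv :: "('a list \<Rightarrow> 'b::comm_ring_1) \<Rightarrow> ('a list \<Rightarrow> 'b) \<Rightarrow> 'a list \<Rightarrow> 'b" (infixl "\<star>" 70) where
  "(F \<star> G) [] = F [] * G []"
| "(F \<star> G) (a # w) = F [] * G (a # w) + ((\<lambda>x. F (a # x)) \<star> G) w"

definition wone :: "'a list \<Rightarrow> 'b::comm_ring_1" where
  "wone w = (if w = [] then 1 else 0)"

text \<open>The antipode of the Hopf algebra of words, and at the same time the transpose of
  \<open>tau\<close>.\<close>

definition antip :: "('a list \<Rightarrow> 'b::comm_ring_1) \<Rightarrow> 'a list \<Rightarrow> 'b" where
  "antip F w = (- 1) ^ length w * F (rev w)"

lemma wone_Nil [simp]: "wone [] = 1"
  and wone_Cons [simp]: "wone (a # w) = 0"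
  by (simp_all add: wone_def)

lemma antip_Nil [simp]: "antip F [] = F []"
  by (simp add: antip_def)

lemma conv_add_left: "((\<lambda>x. F x + G x) \<star> H) w = (F \<star> H) w + (G \<star> H) w"
  by (induction w arbitrary: F G) (simp_all add: algebra_simps)

lemma conv_diff_left: "((\<lambda>x. F x - G x) \<star> H) w = (F \<star> H) w - (G \<star> H) w"
  by (induction w arbitrary: F G) (simp_all add: algebra_simps)

lemma conv_cmult_left: "((\<lambda>x. c * F x) \<star> H) w = c * (F \<star> H) w"
  by (induction w arbitrary: F) (simp_all add: algebra_simps)

lemma conv_uminus_left: "((\<lambda>x. - F x) \<star> H) w = - (F \<star> H) w"
  using conv_cmult_left[of "-1"] by simp

lemma conv_cmult_right: "(F \<star> (\<lambda>x. c * H x)) w = c * (F \<star> H) w"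
  by (induction w arbitrary: F) (simp_all add: algebra_simps)

lemma conv_uminus_right: "(F \<star> (\<lambda>x. - H x)) w = - (F \<star> H) w"
  using conv_cmult_right[of _ "-1"] by simp

lemma conv_zero_left [simp]: "((\<lambda>x. 0) \<star> H) w = 0"
  by (induction w) simp_all

lemma conv_zero_right [simp]: "(F \<star> (\<lambda>x. 0)) w = 0"
  using conv_cmult_right[of F 0] by simp

lemma conv_wone_left [simp]: "wone \<star> F = F"
proof
  show "(wone \<star> F) w = F w" for w
    by (cases w) simp_all
qed

lemma conv_wone_right [simp]: "F \<star> wone = F"
proof
  show "(F \<star> wone) w = F w" for w
    by (induction w arbitrary: F) simp_all
qed

lemma conv_assoc: "F \<star> G \<star> H = F \<star> (G \<star> H)"
proof
  show "(F \<star> G \<star> H) w = (F \<star> (G \<star> H)) w" for w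
    by (induction w arbitrary: F)
      (simp_all add: conv_add_left conv_cmult_left algebra_simps)
qed

lemma conv_snoc: "(F \<star> G) (w @ [b]) = F (w @ [b]) * G [] + (F \<star> (\<lambda>x. G (x @ [b]))) w"
  by (induction w arbitrary: F) (simp_all add: algebra_simps)

lemma antip_conv: "antip (F \<star> G) = antip G \<star> antip F"
proof
  show "antip (F \<star> G) w = (antip G \<star> antip F) w" for w
  proof (induction w arbitrary: G)
    case Nil
    then show ?case by simp
  next
    case (Cons a w)
    have "(\<lambda>x. antip G (a # x)) = (\<lambda>x. - antip (\<lambda>x. G (x @ [a])) x)"
      by (simp add: antip_def)
    then show ?case
      using Cons.IH[of "\<lambda>x. G (x @ [a])"]
      by (simp add: conv_uminus_left antip_def conv_snoc algebra_simps)
  qed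
qed

lemma antip_wone [simp]: "antip wone = wone"
  by (auto simp: antip_def wone_def)

lemma conv_cong:
  assumes "\<And>v. length v \<le> length w \<Longrightarrow> F v = F' v" "\<And>v. length v \<le> length w \<Longrightarrow> G v = G' v"
  shows "(F \<star> G) w = (F' \<star> G') w"
  using assms by (induction w arbitrary: F F') auto

text \<open>The coefficient of \<open>A \<star> X\<close> at \<open>w\<close> is \<open>X w\<close>
  plus a combination of values of \<open>X\<close> at proper suffixes of \<open>w\<close>, so
  induction on the length applies.\<close>

lemma conv_left_cancel:
  assumes "A [] = 1" "A \<star> X = A \<star> Y"
  shows "X = Y"
proof
  show "X w = Y w" for w
  proof (induction w rule: measure_induct_rule[where f = length])
    case (less w)
    show ?case
    proof (cases w)
      case Nil
      then show ?thesis using fun_cong[OF assms(2), of "[]"] assms(1) by simp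
    next
      case (Cons a v)
      have "((\<lambda>x. A (a # x)) \<star> X) v = ((\<lambda>x. A (a # x)) \<star> Y) v"
        using less Cons by (intro conv_cong) auto
      then show ?thesis using fun_cong[OF assms(2), of w] assms(1) Cons by simp
    qed
  qed
qed

lemma conv_inverse_commute:
  assumes "A [] = 1" "A \<star> B = wone"
  shows "B \<star> A = wone"
proof (rule conv_left_cancel[of A])
  show "A \<star> (B \<star> A) = A \<star> wone"
    using assms(2) by (simp flip: conv_assoc)
qed fact

lemma conv_hom:
  assumes "\<And>x y. h (x + y) = h x + h y" "\<And>x y. h (x * y) = h x * h y"
  shows "h ((F \<star> G) w) = ((\<lambda>v. h (F v)) \<star> (\<lambda>v. h (G v))) w"
  by (induction w arbitrary: F) (simp_all add: assms)

lemma has_field_derivative_conv: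
  fixes F G :: "'c::real_normed_field \<Rightarrow> 'a list \<Rightarrow> 'c"
  assumes "\<And>v. ((\<lambda>z. F z v) has_field_derivative F' v) (at x within A)"
    and "\<And>v. ((\<lambda>z. G z v) has_field_derivative G' v) (at x within A)"
  shows "((\<lambda>z. (F z \<star> G z) w) has_field_derivative (F' \<star> G x) w + (F x \<star> G') w) (at x within A)"
  using assms(1)
proof (induction w arbitrary: F F')
  case Nil
  then show ?case
    by (auto intro!: derivative_eq_intros assms(2) simp: algebra_simps)
next
  case (Cons a w)
  have "((\<lambda>z. ((\<lambda>x. F z (a # x)) \<star> G z) w) has_field_derivative
      ((\<lambda>x. F' (a # x)) \<star> G x) w + ((\<lambda>v. F x (a # v)) \<star> G') w) (at x within A)"
    by (rule Cons.IH) (rule Cons.prems)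
  then show ?case
    by (auto intro!: derivative_eq_intros assms(2) Cons.prems simp: algebra_simps)
qed

lemma has_vector_derivative_conv:
  fixes F G :: "real \<Rightarrow> 'a list \<Rightarrow> 'c::real_normed_field"
  assumes "\<And>v. ((\<lambda>z. F z v) has_vector_derivative F' v) (at x within A)"
    and "\<And>v. ((\<lambda>z. G z v) has_vector_derivative G' v) (at x within A)"
  shows "((\<lambda>z. (F z \<star> G z) w) has_vector_derivative (F' \<star> G x) w + (F x \<star> G') w) (at x within A)"
  using assms(1)
proof (induction w arbitrary: F F')
  case Nil
  then show ?case
    by (auto intro!: derivative_eq_intros assms(2) simp: algebra_simps)
next
  case (Cons a w)
  have "((\<lambda>z. ((\<lambda>x. F z (a # x)) \<star> G z) w) has_vector_derivative
      ((\<lambda>x. F' (a # x)) \<star> G x) w + ((\<lambda>v. F x (a # v)) \<star> G') w) (at x within A)"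
    by (rule Cons.IH) (rule Cons.prems)
  then show ?case
    by (auto intro!: derivative_eq_intros assms(2) Cons.prems simp: algebra_simps)
qed

lemma continuous_on_conv:
  fixes F G :: "'d::topological_space \<Rightarrow> 'a list \<Rightarrow> 'c::real_normed_field"
  assumes "\<And>v. continuous_on A (\<lambda>z. F z v)" "\<And>v. continuous_on A (\<lambda>z. G z v)"
  shows "continuous_on A (\<lambda>z. (F z \<star> G z) w)"
  using assms(1)
  by (induction w arbitrary: F) (auto intro!: continuous_intros assms(2))

text \<open>The transpose of \<^const>\<open>phi\<close>: the coefficient of \<open>w\<close> in \<open>subst_phi F\<close> is the value of the
  linear extension of \<open>F\<close> at \<open>phi w\<close>.\<close>

fun subst_phi :: "(letter list \<Rightarrow> 'b::comm_ring_1) \<Rightarrow> letter list \<Rightarrow> 'b" where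
  "subst_phi F [] = F []"
| "subst_phi F (E0 # w) = subst_phi (\<lambda>v. F (E0 # v)) w - subst_phi (\<lambda>v. F (E1 # v)) w"
| "subst_phi F (E1 # w) = - subst_phi (\<lambda>v. F (E1 # v)) w"

lemma subst_phi_add: "subst_phi (\<lambda>v. F v + G v) w = subst_phi F w + subst_phi G w"
  by (induction F w arbitrary: G rule: subst_phi.induct) simp_all

lemma subst_phi_cmult: "subst_phi (\<lambda>v. c * F v) w = c * subst_phi F w"
  by (induction F w rule: subst_phi.induct) (simp_all add: algebra_simps)

lemma subst_phi_zero [simp]: "subst_phi (\<lambda>v. 0) w = 0"
  using subst_phi_cmult[of 0] by simp

text \<open>\<open>phi\<close> sends letters to combinations of letters, hence is compatible with
  cutting a word in two.\<close>

lemma subst_phi_conv: "subst_phi (F \<star> G) = subst_phi F \<star> subst_phi G"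
proof
  show "subst_phi (F \<star> G) w = (subst_phi F \<star> subst_phi G) w" for w
  proof (induction w arbitrary: F)
    case (Cons a w)
    then show ?case
      by (cases a)
        (simp_all add: subst_phi_add subst_phi_cmult conv_diff_left conv_uminus_left algebra_simps)
  qed simp
qed

lemma has_field_derivative_subst_phi:
  fixes F :: "complex \<Rightarrow> letter list \<Rightarrow> complex"
  assumes "\<And>v. ((\<lambda>z. F z v) has_field_derivative F' v) (at x within A)"
  shows "((\<lambda>z. subst_phi (F z) w) has_field_derivative subst_phi F' w) (at x within A)"
  using assms
proof (induction w arbitrary: F F')
  case (Cons a w)
  then show ?case
    by (cases a) (auto intro!: derivative_eq_intros)
qed simp

section \<open>The differential equation\<close>

definition eta :: "complex \<Rightarrow> letter list \<Rightarrow> complex" where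
  "eta z w = (case w of [a] \<Rightarrow> 1 / (z - point a) | _ \<Rightarrow> 0)"

lemma eta_simps [simp]:
  "eta z [] = 0" "eta z [a] = 1 / (z - point a)" "eta z (a # b # w) = 0"
  by (simp_all add: eta_def)

lemma conv_eta [simp]:
  "(eta z \<star> F) [] = 0"
  "(eta z \<star> F) (a # w) = F w / (z - point a)"
proof -
  have "(\<lambda>x. eta z (a # x)) = (\<lambda>x. 1 / (z - point a) * wone x)"
  proof
    show "eta z (a # x) = 1 / (z - point a) * wone x" for x
      by (cases x) simp_all
  qed
  then show "(eta z \<star> F) (a # w) = F w / (z - point a)"
    by (simp only: conv.simps conv_cmult_left conv_wone_left eta_simps) simp
qed simp

text \<open>Only one-letter words occur, on which reversal is trivial and the sign is -1.\<close>

lemma antip_eta: "antip (eta z) w = - eta z w"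
proof (cases w)
  case (Cons a v)
  show ?thesis
  proof (cases v)
    case (Cons b u)
    obtain c d x where "rev w = c # d # x"
      by (metis Cons \<open>w = a # v\<close> length_rev length_Cons list.exhaust list.size(3) nat.inject nat.distinct(1))
    then show ?thesis using Cons \<open>w = a # v\<close> by (simp add: antip_def)
  qed (simp add: Cons antip_def)
qed (simp add: antip_def)

text \<open>In terms of generating series, \<open>F' = - (e\<^sub>0/z + e\<^sub>1/(z - 1)) F\<close>: the equation satisfied by
  iterated integrals as functions of their lower end point.\<close>

definition hol_sys :: "complex set \<Rightarrow> (complex \<Rightarrow> letter list \<Rightarrow> complex) \<Rightarrow> bool" where
  "hol_sys \<Omega> F \<longleftrightarrow>
     (\<forall>w. \<forall>z\<in>\<Omega>. ((\<lambda>z. F z w) has_field_derivative - (eta z \<star> F z) w) (at z))"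

lemma hol_sysD:
  "hol_sys \<Omega> F \<Longrightarrow> z \<in> \<Omega> \<Longrightarrow> ((\<lambda>z. F z w) has_field_derivative - (eta z \<star> F z) w) (at z)"
  by (simp add: hol_sys_def)

lemma hol_sys_subset: "hol_sys \<Omega> F \<Longrightarrow> \<Omega>' \<subseteq> \<Omega> \<Longrightarrow> hol_sys \<Omega>' F"
  by (auto simp: hol_sys_def)

lemma hol_sys_conv_right:
  assumes "hol_sys \<Omega> F"
  shows "hol_sys \<Omega> (\<lambda>z. F z \<star> C)"
  unfolding hol_sys_def
proof (intro allI ballI)
  fix w z assume "z \<in> \<Omega>"
  then have "((\<lambda>z. (F z \<star> C) w) has_field_derivative
      ((\<lambda>v. - (eta z \<star> F z) v) \<star> C) w + (F z \<star> (\<lambda>v. 0)) w) (at z)"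
    by (intro has_field_derivative_conv hol_sysD[OF assms]) auto
  then show "((\<lambda>z. (F z \<star> C) w) has_field_derivative - (eta z \<star> (F z \<star> C)) w) (at z)"
    by (simp add: conv_uminus_left conv_assoc)
qed

section \<open>Uniqueness and existence of holomorphic solutions\<close>

lemma deriv_zero_eq:
  fixes f :: "complex \<Rightarrow> complex"
  assumes "open \<Omega>" "connected \<Omega>" "\<And>z. z \<in> \<Omega> \<Longrightarrow> (f has_field_derivative 0) (at z)"
    "z0 \<in> \<Omega>" "z \<in> \<Omega>"
  shows "f z = f z0"
proof -
  have "f constant_on \<Omega>"
    using assms by (intro has_field_derivative_0_imp_constant_on) auto
  then show ?thesis using assms(4,5) by (auto simp: constant_on_def)
qed

text \<open>The system is triangular: the derivative of the coefficient at \<open>a # w\<close>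
  involves only the one at \<open>w\<close>. Once those agree, the next difference is
  constant.\<close>

lemma hol_sys_unique:
  assumes F: "hol_sys \<Omega> F" and G: "hol_sys \<Omega> G" and "open \<Omega>" "connected \<Omega>"
    and z0: "z0 \<in> \<Omega>" "F z0 = G z0" and z: "z \<in> \<Omega>"
  shows "F z = G z"
proof
  have "\<forall>z\<in>\<Omega>. F z w = G z w" for w
  proof (induction w)
    case Nil
    have "((\<lambda>z. F z [] - G z []) has_field_derivative 0) (at z)" if "z \<in> \<Omega>" for z
      using DERIV_diff[OF hol_sysD[OF F that, of "[]"] hol_sysD[OF G that, of "[]"]] by simp
    from deriv_zero_eq[OF \<open>open \<Omega>\<close> \<open>connected \<Omega>\<close> this z0(1)]
    have "F z [] - G z [] = F z0 [] - G z0 []" if "z \<in> \<Omega>" for z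
      using that by blast
    then show ?case using z0 by auto
  next
    case (Cons a w)
    have D: "((\<lambda>z. F z (a # w) - G z (a # w)) has_field_derivative 0) (at z)" if "z \<in> \<Omega>" for z
      using DERIV_diff[OF hol_sysD[OF F that, of "a # w"] hol_sysD[OF G that, of "a # w"]]
        Cons.IH that by (simp del: conv.simps)
    have "F z (a # w) - G z (a # w) = F z0 (a # w) - G z0 (a # w)" if "z \<in> \<Omega>" for z
      using deriv_zero_eq[OF \<open>open \<Omega>\<close> \<open>connected \<Omega>\<close> D z0(1)] that by blast
    then show ?case using z0 by auto
  qed
  then show "F z w = G z w" for w
    using z by blast
qed

lemma hol_sys_exists:
  fixes c :: "letter list \<Rightarrow> complex"
  assumes "open \<Omega>" "simply_connected \<Omega>" "0 \<notin> \<Omega>" "1 \<notin> \<Omega>" "z0 \<in> \<Omega>"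
  obtains F where "hol_sys \<Omega> F" "F z0 = c"
proof -
  \<comment> \<open>Here \<open>f\<close> is the coefficient already built for the tail
    \<open>w\<close>. The choice is left to \<open>SOME\<close> because a primitive is available
    only once \<open>f\<close> is known to be holomorphic, which is proved afterwards by
    induction.\<close>
  define F where "F = rec_list (\<lambda>z. c [])
    (\<lambda>a w f. SOME h. h z0 = c (a # w) \<and>
       (\<forall>z\<in>\<Omega>. (h has_field_derivative - f z / (z - point a)) (at z)))"
  have prim: "\<exists>h. h z0 = k \<and> (\<forall>z\<in>\<Omega>. (h has_field_derivative - f z / (z - point a)) (at z))"
    if "f holomorphic_on \<Omega>" for f k a
  proof -
    have "point a \<notin> \<Omega>" using assms by (cases a) auto
    then have "(\<lambda>z. - f z / (z - point a)) holomorphic_on \<Omega>"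
      using that by (intro holomorphic_intros) auto
    then obtain h where h: "\<And>z. z \<in> \<Omega> \<Longrightarrow> (h has_field_derivative - f z / (z - point a)) (at z)"
      using simply_connected_eq_global_primitive[OF assms(1)] assms(2) by blast
    then have "((\<lambda>z. h z + (k - h z0)) has_field_derivative - f z / (z - point a)) (at z)"
      if "z \<in> \<Omega>" for z
      using DERIV_add[OF h[OF that] DERIV_const[of "k - h z0"]] by simp
    then show ?thesis
      by (intro exI[of _ "\<lambda>z. h z + (k - h z0)"]) simp
  qed
  have prim_step: "F (a # w) z0 = c (a # w) \<and>
      (\<forall>z\<in>\<Omega>. (F (a # w) has_field_derivative - F w z / (z - point a)) (at z))"
    if "F w holomorphic_on \<Omega>" for a w
    using someI_ex[OF prim[OF that, of "c (a # w)" a]] by (simp add: F_def)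
  have Nil: "F [] = (\<lambda>z. c [])"
    by (simp add: F_def)
  have hol: "F w holomorphic_on \<Omega>" for w
  proof (induction w)
    case Nil
    then show ?case by (simp add: \<open>F [] = _\<close>)
  next
    case (Cons a w)
    then have "(F (a # w) has_field_derivative - F w z / (z - point a)) (at z)" if "z \<in> \<Omega>" for z
      using prim_step[of w a] that by blast
    then show ?case
      unfolding holomorphic_on_def field_differentiable_def
      by (blast intro: has_field_derivative_at_within)
  qed
  have "hol_sys \<Omega> (\<lambda>z w. F w z)"
    unfolding hol_sys_def
  proof (intro allI ballI)
    fix w z assume z: "z \<in> \<Omega>"
    show "((\<lambda>z. F w z) has_field_derivative - (eta z \<star> (\<lambda>w. F w z)) w) (at z)"
    proof (cases w)
      case Nil
      then show ?thesis using \<open>F [] = _\<close> by simp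
    next
      case (Cons a v)
      then show ?thesis using prim_step[OF hol, of a v] z by (simp del: conv.simps)
    qed
  qed
  moreover have "(\<lambda>w. F w z0) = c"
  proof
    fix w
    show "F w z0 = c w"
      using prim_step[OF hol] Nil by (cases w) auto
  qed
  ultimately show ?thesis using that by blast
qed

text \<open>By \<open>antip_eta\<close>, \<open>antip F\<close> solves the adjoint equation with
  \<open>eta\<close> acting from the right; the two terms of the product rule cancel.\<close>

lemma hol_sys_antip_const:
  assumes F: "hol_sys \<Omega> F" and G: "hol_sys \<Omega> G" and "open \<Omega>" "connected \<Omega>"
    and z: "z0 \<in> \<Omega>" "z \<in> \<Omega>"
  shows "antip (F z) \<star> G z = antip (F z0) \<star> G z0"
proof
  fix w
  have "((\<lambda>z. (antip (F z) \<star> G z) w) has_field_derivative 0) (at z)" if "z \<in> \<Omega>" for z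
  proof -
    have "((\<lambda>z. antip (F z) v) has_field_derivative (antip (F z) \<star> eta z) v) (at z)" for v
    proof -
      have "((\<lambda>z. antip (F z) v) has_field_derivative - antip (eta z \<star> F z) v) (at z)"
        unfolding antip_def by (rule derivative_eq_intros hol_sysD[OF F that] refl)+ simp
      moreover have "antip (eta z) = (\<lambda>w. - eta z w)"
        by (rule ext) (rule antip_eta)
      ultimately show ?thesis
        by (simp add: antip_conv conv_uminus_right)
    qed
    then have "((\<lambda>z. (antip (F z) \<star> G z) w) has_field_derivative
        (antip (F z) \<star> eta z \<star> G z) w + (antip (F z) \<star> (\<lambda>v. - (eta z \<star> G z) v)) w) (at z)"
      by (intro has_field_derivative_conv hol_sysD[OF G that])
    then show ?thesis by (simp add: conv_uminus_right conv_assoc)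
  qed
  from deriv_zero_eq[OF \<open>open \<Omega>\<close> \<open>connected \<Omega>\<close> this z]
  show "(antip (F z) \<star> G z) w = (antip (F z0) \<star> G z0) w" .
qed


text \<open>\<open>plane0\<close> and \<open>plane1\<close> are simply connected domains of \<open>\<complex> - {0, 1}\<close>; they overlap in the upper
  and in the lower half plane.\<close>

definition plane :: "complex set" where
  "plane = - {z. Im z = 0 \<and> 1 \<le> Re z}"

definition plane0 :: "complex set" where
  "plane0 = - {z. Im z = 0 \<and> (Re z \<le> 0 \<or> 1 \<le> Re z)}"

definition plane1 :: "complex set" where
  "plane1 = - {z. Im z = 0 \<and> Re z \<le> 1}"

lemma open_planes [simp]: "open plane" "open plane0" "open plane1"
  unfolding plane_def plane0_def plane1_def open_closed double_complement
  by (intro closed_Collect_conj closed_Collect_disj closed_Collect_eq closed_Collect_le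
      continuous_intros)+

lemma starlike_plane: "starlike plane"
  unfolding starlike_def
proof (intro bexI ballI subsetI)
  show "0 \<in> plane" by (simp add: plane_def)
  fix x y assume x: "x \<in> plane" and "y \<in> closed_segment 0 x"
  then obtain u where u: "0 \<le> u" "u \<le> 1" "y = of_real u * x"
    by (auto simp: in_segment scaleR_conv_of_real)
  show "y \<in> plane"
  proof (rule ccontr)
    assume "y \<notin> plane"
    then have *: "u * Im x = 0" "1 \<le> u * Re x" using u by (auto simp: plane_def)
    then have "Im x = 0" by auto
    moreover have "1 \<le> Re x"
      using * u by (metis mult_left_le_one_le mult_nonneg_nonneg order_trans zero_le_one mult_le_0_iff not_one_le_zero linorder_linear)
    ultimately show False using x by (auto simp: plane_def)
  qed
qed

lemma starlike_plane0: "starlike plane0"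
  unfolding starlike_def
proof (intro bexI ballI subsetI)
  show "1 / 2 \<in> plane0" by (simp add: plane0_def)
  fix x y assume x: "x \<in> plane0" and "y \<in> closed_segment (1 / 2) x"
  then obtain u where u: "0 \<le> u" "u \<le> 1" "y = (1 - of_real u) * (1 / 2) + of_real u * x"
    by (auto simp: in_segment scaleR_conv_of_real)
  show "y \<in> plane0"
  proof (rule ccontr)
    assume "y \<notin> plane0"
    then have *: "u * Im x = 0" "(1 - u) / 2 + u * Re x \<le> 0 \<or> 1 \<le> (1 - u) / 2 + u * Re x"
      using u by (auto simp: plane0_def)
    then have "u \<noteq> 0" "Im x = 0" by auto
    then have "0 < Re x" "Re x < 1" using x by (auto simp: plane0_def)
    then have "u * Re x < u * 1" "0 < u * Re x"
      using \<open>u \<noteq> 0\<close> u by (auto intro!: mult_strict_left_mono)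
    moreover define p where "p = u * Re x"
    ultimately have "p < u" "0 < p" "(1 - u) / 2 + p \<le> 0 \<or> 1 \<le> (1 - u) / 2 + p"
      using *(2) by simp_all
    then show False using u(2) by (auto simp: field_simps)
  qed
qed

lemma starlike_plane1: "starlike plane1"
  unfolding starlike_def
proof (intro bexI ballI subsetI)
  show "2 \<in> plane1" by (simp add: plane1_def)
  fix x y assume x: "x \<in> plane1" and "y \<in> closed_segment 2 x"
  then obtain u where u: "0 \<le> u" "u \<le> 1" "y = (1 - of_real u) * 2 + of_real u * x"
    by (auto simp: in_segment scaleR_conv_of_real)
  show "y \<in> plane1"
  proof (rule ccontr)
    assume "y \<notin> plane1"
    then have *: "u * Im x = 0" "(1 - u) * 2 + u * Re x \<le> 1"
      using u by (auto simp: plane1_def)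
    then have "u \<noteq> 0" "Im x = 0" by auto
    then have "1 < Re x" using x by (auto simp: plane1_def)
    then have "u * 1 < u * Re x"
      using \<open>u \<noteq> 0\<close> u by (intro mult_strict_left_mono) auto
    then show False using * u by (auto simp: algebra_simps)
  qed
qed

lemma connected_planes [simp]: "connected plane0" "connected plane1"
  using starlike_plane0 starlike_plane1 starlike_imp_connected by auto

lemma simply_connected_planes: "simply_connected plane" "simply_connected plane0" "simply_connected plane1"
  using starlike_plane starlike_plane0 starlike_plane1 starlike_imp_simply_connected by auto

text \<open>The solution of \<open>V' = V e\<^sub>0/z - (e\<^sub>0/z + e\<^sub>1/(z - 1)) V\<close> that is holomorphic at \<open>0\<close> with value \<open>1\<close>:
  the solution normalized at the tangential base point is \<open>V\<close> times \<open>exp (- e\<^sub>0 log z)\<close>.\<close>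

function reg_part :: "letter list \<Rightarrow> complex \<Rightarrow> complex" where
  "reg_part w =
    (if w = [] then (\<lambda>z. 1) else SOME h. h holomorphic_on plane \<and> h 0 = 0 \<and>
       (\<forall>z\<in>plane - {0}. (h has_field_derivative
          ((if last w = E0 then reg_part (butlast w) z else 0)
            - (if hd w = E0 then reg_part (tl w) z else 0)) / z
          - (if hd w = E1 then reg_part (tl w) z else 0) / (z - 1)) (at z)))"
  by pat_completeness auto
termination
  by (relation "Wellfounded.measure length") auto

declare reg_part.simps [simp del]

lemma reg_part_Nil [simp]: "reg_part [] = (\<lambda>z. 1)"
  by (simp add: reg_part.simps)

text \<open>Since \<open>n 0 = 0\<close>, the quotient \<open>n z / z\<close> has a removable
  singularity. The integrand is thus holomorphic on \<open>plane\<close>, which contains 0, omits 1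
  and is simply connected.\<close>

lemma reg_part_exists:
  assumes "n holomorphic_on plane" "n 0 = 0" "m holomorphic_on plane"
  shows "\<exists>h. h holomorphic_on plane \<and> h 0 = 0 \<and>
       (\<forall>z\<in>plane - {0}. (h has_field_derivative n z / z - m z / (z - 1)) (at z))"
proof -
  define q where "q z = (if z = 0 then deriv n 0 else (n z - n 0) / (z - 0)) - m z / (z - 1)" for z
  have "0 \<in> interior plane"
    by (simp add: interior_open) (simp add: plane_def)
  then have "(\<lambda>z. if z = 0 then deriv n 0 else (n z - n 0) / (z - 0)) holomorphic_on plane"
    by (rule pole_lemma[OF assms(1)])
  moreover have "z - 1 \<noteq> 0" if "z \<in> plane" for z using that by (auto simp: plane_def)
  then have "(\<lambda>z. m z / (z - 1)) holomorphic_on plane"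
    by (intro holomorphic_on_divide assms holomorphic_on_diff holomorphic_on_ident holomorphic_on_const)
  ultimately have "q holomorphic_on plane"
    unfolding q_def by (rule holomorphic_on_diff)
  then obtain h where h: "\<And>z. z \<in> plane \<Longrightarrow> (h has_field_derivative q z) (at z)"
    using simply_connected_eq_global_primitive[OF open_planes(1)] simply_connected_planes(1) by blast
  have "((\<lambda>z. h z + (- h 0)) has_field_derivative q z) (at z)" if "z \<in> plane" for z
    using DERIV_add[OF h[OF that] DERIV_const[of "- h 0"]] by simp
  then have h': "\<And>z. z \<in> plane \<Longrightarrow> ((\<lambda>z. h z - h 0) has_field_derivative q z) (at z)"
    by simp
  show ?thesis
  proof (intro exI[of _ "\<lambda>z. h z - h 0"] conjI ballI)
    show "(\<lambda>z. h z - h 0) holomorphic_on plane"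
      unfolding holomorphic_on_def field_differentiable_def
      by (blast intro: has_field_derivative_at_within h')
    show "((\<lambda>z. h z - h 0) has_field_derivative n z / z - m z / (z - 1)) (at z)"
      if "z \<in> plane - {0}" for z
      using h'[of z] that assms(2) by (simp add: q_def)
  qed simp
qed

lemma reg_part_props:
  "reg_part w holomorphic_on plane \<and> reg_part w 0 = wone w \<and>
    (w \<noteq> [] \<longrightarrow> (\<forall>z\<in>plane - {0}. (reg_part w has_field_derivative
          ((if last w = E0 then reg_part (butlast w) z else 0)
            - (if hd w = E0 then reg_part (tl w) z else 0)) / z
          - (if hd w = E1 then reg_part (tl w) z else 0) / (z - 1)) (at z)))"
proof (induction w rule: measure_induct_rule[where f = length])
  case (less w)
  show ?case
  proof (cases "w = []")
    case False
    have IH: "reg_part v holomorphic_on plane" "reg_part v 0 = wone v" if "v \<in> {butlast w, tl w}" for v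
    proof -
      have "length v < length w" using that False by auto
      from less[OF this] show "reg_part v holomorphic_on plane" "reg_part v 0 = wone v" by blast+
    qed
    have hol: "(\<lambda>z. if P then reg_part v z else 0) holomorphic_on plane"
      if "v \<in> {butlast w, tl w}" for P v
      using IH(1)[OF that] by (cases P) simp_all
    \<comment> \<open>At 0 only empty words contribute to the numerator over \<open>z\<close>. If
      \<open>w\<close> is a single letter, both shortened words are empty and cancel because first
      and last letter coincide; otherwise both terms vanish.\<close>
    have "wone (butlast w) = (wone (tl w) :: complex)" "butlast w = [] \<Longrightarrow> last w = hd w"
      using False by (cases w; auto simp: wone_def)+
    moreover have "hd w \<noteq> last w \<Longrightarrow> wone (tl w) = (0 :: complex)"
      using False by (cases w) (auto simp: wone_def)
    ultimately have "\<exists>h. h holomorphic_on plane \<and> h 0 = 0 \<and>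
       (\<forall>z\<in>plane - {0}. (h has_field_derivative
          ((if last w = E0 then reg_part (butlast w) z else 0)
            - (if hd w = E0 then reg_part (tl w) z else 0)) / z
          - (if hd w = E1 then reg_part (tl w) z else 0) / (z - 1)) (at z))"
      by (intro reg_part_exists holomorphic_on_diff hol) (auto simp: IH)
    from someI_ex[OF this, folded trans[OF reg_part.simps if_not_P[OF False]]] False show ?thesis
      by (simp add: wone_def)
  qed simp
qed

lemmas holomorphic_reg_part = reg_part_props[THEN conjunct1]
  and reg_part_0 = reg_part_props[THEN conjunct2, THEN conjunct1]

definition wE0 :: "letter list \<Rightarrow> complex" where
  "wE0 w = (if w = [E0] then 1 else 0)"

lemma conv_wE0_left: "(wE0 \<star> F) [] = 0" "(wE0 \<star> F) (a # w) = (if a = E0 then F w else 0)"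
proof -
  have "(\<lambda>x. wE0 (a # x)) = (\<lambda>x. (if a = E0 then 1 else 0) * wone x)"
    by (auto simp: wE0_def wone_def)
  then show "(wE0 \<star> F) (a # w) = (if a = E0 then F w else 0)"
    by (simp only: conv.simps conv_cmult_left conv_wone_left) (simp add: wE0_def)
qed (simp add: wE0_def)

lemma conv_wE0_right: "(F \<star> wE0) [] = 0" "(F \<star> wE0) (w @ [a]) = (if a = E0 then F w else 0)"
proof -
  have "(\<lambda>x. wE0 (x @ [a])) = (\<lambda>x. (if a = E0 then 1 else 0) * wone x)"
    by (auto simp: wE0_def wone_def)
  then show "(F \<star> wE0) (w @ [a]) = (if a = E0 then F w else 0)"
    by (simp only: conv_snoc conv_cmult_right conv_wone_right) (simp add: wE0_def)
qed (simp add: wE0_def)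

lemma reg_part_deriv:
  assumes z: "z \<in> plane0"
  shows "(reg_part w has_field_derivative
    ((\<lambda>v. reg_part v z) \<star> wE0) w / z - (eta z \<star> (\<lambda>v. reg_part v z)) w) (at z)"
proof (cases w)
  case Nil
  then show ?thesis by (simp add: wE0_def)
next
  case (Cons a u)
  have z': "z \<in> plane - {0}" using z by (auto simp: plane0_def plane_def)
  obtain v b where vb: "w = v @ [b]" using Cons by (metis list.distinct(1) rev_exhaust)
  have 1: "((\<lambda>v. reg_part v z) \<star> wE0) w =
      (if last w = E0 then reg_part (butlast w) z else 0)"
    by (simp add: vb conv_wE0_right)
  have 2: "(eta z \<star> (\<lambda>v. reg_part v z)) w =
      (if hd w = E0 then reg_part (tl w) z else 0) / z + (if hd w = E1 then reg_part (tl w) z else 0) / (z - 1)"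
    by (cases a) (simp_all add: Cons del: conv.simps)
  show ?thesis
    using reg_part_props[of w] z' Cons unfolding 1 2
    by (simp add: diff_divide_distrib diff_diff_eq del: conv.simps)
qed

text \<open>The series \<open>exp (- l e\<^sub>0)\<close>, with coefficients polynomial in \<open>l\<close>.\<close>

definition lam_poly :: "letter list \<Rightarrow> complex poly" where
  "lam_poly w = (if set w \<subseteq> {E0} then smult (1 / fact (length w)) ([:0, -1:] ^ length w) else 0)"

definition lam :: "complex \<Rightarrow> letter list \<Rightarrow> complex" where
  "lam l w = poly (lam_poly w) l"

lemma lam_altdef: "lam l w = (if set w \<subseteq> {E0} then (- l) ^ length w / fact (length w) else 0)"
  by (simp add: lam_def lam_poly_def poly_power)

lemma lam_deriv: "((\<lambda>l. lam l w) has_field_derivative - (wE0 \<star> lam l) w) (at l)"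
proof (cases w)
  case Nil
  then show ?thesis by (simp add: lam_altdef wE0_def)
next
  case (Cons a v)
  have "((\<lambda>l::complex. (- l) ^ Suc n / fact (Suc n)) has_field_derivative - ((- l) ^ n / fact n)) (at l)" for n
    by (rule derivative_eq_intros refl fact_nonzero)+
      (simp add: fact_Suc field_simps del: of_nat_Suc)
  then show ?thesis
    by (simp add: Cons lam_altdef conv_wE0_left del: conv.simps)
qed

definition sol0 :: "complex \<Rightarrow> letter list \<Rightarrow> complex" where
  "sol0 z = (\<lambda>w. reg_part w z) \<star> lam (Ln z)"

text \<open>The derivative of \<open>lam (Ln z)\<close> inserts - e_0/z between the two factors,
  cancelling the extra right term in the equation for \<open>reg_part\<close>.\<close>

lemma hol_sys_sol0: "hol_sys plane0 sol0"
  unfolding hol_sys_def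
proof (intro allI ballI)
  fix w z assume z: "z \<in> plane0"
  have "z \<notin> \<real>\<^sub>\<le>\<^sub>0" using z by (auto simp: plane0_def complex_nonpos_Reals_iff)
  then have "((\<lambda>z. lam (Ln z) v) has_field_derivative (- 1 / z) * (wE0 \<star> lam (Ln z)) v) (at z)" for v
    using DERIV_chain2[OF lam_deriv[of v "Ln z"] has_field_derivative_Ln[of z]]
    by (simp add: field_simps)
  then have "((\<lambda>z. ((\<lambda>w. reg_part w z) \<star> lam (Ln z)) w) has_field_derivative
     ((\<lambda>v. (1 / z) * ((\<lambda>v. reg_part v z) \<star> wE0) v - (eta z \<star> (\<lambda>v. reg_part v z)) v) \<star> lam (Ln z)) w
     + ((\<lambda>w. reg_part w z) \<star> (\<lambda>v. (- 1 / z) * (wE0 \<star> lam (Ln z)) v)) w) (at z)"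
    using reg_part_deriv[OF z] by (intro has_field_derivative_conv) simp_all
  then show "((\<lambda>z. sol0 z w) has_field_derivative - (eta z \<star> sol0 z) w) (at z)"
    unfolding conv_diff_left conv_cmult_left conv_cmult_right conv_assoc
    by (simp add: sol0_def)
qed

section \<open>Logarithmic asymptotics at the base point\<close>

text \<open>One number \<open>d\<close> bounds both the degree in \<open>ln t\<close> and the power
  of \<open>ln t\<close> in the error. It will be the word length, so bounds add up under
  \<open>\<star>\<close>.\<close>

definition asy :: "nat \<Rightarrow> (real \<Rightarrow> complex) \<Rightarrow> complex poly \<Rightarrow> bool" where
  "asy d f p \<longleftrightarrow> degree p \<le> d \<and>
     (\<lambda>t. f t - poly p (of_real (ln t))) \<in> O[at_right 0](\<lambda>t. of_real (t * ln t ^ d))"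

lemma ln_power_bigo:
  assumes "d \<le> e"
  shows "(\<lambda>t. of_real (ln t ^ d) :: complex) \<in> O[at_right 0](\<lambda>t. of_real (ln t ^ e))"
proof (rule bigoI[where c = 1])
  \<comment> \<open>Beyond absolute value 1, powers of the logarithm increase with the
    exponent.\<close>
  have "eventually (\<lambda>t::real. ln t < - 1) (at_right 0)"
    by real_asymp
  then show "eventually (\<lambda>t. norm (of_real (ln t ^ d) :: complex) \<le> 1 * norm (of_real (ln t ^ e) :: complex)) (at_right 0)"
    by eventually_elim (use assms in \<open>auto simp: norm_power power_increasing\<close>)
qed

lemma t_ln_power_bigo:
  assumes "d \<le> e"
  shows "(\<lambda>t. of_real (t * ln t ^ d) :: complex) \<in> O[at_right 0](\<lambda>t. of_real (t * ln t ^ e))"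
  unfolding of_real_mult by (intro landau_o.big.mult ln_power_bigo assms) simp

lemma poly_ln_bigo:
  assumes "degree p \<le> d"
  shows "(\<lambda>t. poly p (of_real (ln t)) :: complex) \<in> O[at_right 0](\<lambda>t. of_real (ln t ^ d))"
  unfolding poly_altdef
proof (rule big_sum_in_bigo)
  fix i assume "i \<in> {..degree p}"
  then have "(\<lambda>t. coeff p i * of_real (ln t ^ i)) \<in> O[at_right 0](\<lambda>t. of_real (ln t ^ d) :: complex)"
    using ln_power_bigo[of i d] assms by (auto intro: landau_o.big.mult_in_1)
  then show "(\<lambda>t. coeff p i * of_real (ln t) ^ i) \<in> O[at_right 0](\<lambda>t. of_real (ln t ^ d) :: complex)"
    by simp
qed

lemma asy_const [simp]: "asy d (\<lambda>t. c) [:c:]"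
  by (simp add: asy_def)

lemma asy_add: "asy d f p \<Longrightarrow> asy d g q \<Longrightarrow> asy d (\<lambda>t. f t + g t) (p + q)"
  unfolding asy_def using sum_in_bigo(1)[of "\<lambda>t. f t - poly p (of_real (ln t))" _ _ "\<lambda>t. g t - poly q (of_real (ln t))"]
  by (auto simp: degree_add_le algebra_simps)

lemma asy_bigo:
  assumes "asy d f p"
  shows "f \<in> O[at_right 0](\<lambda>t. of_real (ln t ^ d))"
proof -
  have "(\<lambda>t. of_real t * of_real (ln t ^ d) :: complex) \<in> O[at_right 0](\<lambda>t. 1 * of_real (ln t ^ d))"
  proof (rule landau_o.big.mult)
    have "eventually (\<lambda>t::real. t \<in> {0<..<1}) (at_right 0)"
      by (rule eventually_at_right_real) simp
    then have "eventually (\<lambda>t::real. norm (of_real t :: complex) \<le> 1 * norm (1 :: complex)) (at_right 0)"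
      by eventually_elim auto
    then show "(\<lambda>t. of_real t :: complex) \<in> O[at_right 0](\<lambda>_. 1)"
      by (rule bigoI)
  qed simp
  then have "(\<lambda>t. f t - poly p (of_real (ln t))) \<in> O[at_right 0](\<lambda>t. of_real (ln t ^ d))"
    using assms by (auto simp: asy_def elim: landau_o.big_trans)
  from sum_in_bigo(1)[OF this poly_ln_bigo[of p d]] show ?thesis
    using assms by (simp add: asy_def)
qed

lemma asy_mult:
  assumes "asy d f p" "asy e g q"
  shows "asy (d + e) (\<lambda>t. f t * g t) (p * q)"
proof -
  have "(\<lambda>t. (f t - poly p (of_real (ln t))) * g t) \<in> O[at_right 0](\<lambda>t. of_real (t * ln t ^ d) * of_real (ln t ^ e))"
    using assms(1) asy_bigo[OF assms(2)] by (intro landau_o.big.mult) (auto simp: asy_def)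
  moreover have "(\<lambda>t. poly p (of_real (ln t)) * (g t - poly q (of_real (ln t)))) \<in>
      O[at_right 0](\<lambda>t. of_real (ln t ^ d) * of_real (t * ln t ^ e))"
    using assms by (intro landau_o.big.mult poly_ln_bigo) (auto simp: asy_def)
  ultimately have "(\<lambda>t. f t * g t - poly (p * q) (of_real (ln t))) \<in> O[at_right 0](\<lambda>t. of_real (t * ln t ^ (d + e)))"
    using sum_in_bigo(1) by (fastforce simp: power_add algebra_simps)
  moreover have "degree (p * q) \<le> d + e"
    using degree_mult_le[of p q] assms by (auto simp: asy_def)
  ultimately show ?thesis by (simp add: asy_def)
qed

lemma asy_cmult: "asy d f p \<Longrightarrow> asy d (\<lambda>t. c * f t) ([:c:] * p)"
  using asy_mult[OF asy_const[of 0 c]] by fastforce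

lemma asy_uminus: "asy d f p \<Longrightarrow> asy d (\<lambda>t. - f t) (- p)"
  using asy_cmult[of d f p "-1"] by simp

lemma asy_diff: "asy d f p \<Longrightarrow> asy d g q \<Longrightarrow> asy d (\<lambda>t. f t - g t) (p - q)"
  using asy_add[OF _ asy_uminus] by fastforce

lemma asy_power: "asy 1 f p \<Longrightarrow> asy n (\<lambda>t. f t ^ n) (p ^ n)"
proof (induction n)
  case 0
  then show ?case using asy_const[of 0 1] by (simp add: one_pCons)
next
  case (Suc n)
  then show ?case using asy_mult[of 1 f p n] by simp
qed

lemma asy_conv:
  assumes "\<And>v. asy (length v) (\<lambda>t. F t v) (P v)" "\<And>v. asy (length v) (\<lambda>t. G t v) (Q v)"
  shows "asy (length w) (\<lambda>t. (F t \<star> G t) w) ((P \<star> Q) w)"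
proof -
  \<comment> \<open>The recursion strips letters from the left factor only, whose bounds still count
    them; \<open>m\<close> is the number of letters removed so far.\<close>
  have "asy (m + length w) (\<lambda>t. (F t \<star> G t) w) ((P \<star> Q) w)"
    if "\<And>v. asy (m + length v) (\<lambda>t. F t v) (P v)" for m and F :: "real \<Rightarrow> 'a list \<Rightarrow> complex" and P
    using that
  proof (induction w arbitrary: m F P)
    case Nil
    then show ?case using asy_mult[OF Nil[of "[]"] assms(2)[of "[]"]] by simp
  next
    case (Cons a w)
    have "asy (Suc m + length w) (\<lambda>t. ((\<lambda>x. F t (a # x)) \<star> G t) w) (((\<lambda>x. P (a # x)) \<star> Q) w)"
      using Cons.prems[of "a # _"] by (intro Cons.IH) simp
    then show ?case
      using asy_add[OF asy_mult[OF Cons.prems[of "[]"] assms(2)[of "a # w"]]] by simp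
  qed
  from this[of 0] assms(1) show ?thesis by simp
qed

lemma asy_antip:
  assumes "\<And>v. asy (length v) (\<lambda>t. F t v) (P v)"
  shows "asy (length w) (\<lambda>t. antip (F t) w) (antip P w)"
  using assms[of "rev w"] asy_uminus[OF assms[of "rev w"]]
  by (cases "even (length w)") (simp_all add: antip_def)

lemma asy_subst_phi:
  assumes "\<And>v. asy (length v) (\<lambda>t. F t v) (P v)"
  shows "asy (length w) (\<lambda>t. subst_phi (F t) w) (subst_phi P w)"
proof -
  have "asy (m + length w) (\<lambda>t. subst_phi (F t) w) (subst_phi P w)"
    if "\<And>v. asy (m + length v) (\<lambda>t. F t v) (P v)" for m F P
    using that
  proof (induction w arbitrary: m F P)
    case (Cons a w)
    have "asy (Suc m + length w) (\<lambda>t. subst_phi (\<lambda>x. F t (b # x)) w) (subst_phi (\<lambda>x. P (b # x)) w)" for b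
      using Cons.prems[of "b # _"] by (intro Cons.IH) simp
    then show ?case
      by (cases a) (auto intro!: asy_diff asy_uminus)
  next
    case Nil
    then show ?case using Nil[of "[]"] by simp
  qed
  from this[of 0] assms(1) show ?thesis by simp
qed

text \<open>As \<open>t\<close> tends to 0, \<open>ln t\<close> tends to minus infinity, where a
  nonconstant polynomial is unbounded.\<close>

lemma poly_ln_tendsto_0:
  assumes "((\<lambda>t. poly r (of_real (ln t)) :: complex) \<longlongrightarrow> 0) (at_right 0)"
  shows "r = 0"
proof (cases r)
  case (pCons a p)
  show ?thesis
  proof (cases "p = 0")
    case True
    then show ?thesis using assms pCons by (simp add: tendsto_const_iff)
  next
    case False
    then obtain R where R: "\<And>z. R \<le> norm z \<Longrightarrow> 1 \<le> norm (poly r z)"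
      using poly_infinity[of p 1 a] pCons by auto
    have "eventually (\<lambda>t::real. ln t < - \<bar>R\<bar>) (at_right 0)"
      by real_asymp
    moreover have "eventually (\<lambda>t::real. norm (poly r (of_real (ln t))) < 1) (at_right 0)"
      using tendstoD[OF assms, of 1] by simp
    ultimately have "eventually (\<lambda>t::real. False) (at_right 0)"
    proof eventually_elim
      case (elim t)
      then have "R \<le> norm (of_real (ln t) :: complex)" by simp
      from R[OF this] elim show ?case by linarith
    qed
    then show ?thesis by simp
  qed
qed

lemma t_ln_tendsto_0:
  assumes "f \<in> O[at_right 0](\<lambda>t. of_real (t * ln t ^ d) :: complex)"
  shows "(f \<longlongrightarrow> 0) (at_right 0)"
proof -
  have "((\<lambda>t::real. t * ln t ^ d) \<longlongrightarrow> 0) (at_right 0)"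
    by real_asymp
  then have "((\<lambda>t. of_real (t * ln t ^ d) :: complex) \<longlongrightarrow> 0) (at_right 0)"
    using tendsto_of_real by fastforce
  then have "(\<lambda>t. of_real (t * ln t ^ d) :: complex) \<in> o[at_right 0](\<lambda>_. 1)"
    by (intro smalloI_tendsto) auto
  from landau_o.big_small_trans[OF assms this] show ?thesis
    by (auto dest: smalloD_tendsto)
qed

lemma asy_unique:
  assumes "asy d f p" "asy e f q"
  shows "p = q"
proof -
  have "((\<lambda>t. (f t - poly q (of_real (ln t))) - (f t - poly p (of_real (ln t)))) \<longlongrightarrow> 0 - 0) (at_right 0)"
    using assms by (intro tendsto_diff t_ln_tendsto_0) (auto simp: asy_def)
  then have "((\<lambda>t. poly (p - q) (of_real (ln t))) \<longlongrightarrow> 0) (at_right 0)"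
    by simp
  then show ?thesis using poly_ln_tendsto_0 by fastforce
qed

lemma asy_cong:
  assumes "eventually (\<lambda>t. f t = g t) (at_right 0)" "asy d f p"
  shows "asy d g p"
proof -
  have "(\<lambda>t. g t - poly p (of_real (ln t))) \<in> O[at_right 0](\<lambda>t. of_real (t * ln t ^ d))
    \<longleftrightarrow> (\<lambda>t. f t - poly p (of_real (ln t))) \<in> O[at_right 0](\<lambda>t. of_real (t * ln t ^ d))"
    by (rule landau_o.big.in_cong) (use assms(1) in eventually_elim, simp)
  then show ?thesis using assms(2) by (simp add: asy_def)
qed

section \<open>Curves approaching the base point\<close>

lemma field_differentiable_bigo:
  fixes f :: "complex \<Rightarrow> complex"
  assumes f: "f field_differentiable (at a)"
    and g: "(\<lambda>t. g t - a) \<in> O[at_right 0](\<lambda>t. of_real t)"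
  shows "(\<lambda>t. f (g t) - f a) \<in> O[at_right 0](\<lambda>t. of_real t)"
proof -
  from f obtain D where "(f has_field_derivative D) (at a)"
    by (auto simp: field_differentiable_def)
  then have "((\<lambda>z. (f z - f a) / (z - a)) \<longlongrightarrow> D) (at a)"
    by (simp add: has_field_derivative_iff)
  then have "eventually (\<lambda>z. norm ((f z - f a) / (z - a) - D) < 1) (at a)"
    using tendstoD[of _ D "at a" 1] by (simp add: dist_norm)
  then have ev: "eventually (\<lambda>z. norm (f z - f a) \<le> (1 + norm D) * norm (z - a)) (nhds a)"
    unfolding eventually_at_filter
  proof eventually_elim
    case (elim z)
    show ?case
    proof (cases "z = a")
      case False
      then have "norm ((f z - f a) / (z - a)) \<le> 1 + norm D"
        using elim norm_triangle_sub[of "(f z - f a) / (z - a)" D] by auto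
      then show ?thesis using False by (simp add: norm_divide field_simps)
    qed simp
  qed
  have "((\<lambda>t. g t - a) \<longlongrightarrow> 0) (at_right 0)"
    using g t_ln_tendsto_0[of _ 0] by simp
  then have "filterlim g (nhds a) (at_right 0)"
    by (rule LIM_zero_cancel)
  from eventually_compose_filterlim[OF ev this]
  have "(\<lambda>t. f (g t) - f a) \<in> O[at_right 0](\<lambda>t. g t - a)"
    by (rule bigoI)
  then show ?thesis using g by (rule landau_o.big_trans)
qed

text \<open>\<open>\<zeta>\<close> leaves \<open>0\<close> in the direction \<open>exp \<kappa>\<close>.\<close>

definition tangential :: "(real \<Rightarrow> complex) \<Rightarrow> complex \<Rightarrow> bool" where
  "tangential \<zeta> \<kappa> \<longleftrightarrow> \<zeta> \<in> O[at_right 0](\<lambda>t. of_real t) \<and>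
     (\<lambda>t. Ln (\<zeta> t) - of_real (ln t) - \<kappa>) \<in> O[at_right 0](\<lambda>t. of_real t)"

text \<open>For \<open>t > 0\<close> the principal logarithm of \<open>of_real t * g t\<close>
  splits off \<open>ln t\<close> without a branch correction, and \<open>Ln\<close> is
  differentiable at \<open>g0\<close>, which is off the cut.\<close>

lemma tangentialI:
  assumes g: "(\<lambda>t. g t - g0) \<in> O[at_right 0](\<lambda>t. of_real t)"
    and g0: "g0 \<notin> \<real>\<^sub>\<le>\<^sub>0"
    and ev: "eventually (\<lambda>t. \<zeta> t = of_real t * g t) (at_right 0)"
  shows "tangential \<zeta> (Ln g0)"
proof -
  have "((\<lambda>t. g t - g0) \<longlongrightarrow> 0) (at_right 0)"
    using g t_ln_tendsto_0[of _ 0] by simp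
  then have lim: "(g \<longlongrightarrow> g0) (at_right 0)"
    by (rule LIM_zero_cancel)
  have "g0 \<noteq> 0" using g0 by auto
  then have nz: "eventually (\<lambda>t. g t \<noteq> 0) (at_right 0)"
    using tendsto_imp_eventually_ne[OF lim] by auto
  have pos: "eventually (\<lambda>t::real. 0 < t) (at_right 0)"
    by real_asymp
  have "(\<lambda>t. Ln (g t) - Ln g0) \<in> O[at_right 0](\<lambda>t. of_real t)"
    by (rule field_differentiable_bigo[OF field_differentiable_at_Ln[OF g0] g])
  moreover have eq: "eventually (\<lambda>t. Ln (g t) - Ln g0 = Ln (\<zeta> t) - of_real (ln t) - Ln g0) (at_right 0)"
    using nz pos ev by eventually_elim (simp add: Ln_times_of_real Ln_of_real)
  ultimately have Ln: "(\<lambda>t. Ln (\<zeta> t) - of_real (ln t) - Ln g0) \<in> O[at_right 0](\<lambda>t. of_real t)"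
    using landau_o.big.in_cong[OF eq, of "\<lambda>t. of_real t"] by blast
  have "g \<in> O[at_right 0](\<lambda>_. 1)"
    by (rule bigoI_tendsto[of _ _ g0]) (use lim in auto)
  then have "(\<lambda>t. of_real t * g t) \<in> O[at_right 0](\<lambda>t. of_real t * 1)"
    by (intro landau_o.big.mult) auto
  then have "\<zeta> \<in> O[at_right 0](\<lambda>t. of_real t)"
    using landau_o.big.in_cong[OF ev, of "\<lambda>t. of_real t"] by simp
  with Ln show ?thesis by (simp add: tangential_def)
qed

text \<open>The series exp(- (\<open>\<kappa>\<close> + x) e_0), with the polynomial variable x
  standing for \<open>ln t\<close>.\<close>

definition lam_asy :: "complex \<Rightarrow> letter list \<Rightarrow> complex poly" where
  "lam_asy \<kappa> w = pcompose (lam_poly w) [:\<kappa>, 1:]"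

lemma poly_lam_asy: "poly (lam_asy \<kappa> w) x = lam (\<kappa> + x) w"
  by (simp add: lam_asy_def poly_pcompose lam_def)

lemma asy_lam:
  assumes "asy 1 f p"
  shows "asy (length w) (\<lambda>t. lam (f t) w) (pcompose (lam_poly w) p)"
proof (cases "set w \<subseteq> {E0}")
  case True
  have "pcompose (q ^ n) p = pcompose q p ^ n" for q :: "complex poly" and n
    by (induction n) (simp_all add: pcompose_mult pcompose_1)
  then show ?thesis
    using asy_cmult[OF asy_power[OF asy_uminus[OF assms]], of "length w" "1 / fact (length w)"] True
    by (simp add: lam_altdef lam_poly_def pcompose_smult pcompose_pCons)
next
  case False
  then show ?thesis using asy_const[of "length w" 0] by (simp add: lam_altdef lam_poly_def)
qed

lemma asy_reg_part:
  assumes "\<zeta> \<in> O[at_right 0](\<lambda>t. of_real t)"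
  shows "asy (length w) (\<lambda>t. reg_part w (\<zeta> t)) (wone w)"
proof -
  have "0 \<in> plane" by (simp add: plane_def)
  then have "reg_part w field_differentiable (at 0)"
    using holomorphic_reg_part holomorphic_on_imp_differentiable_at open_planes(1) by blast
  from field_differentiable_bigo[OF this, of \<zeta>] assms
  have "(\<lambda>t. reg_part w (\<zeta> t) - wone w) \<in> O[at_right 0](\<lambda>t. of_real (t * ln t ^ 0))"
    by (simp add: reg_part_0)
  from landau_o.big_trans[OF this t_ln_power_bigo[of 0 "length w"]] show ?thesis
    by (cases w) (auto simp: asy_def)
qed

lemma asy_Ln_tangential:
  assumes "tangential \<zeta> \<kappa>"
  shows "asy 1 (\<lambda>t. Ln (\<zeta> t)) [:\<kappa>, 1:]"
proof -
  have "(\<lambda>t. Ln (\<zeta> t) - of_real (ln t) - \<kappa>) \<in> O[at_right 0](\<lambda>t. of_real (t * ln t ^ 0))"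
    using assms by (simp add: tangential_def)
  from landau_o.big_trans[OF this t_ln_power_bigo[of 0 1]] show ?thesis
    by (simp add: asy_def algebra_simps)
qed

lemma asy_sol0:
  assumes "tangential \<zeta> \<kappa>"
  shows "asy (length w) (\<lambda>t. sol0 (\<zeta> t) w) (lam_asy \<kappa> w)"
proof -
  have "asy (length w) (\<lambda>t. sol0 (\<zeta> t) w) ((wone \<star> lam_asy \<kappa>) w)"
    unfolding sol0_def lam_asy_def
    using assms by (intro asy_conv asy_lam asy_Ln_tangential asy_reg_part) (auto simp: tangential_def)
  then show ?thesis by simp
qed

section \<open>Continuation around \<open>1\<close>\<close>

abbreviation ucnj :: "(letter list \<Rightarrow> complex) \<Rightarrow> letter list \<Rightarrow> complex" where
  "ucnj F \<equiv> \<lambda>w. cnj (F w)"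

lemma cnj_conv: "ucnj (F \<star> G) = ucnj F \<star> ucnj G"
  by (rule ext) (rule conv_hom[of cnj]; simp)

lemma poly_conv: "poly ((P \<star> Q) w) x = ((\<lambda>v. poly (P v) x) \<star> (\<lambda>v. poly (Q v) x)) w"
  by (rule conv_hom) simp_all

lemma poly_antip: "poly (antip P w) x = antip (\<lambda>v. poly (P v) x) w"
  by (cases "even (length w)") (simp_all add: antip_def)

lemma poly_subst_phi: "poly (subst_phi P w) x = subst_phi (\<lambda>v. poly (P v) x) w"
  by (induction P w rule: subst_phi.induct) simp_all

lemma lam_0: "lam 0 = wone"
proof
  show "lam 0 w = wone w" for w
    by (cases w) (simp_all add: lam_altdef)
qed

text \<open>Under \<open>phi\<close>, a power of e_0 becomes itself plus words containing
  \<open>E1\<close>, on which \<open>lam\<close> vanishes.\<close>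

lemma subst_phi_lam: "subst_phi (lam l) = lam l"
proof
  have *: "subst_phi F w = F w" if "\<And>v. E1 \<in> set v \<Longrightarrow> F v = 0" for F :: "letter list \<Rightarrow> complex" and w
    using that
  proof (induction w arbitrary: F)
    case (Cons a w)
    have "(\<lambda>v. F (E1 # v)) = (\<lambda>v. 0)"
      using Cons.prems by auto
    then show ?case
      using Cons by (cases a) simp_all
  qed simp
  show "subst_phi (lam l) w = lam l w" for w
    by (rule *) (auto simp: lam_altdef)
qed

section \<open>Symmetries of the equation: conjugation and the Moebius map\<close>

lemma hol_sys_cnj:
  assumes F: "hol_sys \<Omega> F" and \<Omega>: "\<And>z. z \<in> \<Omega>' \<Longrightarrow> cnj z \<in> \<Omega>"
  shows "hol_sys \<Omega>' (\<lambda>z. ucnj (F (cnj z)))"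
  unfolding hol_sys_def
proof (intro allI ballI)
  fix w z assume z: "z \<in> \<Omega>'"
  have "cnj (eta (cnj z) v) = eta z v" for v
  proof -
    have "cnj (point a) = point a" for a
      by (cases a) simp_all
    then show ?thesis by (cases v rule: remdups_adj.cases) simp_all
  qed
  then have "cnj ((eta (cnj z) \<star> F (cnj z)) w) = (eta z \<star> ucnj (F (cnj z))) w"
    using fun_cong[OF cnj_conv[of "eta (cnj z)" "F (cnj z)"], of w] by simp
  then show "((\<lambda>z. cnj (F (cnj z) w)) has_field_derivative - (eta z \<star> ucnj (F (cnj z))) w) (at z)"
    using has_field_derivative_cnj_cnj[OF hol_sysD[OF F \<Omega>[OF z], of w]] by (simp add: o_def)
qed

text \<open>The Moebius transformation \<open>z/(z - 1)\<close> fixes \<open>0\<close>, swaps \<open>1\<close> and \<open>\<infinity>\<close>, and pulls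
  \<open>e\<^sub>0 dz/z + e\<^sub>1 dz/(z - 1)\<close> back to its image under \<open>phi\<close>.\<close>

definition moeb :: "complex \<Rightarrow> complex" where
  "moeb z = z / (z - 1)"

lemma hol_sys_moeb:
  assumes F: "hol_sys \<Omega> F" and \<Omega>: "\<And>z. z \<in> \<Omega>' \<Longrightarrow> moeb z \<in> \<Omega> \<and> z \<noteq> 0 \<and> z \<noteq> 1"
  shows "hol_sys \<Omega>' (\<lambda>z. subst_phi (F (moeb z)))"
  unfolding hol_sys_def
proof (intro allI ballI)
  fix w z assume "z \<in> \<Omega>'"
  with \<Omega> have z: "moeb z \<in> \<Omega>" "z \<noteq> 0" "z \<noteq> 1" by auto
  define c where "c = - 1 / (z - 1) ^ 2"
  have "(moeb has_field_derivative c) (at z)"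
    unfolding moeb_def c_def using z
    by (auto intro!: derivative_eq_intros simp: divide_simps power2_eq_square)
  from DERIV_chain2[OF hol_sysD[OF F z(1)] this]
  have "((\<lambda>z. F (moeb z) v) has_field_derivative (- c) * (eta (moeb z) \<star> F (moeb z)) v) (at z)" for v
    by (simp add: mult.commute)
  from has_field_derivative_subst_phi[where F = "\<lambda>z. F (moeb z)", OF this, of w]
  have "((\<lambda>z. subst_phi (F (moeb z)) w) has_field_derivative
      (- c) * (subst_phi (eta (moeb z)) \<star> subst_phi (F (moeb z))) w) (at z)"
    by (simp only: subst_phi_cmult subst_phi_conv)
  \<comment> \<open>With m = \<open>moeb z\<close>: dm/m = dz/z - dz/(z - 1) and dm/(m - 1) = -
    dz/(z - 1). The transpose of \<open>phi\<close> undoes exactly this change of forms.\<close>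
  moreover have "(\<lambda>v. c * subst_phi (eta (moeb z)) v) = eta z"
  proof
    fix v
    have wone: "subst_phi (\<lambda>v. k * wone v) (a # u) = 0" for k :: complex and a u
      using subst_phi_lam[of 0] by (simp add: subst_phi_cmult lam_0)
    have cons: "(\<lambda>v. eta (moeb z) (b # v)) = (\<lambda>v. 1 / (moeb z - point b) * wone v)" for b
    proof
      show "eta (moeb z) (b # v) = 1 / (moeb z - point b) * wone v" for v
        by (cases v) simp_all
    qed
    obtain u where u: "z = 1 + u" by (metis add.commute diff_add_cancel)
    have m: "moeb z = (1 + u) / u" "moeb z - 1 = 1 / u" "c = - 1 / (u * u)" "u \<noteq> 0" "1 + u \<noteq> 0"
      using z by (auto simp: moeb_def c_def u field_simps power2_eq_square)
    have "u * u + u * (u * u) = u * u * (1 + u)" by (simp add: algebra_simps)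
    with m have nz: "u * u + u * (u * u) \<noteq> 0" by simp
    show "c * subst_phi (eta (moeb z)) v = eta z v"
    proof (cases v)
      case (Cons a x)
      show ?thesis
      proof (cases x)
        case Nil
        show ?thesis
          using m(4,5) nz unfolding Cons Nil
          by (cases a) (simp_all add: m(2), simp_all add: m(1,3), simp_all add: u field_simps)
      next
        case x: (Cons b y)
        show ?thesis unfolding Cons x
          by (cases a) (simp_all only: subst_phi.simps cons wone eta_simps, simp_all)
      qed
    qed simp
  qed
  then have "c * (subst_phi (eta (moeb z)) \<star> subst_phi (F (moeb z))) w = (eta z \<star> subst_phi (F (moeb z))) w"
    by (metis conv_cmult_left)
  ultimately show "((\<lambda>z. subst_phi (F (moeb z)) w) has_field_derivative
      - (eta z \<star> subst_phi (F (moeb z))) w) (at z)"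
    by simp
qed

section \<open>Comparing solutions through their expansions at 0\<close>

definition upper :: "complex set" where "upper = {z. 0 < Im z}"
definition lower :: "complex set" where "lower = {z. Im z < 0}"

lemma half_planes [simp]:
  "open upper" "open lower" "connected upper" "connected lower"
  by (auto simp: upper_def lower_def open_halfspace_Im_gt open_halfspace_Im_lt
      convex_halfspace_Im_gt convex_halfspace_Im_lt intro!: convex_connected)

lemma half_planes_subset:
  "upper \<subseteq> plane0" "lower \<subseteq> plane0" "upper \<subseteq> plane1" "lower \<subseteq> plane1"
  by (auto simp: upper_def lower_def plane0_def plane1_def)

text \<open>The product is constant, so its polynomial in \<open>ln t\<close> is constant as well
  and may be evaluated at any \<open>x\<close>. This determines it at an interior point from the
  expansions along \<open>\<zeta>\<close>.\<close>

lemma hol_sys_antip_asy: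
  assumes F: "hol_sys \<Omega> F" and G: "hol_sys \<Omega> G" and \<Omega>: "open \<Omega>" "connected \<Omega>"
    and \<zeta>: "eventually (\<lambda>t. \<zeta> t \<in> \<Omega>) (at_right 0)" and z: "z \<in> \<Omega>"
    and P: "\<And>w. asy (length w) (\<lambda>t. F (\<zeta> t) w) (P w)"
    and Q: "\<And>w. asy (length w) (\<lambda>t. G (\<zeta> t) w) (Q w)"
  shows "antip (F z) \<star> G z = antip (\<lambda>w. poly (P w) x) \<star> (\<lambda>w. poly (Q w) x)"
proof
  fix w
  have "asy (length w) (\<lambda>t. (antip (F (\<zeta> t)) \<star> G (\<zeta> t)) w) ((antip P \<star> Q) w)"
    by (intro asy_conv asy_antip P Q)
  moreover have "eventually (\<lambda>t. (antip (F (\<zeta> t)) \<star> G (\<zeta> t)) w = (antip (F z) \<star> G z) w) (at_right 0)"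
    using \<zeta> by eventually_elim (use hol_sys_antip_const[OF F G \<Omega> z] in metis)
  ultimately have "asy (length w) (\<lambda>t. (antip (F z) \<star> G z) w) ((antip P \<star> Q) w)"
    by (rule asy_cong[rotated])
  from asy_unique[OF this asy_const] have "(antip P \<star> Q) w = [:(antip (F z) \<star> G z) w:]" .
  from arg_cong[OF this, of "\<lambda>p. poly p x"]
  show "(antip (F z) \<star> G z) w = (antip (\<lambda>w. poly (P w) x) \<star> (\<lambda>w. poly (Q w) x)) w"
    by (simp add: poly_conv poly_antip)
qed

lemma tangential_pos: "tangential of_real 0"
  using tangentialI[of "\<lambda>_. 1" 1 of_real] by simp

lemma eventually_pos_plane0: "eventually (\<lambda>t. of_real t \<in> plane0) (at_right 0)"
proof -
  have "eventually (\<lambda>t::real. t \<in> {0<..<1}) (at_right 0)"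
    by (rule eventually_at_right_real) simp
  then show ?thesis by eventually_elim (auto simp: plane0_def)
qed

text \<open>Both expansions along the positive axis are given by \<open>lam\<close>, which becomes
  \<open>wone\<close> at \<open>x = 0\<close>.\<close>

lemma sol0_inverse:
  assumes "z \<in> plane0"
  shows "antip (sol0 z) \<star> sol0 z = wone" "sol0 z \<star> antip (sol0 z) = wone"
proof -
  show *: "antip (sol0 z) \<star> sol0 z = wone"
    using hol_sys_antip_asy[OF hol_sys_sol0 hol_sys_sol0 open_planes(2) connected_planes(1)
        eventually_pos_plane0 assms asy_sol0[OF tangential_pos] asy_sol0[OF tangential_pos], of 0]
    by (simp add: poly_lam_asy lam_0)
  show "sol0 z \<star> antip (sol0 z) = wone"
    by (rule conv_inverse_commute[OF _ *]) (simp add: sol0_def lam_altdef)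
qed

text \<open>The conjugate is again a solution, with the same expansion along the positive axis:
  \<open>Ln\<close> is real there, and so is the limit \<open>wone\<close> of
  \<open>reg_part\<close>.\<close>

lemma sol0_cnj:
  assumes "z \<in> plane0"
  shows "ucnj (sol0 (cnj z)) = sol0 z"
proof -
  have asy: "asy (length w) (\<lambda>t. cnj (sol0 (cnj (of_real t)) w)) (lam_asy 0 w)" for w
  proof -
    have cnj_bigo: "(\<lambda>t. cnj (f t)) \<in> O[at_right 0](g)" if "f \<in> O[at_right 0](g)"
      for f g :: "real \<Rightarrow> complex"
      using that by (simp add: bigo_def)
    have reg: "asy (length v) (\<lambda>t. cnj (reg_part v (of_real t))) (wone v)" for v
    proof -
      have "asy (length v) (\<lambda>t. reg_part v (of_real t)) (wone v)"
        by (rule asy_reg_part) simp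
      then show ?thesis
        using cnj_bigo[of "\<lambda>t. reg_part v (of_real t) - poly (wone v) (of_real (ln t))"]
        by (cases v) (simp_all add: asy_def)
    qed
    have "asy (length v) (\<lambda>t. lam (Ln (of_real t)) v) (lam_asy 0 v)" for v
      unfolding lam_asy_def by (intro asy_lam asy_Ln_tangential tangential_pos)
    from asy_conv[OF reg this, of w]
    have "asy (length w) (\<lambda>t. ((\<lambda>v. cnj (reg_part v (of_real t))) \<star> lam (Ln (of_real t))) w) (lam_asy 0 w)"
      by simp
    moreover have "eventually (\<lambda>t::real. 0 < t) (at_right 0)"
      by real_asymp
    then have "eventually (\<lambda>t. ((\<lambda>v. cnj (reg_part v (of_real t))) \<star> lam (Ln (of_real t))) w
        = cnj (sol0 (cnj (of_real t)) w)) (at_right 0)"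
    proof eventually_elim
      case (elim t)
      have "ucnj (lam (Ln (of_real t))) = lam (Ln (of_real t))"
        using elim by (auto simp: lam_altdef Ln_of_real)
      then show ?case
        using fun_cong[OF cnj_conv, of "\<lambda>v. reg_part v (of_real t)" "lam (Ln (of_real t))" w]
        by (simp add: sol0_def)
    qed
    ultimately show ?thesis by (rule asy_cong[rotated])
  qed
  have "hol_sys plane0 (\<lambda>z. ucnj (sol0 (cnj z)))"
    by (rule hol_sys_cnj[OF hol_sys_sol0]) (auto simp: plane0_def)
  from hol_sys_antip_asy[OF hol_sys_sol0 this open_planes(2) connected_planes(1)
        eventually_pos_plane0 assms asy_sol0[OF tangential_pos] asy, of 0]
  have "antip (sol0 z) \<star> ucnj (sol0 (cnj z)) = wone"
    by (simp add: poly_lam_asy lam_0)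
  then have "sol0 z \<star> (antip (sol0 z) \<star> ucnj (sol0 (cnj z))) = sol0 z"
    by simp
  then show ?thesis
    by (simp add: sol0_inverse[OF assms] flip: conv_assoc)
qed

text \<open>The continuation of \<open>sol0\<close> from the upper half plane across the real axis
  to the right of 1.\<close>

definition sol1 :: "complex \<Rightarrow> letter list \<Rightarrow> complex" where
  "sol1 = (SOME F. hol_sys plane1 F \<and> F \<i> = sol0 \<i>)"

text \<open>This will be the series of regularized iterated integrals along \<^const>\<open>beta\<close>, which passes from
  \<open>0\<close> through the lower half plane to the right of \<open>1\<close> and returns through the upper one.\<close>

definition loop_ser :: "letter list \<Rightarrow> complex" where
  "loop_ser = antip (sol0 (- \<i>)) \<star> sol1 (- \<i>)"

lemma sol1: "hol_sys plane1 sol1" "sol1 \<i> = sol0 \<i>"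
proof -
  obtain F where "hol_sys plane1 F" "F \<i> = sol0 \<i>"
    by (rule hol_sys_exists[of plane1 \<i> "sol0 \<i>"]) (simp_all add: simply_connected_planes, auto simp: plane1_def)
  then have "\<exists>F. hol_sys plane1 F \<and> F \<i> = sol0 \<i>" by blast
  from someI_ex[OF this] show "hol_sys plane1 sol1" "sol1 \<i> = sol0 \<i>"
    by (simp_all add: sol1_def)
qed

lemma sol1_upper:
  assumes "z \<in> upper"
  shows "sol1 z = sol0 z"
proof (rule hol_sys_unique[of upper _ _ \<i>])
  show "hol_sys upper sol1" "hol_sys upper sol0"
    using hol_sys_subset[OF sol1(1)] hol_sys_subset[OF hol_sys_sol0] half_planes_subset by auto
  show "\<i> \<in> upper" by (simp add: upper_def)
qed (use assms sol1 in simp_all)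

text \<open>Both sides solve the equation on a connected half plane; \<open>loop_ser\<close> is
  built to make them agree at \<open>- \<i>\<close>, with \<open>antip (sol0 (- \<i>))\<close> as
  inverse.\<close>

lemma sol1_lower:
  assumes "z \<in> lower"
  shows "sol1 z = sol0 z \<star> loop_ser"
proof (rule hol_sys_unique[of lower _ _ "- \<i>"])
  have "- \<i> \<in> plane0" by (simp add: plane0_def)
  then show "sol1 (- \<i>) = sol0 (- \<i>) \<star> loop_ser"
    by (simp add: loop_ser_def sol0_inverse flip: conv_assoc)
  show "hol_sys lower sol1"
    using hol_sys_subset[OF sol1(1)] half_planes_subset by auto
  show "hol_sys lower (\<lambda>z. sol0 z \<star> loop_ser)"
    using hol_sys_conv_right hol_sys_subset[OF hol_sys_sol0] half_planes_subset by auto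
  show "- \<i> \<in> lower" by (simp add: lower_def)
qed (use assms in simp_all)

lemma hol_sys_Nil:
  assumes "hol_sys \<Omega> F" "open \<Omega>" "connected \<Omega>" "z0 \<in> \<Omega>" "z \<in> \<Omega>"
  shows "F z [] = F z0 []"
  using hol_sysD[OF assms(1), of _ "[]"] by (intro deriv_zero_eq[OF assms(2,3) _ assms(4,5)]) simp

lemma sol0_Nil [simp]: "sol0 z [] = 1"
  by (simp add: sol0_def lam_altdef)

lemma loop_ser_Nil [simp]: "loop_ser [] = 1"
proof -
  have "sol1 (- \<i>) [] = sol1 \<i> []"
    by (rule hol_sys_Nil[OF sol1(1) open_planes(3) connected_planes(2)]) (simp_all add: plane1_def)
  then show ?thesis by (simp add: loop_ser_def sol1)
qed

text \<open>The product \<open>antip (sol1 z) \<star> sol1 z\<close> is constant on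
  \<open>plane1\<close>. It is \<open>wone\<close> at \<open>\<i>\<close>, and at
  \<open>- \<i>\<close> it reduces to the left-hand side once \<open>sol0\<close> cancels.\<close>

lemma antip_loop_ser: "antip loop_ser \<star> loop_ser = wone"
proof -
  have pm: "\<i> \<in> plane1" "- \<i> \<in> plane1" "\<i> \<in> plane0" "- \<i> \<in> plane0" "- \<i> \<in> lower"
    by (simp_all add: plane0_def plane1_def lower_def)
  have "wone = antip (sol1 \<i>) \<star> sol1 \<i>"
    using sol0_inverse pm by (simp add: sol1)
  also have "\<dots> = antip (sol1 (- \<i>)) \<star> sol1 (- \<i>)"
    using pm by (intro hol_sys_antip_const[OF sol1(1) sol1(1)]) auto
  also have "\<dots> = antip loop_ser \<star> (antip (sol0 (- \<i>)) \<star> sol0 (- \<i>)) \<star> loop_ser"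
    using pm by (simp add: sol1_lower antip_conv conv_assoc)
  also have "\<dots> = antip loop_ser \<star> loop_ser"
    using sol0_inverse pm by simp
  finally show ?thesis ..
qed

text \<open>\<open>z \<mapsto> ucnj (sol1 (cnj z))\<close> is the continuation to \<open>plane1\<close> of \<^const>\<open>sol0\<close> on the lower half
  plane.\<close>

lemma sol1_cnj:
  assumes "z \<in> plane1"
  shows "sol1 z = ucnj (sol1 (cnj z)) \<star> loop_ser"
proof (rule hol_sys_unique[OF sol1(1) _ _ _ _ _ assms])
  show "hol_sys plane1 (\<lambda>z. ucnj (sol1 (cnj z)) \<star> loop_ser)"
    by (intro hol_sys_conv_right hol_sys_cnj[OF sol1(1)]) (auto simp: plane1_def)
  show "- \<i> \<in> plane1" by (simp add: plane1_def)
  have "- \<i> \<in> lower" "\<i> \<in> upper" "- \<i> \<in> plane0" by (simp_all add: lower_def upper_def plane0_def)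
  then show "sol1 (- \<i>) = ucnj (sol1 (cnj (- \<i>))) \<star> loop_ser"
    using sol1_lower sol1_upper[of \<i>] sol0_cnj[of "- \<i>"] by simp
qed simp_all

lemma sol1_cnj_upper:
  assumes "z \<in> upper"
  shows "ucnj (sol1 (cnj z)) = sol0 z \<star> ucnj loop_ser"
proof -
  have "cnj z \<in> lower" using assms by (simp add: upper_def lower_def)
  then show ?thesis
    using sol1_lower[of "cnj z"] sol0_cnj[of z] half_planes_subset assms
    by (auto simp: cnj_conv)
qed

text \<open>At \<open>\<i>\<close>, \<open>sol1_cnj\<close> and \<open>sol1_cnj_upper\<close> make
  \<open>ucnj loop_ser\<close> a left inverse of \<open>loop_ser\<close>;
  \<open>antip loop_ser\<close> is one too, and inverses are unique. In terms of \<open>tau\<close>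
  this is (ii).\<close>

lemma loop_ser_antip: "antip loop_ser = ucnj loop_ser"
proof -
  have i: "\<i> \<in> upper" "\<i> \<in> plane1" "\<i> \<in> plane0" by (simp_all add: upper_def plane0_def plane1_def)
  have "sol0 \<i> \<star> (ucnj loop_ser \<star> loop_ser) = ucnj (sol1 (cnj \<i>)) \<star> loop_ser"
    by (simp only: sol1_cnj_upper[OF i(1)] conv_assoc)
  also have "\<dots> = sol0 \<i> \<star> wone"
    by (simp only: sol1_cnj[OF i(2), symmetric] sol1 conv_wone_right)
  finally have "sol0 \<i> \<star> (ucnj loop_ser \<star> loop_ser) = sol0 \<i> \<star> wone" .
  then have *: "ucnj loop_ser \<star> loop_ser = wone"
    by (rule conv_left_cancel[rotated]) simp
  have inv: "loop_ser \<star> antip loop_ser = wone"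
    using antip_loop_ser loop_ser_Nil by (auto intro: conv_inverse_commute[of "antip loop_ser"])
  have "antip loop_ser = ucnj loop_ser \<star> loop_ser \<star> antip loop_ser"
    by (simp add: *)
  also have "\<dots> = ucnj loop_ser"
    by (simp add: conv_assoc inv)
  finally show ?thesis .
qed

section \<open>The Moebius symmetry of the loop series\<close>

lemma moeb_half_planes:
  "z \<in> upper \<Longrightarrow> moeb z \<in> lower" "z \<in> lower \<Longrightarrow> moeb z \<in> upper"
proof -
  have im: "Im (moeb z) = - Im z / ((Re z - 1)\<^sup>2 + (Im z)\<^sup>2)"
    by (simp add: moeb_def Im_divide algebra_simps)
  have pos: "0 < (Re z - 1)\<^sup>2 + (Im z)\<^sup>2" if "Im z \<noteq> 0"
    using that by (intro add_nonneg_pos) auto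
  show "z \<in> upper \<Longrightarrow> moeb z \<in> lower" "z \<in> lower \<Longrightarrow> moeb z \<in> upper"
    using pos im by (auto simp: upper_def lower_def divide_neg_pos)
qed

lemma moeb_plane1:
  assumes "z \<in> plane1"
  shows "moeb z \<in> plane1"
proof (cases "Im z = 0")
  case True
  then obtain r where z: "z = of_real r" by (metis complex_is_Real_iff Reals_cases)
  then have eq: "moeb z = of_real (r / (r - 1))" by (simp add: moeb_def)
  have "1 < r" using assms z by (auto simp: plane1_def)
  then have "1 < r / (r - 1)" by (simp add: field_simps)
  then show ?thesis by (simp add: plane1_def eq del: of_real_divide)
next
  case False
  then show ?thesis
    using moeb_half_planes[of z] half_planes_subset by (force simp: upper_def lower_def)
qed

text \<open>On a half plane the transformed solution differs from the original one by a half turn at \<open>0\<close>.\<close>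

lemma sol0_moeb:
  assumes \<sigma>: "\<sigma> = 1 \<or> \<sigma> = - 1" and z: "0 < Im z * \<sigma>"
  shows "\<exists>l. subst_phi (sol0 (moeb z)) = sol0 z \<star> lam l"
proof -
  define H where "H = (if \<sigma> = 1 then upper else lower)"
  define H' where "H' = (if \<sigma> = 1 then lower else upper)"
  have H: "open H" "connected H" "H \<subseteq> plane0" "H' \<subseteq> plane0" "\<And>z. z \<in> H \<Longrightarrow> moeb z \<in> H'"
    using half_planes_subset moeb_half_planes by (auto simp: H_def H'_def)
  have zH: "z \<in> H" using z \<sigma> by (auto simp: H_def upper_def lower_def)
  \<comment> \<open>On the imaginary axis both \<open>\<zeta> t\<close> and
    \<open>moeb (\<zeta> t)\<close>, which leaves 0 in the opposite direction, avoid the cut of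
    \<open>Ln\<close>; points of the positive axis near 0 would be sent onto the cut.\<close>
  define \<zeta> where "\<zeta> t = of_real t * (of_real \<sigma> * \<i>)" for t
  define g where "g z = of_real \<sigma> * \<i> / (z - 1)" for z
  have tang1: "tangential \<zeta> (Ln (of_real \<sigma> * \<i>))"
    using \<sigma> by (intro tangentialI[of "\<lambda>_. of_real \<sigma> * \<i>"]) (auto simp: \<zeta>_def complex_nonpos_Reals_iff)
  have tang2: "tangential (\<lambda>t. moeb (\<zeta> t)) (Ln (g 0))"
  proof (rule tangentialI[of "\<lambda>t. g (\<zeta> t)"])
    show "(\<lambda>t. g (\<zeta> t) - g 0) \<in> O[at_right 0](\<lambda>t. of_real t)"
    proof (rule field_differentiable_bigo[of g 0 \<zeta>])
      show "g field_differentiable (at 0)"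
        unfolding g_def by (intro derivative_intros field_differentiable_divide) auto
    qed (use tang1 in \<open>simp add: tangential_def\<close>)
    show "g 0 \<notin> \<real>\<^sub>\<le>\<^sub>0" using \<sigma> by (auto simp: g_def complex_nonpos_Reals_iff)
    show "eventually (\<lambda>t. moeb (\<zeta> t) = of_real t * g (\<zeta> t)) (at_right 0)"
      by (simp add: moeb_def g_def \<zeta>_def)
  qed
  have "eventually (\<lambda>t::real. 0 < t) (at_right 0)"
    by real_asymp
  then have ev: "eventually (\<lambda>t. \<zeta> t \<in> H) (at_right 0)"
    by eventually_elim (use \<sigma> in \<open>auto simp: \<zeta>_def H_def upper_def lower_def\<close>)
  have sys: "hol_sys H sol0" "hol_sys H (\<lambda>z. subst_phi (sol0 (moeb z)))"
  proof -
    show "hol_sys H sol0" using H hol_sys_subset[OF hol_sys_sol0] by blast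
    show "hol_sys H (\<lambda>z. subst_phi (sol0 (moeb z)))"
    proof (rule hol_sys_moeb[OF hol_sys_sol0])
      fix z assume "z \<in> H"
      then have "moeb z \<in> plane0" "z \<in> plane0" using H by blast+
      then show "moeb z \<in> plane0 \<and> z \<noteq> 0 \<and> z \<noteq> 1" by (auto simp: plane0_def)
    qed
  qed
  \<comment> \<open>Chosen so that the expansion of \<open>sol0 (\<zeta> t)\<close> evaluates to
    \<open>lam 0\<close>, that is \<open>wone\<close>.\<close>
  define x where "x = - Ln (of_real \<sigma> * \<i>)"
  have "antip (sol0 z) \<star> subst_phi (sol0 (moeb z)) =
      antip (lam 0) \<star> subst_phi (lam (Ln (g 0) + x))"
    using hol_sys_antip_asy[OF sys H(1,2) ev zH asy_sol0[OF tang1] asy_subst_phi[OF asy_sol0[OF tang2]], of x]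
    by (simp add: poly_subst_phi poly_lam_asy x_def)
  also have "\<dots> = lam (Ln (g 0) + x)"
    by (simp add: lam_0 subst_phi_lam)
  finally have "sol0 z \<star> (antip (sol0 z) \<star> subst_phi (sol0 (moeb z))) = sol0 z \<star> lam (Ln (g 0) + x)"
    by simp
  moreover have "z \<in> plane0" using zH H by auto
  ultimately show ?thesis
    by (auto simp: sol0_inverse simp flip: conv_assoc)
qed

text \<open>Two solutions on \<open>plane1\<close>, one transformed by \<open>moeb\<close> and one
  by conjugation, agree at \<open>- \<i>\<close> and hence at \<open>\<i>\<close>. There both maps
  lead to the lower half plane, so the first exhibits \<open>loop_ser\<close> and the second its
  conjugate.\<close>

lemma loop_ser_phi: "\<exists>l l'. lam l \<star> subst_phi loop_ser = ucnj loop_ser \<star> lam l'"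
proof -
  have pm: "\<i> \<in> plane1" "- \<i> \<in> plane1" "\<i> \<in> plane0" "- \<i> \<in> plane0" "- \<i> \<in> lower" "\<i> \<in> upper"
    by (simp_all add: plane0_def plane1_def lower_def upper_def)
  obtain l where l: "subst_phi (sol0 (moeb \<i>)) = sol0 \<i> \<star> lam l"
    using sol0_moeb[of 1 \<i>] by auto
  obtain l' where l': "subst_phi (sol0 (moeb (- \<i>))) = sol0 (- \<i>) \<star> lam l'"
    using sol0_moeb[of "-1" "- \<i>"] by auto
  have "subst_phi (sol1 (moeb \<i>)) = ucnj (sol1 (cnj \<i>)) \<star> lam l'"
  proof (rule hol_sys_unique[of plane1 "\<lambda>z. subst_phi (sol1 (moeb z))"
        "\<lambda>z. ucnj (sol1 (cnj z)) \<star> lam l'" "- \<i>" \<i>])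
    show "hol_sys plane1 (\<lambda>z. subst_phi (sol1 (moeb z)))"
    proof (rule hol_sys_moeb[OF sol1(1)])
      fix z assume "z \<in> plane1"
      then have "moeb z \<in> plane1" by (rule moeb_plane1)
      moreover have "z \<noteq> 0 \<and> z \<noteq> 1" using \<open>z \<in> plane1\<close> by (auto simp: plane1_def)
      ultimately show "moeb z \<in> plane1 \<and> z \<noteq> 0 \<and> z \<noteq> 1" by blast
    qed
    show "hol_sys plane1 (\<lambda>z. ucnj (sol1 (cnj z)) \<star> lam l')"
      by (intro hol_sys_conv_right hol_sys_cnj[OF sol1(1)]) (auto simp: plane1_def)
    show "subst_phi (sol1 (moeb (- \<i>))) = ucnj (sol1 (cnj (- \<i>))) \<star> lam l'"
      using l' pm moeb_half_planes(2)[of "- \<i>"] sol1_upper sol0_cnj[of "- \<i>"] by simp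
  qed (use pm in auto)
  also have "\<dots> = sol0 \<i> \<star> (ucnj loop_ser \<star> lam l')"
    using pm by (simp only: sol1_cnj_upper conv_assoc)
  also have "subst_phi (sol1 (moeb \<i>)) = sol0 \<i> \<star> (lam l \<star> subst_phi loop_ser)"
    using moeb_half_planes(1)[of \<i>] sol1_lower pm l by (simp add: subst_phi_conv conv_assoc)
  finally have "lam l \<star> subst_phi loop_ser = ucnj loop_ser \<star> lam l'"
    by (rule conv_left_cancel[rotated]) simp
  then show ?thesis by blast
qed

text \<open>\<open>lam\<close> vanishes on words containing \<open>E1\<close>. Nonempty prefixes of
  \<open>w\<close> start with \<open>E1\<close> and nonempty suffixes end with it, so on each side
  only the empty word survives in \<open>lam\<close>.\<close>

lemma loop_ser_phi_coeff:
  assumes "w = [E1] \<or> w = E1 # u @ [E1]"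
  shows "subst_phi loop_ser w = cnj (loop_ser w)"
proof -
  obtain l l' where eq: "lam l \<star> subst_phi loop_ser = ucnj loop_ser \<star> lam l'"
    using loop_ser_phi by blast
  obtain v v' where v: "w = E1 # v" "w = v' @ [E1]"
    using assms by (metis append_Cons append_Nil)
  have "(\<lambda>x. lam l (E1 # x)) = (\<lambda>x. 0)" "(\<lambda>x. lam l' (x @ [E1])) = (\<lambda>x. 0)"
    by (auto simp: lam_altdef)
  then have "(lam l \<star> subst_phi loop_ser) w = subst_phi loop_ser w" "(ucnj loop_ser \<star> lam l') w = cnj (loop_ser w)"
    unfolding v(1) by (simp add: lam_altdef) (simp add: v(1)[symmetric] v(2) conv_snoc lam_altdef del: conv.simps)
  then show ?thesis using eq by simp
qed

section \<open>Solutions along paths\<close>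

text \<open>Weaker than piecewise smoothness: differentiability off a finite set suffices for the
  chain rule and the fundamental theorem of calculus.\<close>

definition pdiff :: "(real \<Rightarrow> complex) \<Rightarrow> real \<Rightarrow> real \<Rightarrow> bool" where
  "pdiff \<gamma> a b \<longleftrightarrow> continuous_on {a..b} \<gamma> \<and>
     (\<exists>S. finite S \<and> (\<forall>t\<in>{a<..<b} - S. \<gamma> differentiable (at t)))"

lemma pdiff_subset: "pdiff \<gamma> a b \<Longrightarrow> a \<le> c \<Longrightarrow> d \<le> b \<Longrightarrow> pdiff \<gamma> c d"
  unfolding pdiff_def
  by (elim conjE exE, intro conjI exI, erule continuous_on_subset) auto

text \<open>The equation pulled back to the parameter, so that continuation needs no global branch.
  One exceptional set serves all words, since \<open>\<star>\<close> mixes coefficients.\<close>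

definition path_sys :: "(real \<Rightarrow> complex) \<Rightarrow> real \<Rightarrow> real \<Rightarrow> (real \<Rightarrow> letter list \<Rightarrow> complex) \<Rightarrow> bool" where
  "path_sys \<gamma> a b F \<longleftrightarrow> (\<forall>w. continuous_on {a..b} (\<lambda>t. F t w)) \<and>
     (\<exists>S. finite S \<and> (\<forall>w. \<forall>t\<in>{a<..<b} - S. ((\<lambda>t. F t w) has_vector_derivative
        - vector_derivative \<gamma> (at t) * (eta (\<gamma> t) \<star> F t) w) (at t)))"

lemma path_sysE:
  assumes "path_sys \<gamma> a b F"
  obtains S where "finite S" "\<And>w t. t \<in> {a<..<b} - S \<Longrightarrow> ((\<lambda>t. F t w) has_vector_derivative
        - vector_derivative \<gamma> (at t) * (eta (\<gamma> t) \<star> F t) w) (at t)"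
  using assms unfolding path_sys_def by blast

lemma path_sysI:
  assumes "\<And>w. continuous_on {a..b} (\<lambda>t. F t w)" "finite S"
    and "\<And>w t. t \<in> {a<..<b} - S \<Longrightarrow> ((\<lambda>t. F t w) has_vector_derivative
        - vector_derivative \<gamma> (at t) * (eta (\<gamma> t) \<star> F t) w) (at t)"
  shows "path_sys \<gamma> a b F"
  using assms unfolding path_sys_def by blast

lemma path_sys_subset:
  assumes "path_sys \<gamma> a b F" "a \<le> c" "d \<le> b"
  shows "path_sys \<gamma> c d F"
proof -
  obtain S where S: "finite S" "\<And>w t. t \<in> {a<..<b} - S \<Longrightarrow> ((\<lambda>t. F t w) has_vector_derivative
        - vector_derivative \<gamma> (at t) * (eta (\<gamma> t) \<star> F t) w) (at t)"
    using path_sysE[OF assms(1)] by blast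
  have "continuous_on {a..b} (\<lambda>t. F t w)" for w
    using assms(1) by (simp add: path_sys_def)
  then have "continuous_on {c..d} (\<lambda>t. F t w)" for w
    by (rule continuous_on_subset) (use assms in auto)
  then show ?thesis
    by (rule path_sysI[OF _ S(1)]) (use assms S(2) in auto)
qed

lemma path_sys_cong:
  assumes "path_sys \<gamma> a b F" "\<And>t. t \<in> {a..b} \<Longrightarrow> F t = G t"
  shows "path_sys \<gamma> a b G"
proof -
  obtain S where S: "finite S" "\<And>w t. t \<in> {a<..<b} - S \<Longrightarrow> ((\<lambda>t. F t w) has_vector_derivative
        - vector_derivative \<gamma> (at t) * (eta (\<gamma> t) \<star> F t) w) (at t)"
    using path_sysE[OF assms(1)] by blast
  have "((\<lambda>t. G t w) has_vector_derivative
        - vector_derivative \<gamma> (at t) * (eta (\<gamma> t) \<star> G t) w) (at t)" if t: "t \<in> {a<..<b} - S" for t w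
  proof -
    have "F t = G t" using t assms(2) by auto
    then show ?thesis
      using has_vector_derivative_transform_within_open[OF S(2)[OF t, of w], of "{a<..<b}" "\<lambda>t. G t w"]
        t assms(2) by auto
  qed
  moreover have "continuous_on {a..b} (\<lambda>t. G t w)" for w
    using assms continuous_on_cong[of "{a..b}" "{a..b}" "\<lambda>t. F t w" "\<lambda>t. G t w"]
    by (auto simp: path_sys_def)
  ultimately show ?thesis by (intro path_sysI[OF _ S(1)])
qed

lemma continuous_on_Icc_join:
  fixes f :: "real \<Rightarrow> 'a::topological_space"
  assumes "continuous_on {a..b} f" "continuous_on {b..c} f" "a \<le> b" "b \<le> c"
  shows "continuous_on {a..c} f"
proof -
  have "continuous_on ({a..b} \<union> {b..c}) f"
    using assms by (intro continuous_on_closed_Un) auto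
  then show ?thesis using assms by (simp add: ivl_disj_un)
qed

lemma path_sys_join:
  assumes "path_sys \<gamma> a b F" "path_sys \<gamma> b c F" "a \<le> b" "b \<le> c"
  shows "path_sys \<gamma> a c F"
proof -
  obtain S where S: "finite S"
    and d: "\<And>w t. t \<in> {a<..<b} - S \<Longrightarrow> ((\<lambda>t. F t w) has_vector_derivative
        - vector_derivative \<gamma> (at t) * (eta (\<gamma> t) \<star> F t) w) (at t)"
    using path_sysE[OF assms(1)] by blast
  obtain S' where S': "finite S'"
    and d': "\<And>w t. t \<in> {b<..<c} - S' \<Longrightarrow> ((\<lambda>t. F t w) has_vector_derivative
        - vector_derivative \<gamma> (at t) * (eta (\<gamma> t) \<star> F t) w) (at t)"
    using path_sysE[OF assms(2)] by blast
  have "finite (insert b (S \<union> S'))" using S S' by simp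
  moreover have "((\<lambda>t. F t w) has_vector_derivative
        - vector_derivative \<gamma> (at t) * (eta (\<gamma> t) \<star> F t) w) (at t)"
    if "t \<in> {a<..<c} - insert b (S \<union> S')" for t w
    using that d d' by (cases "t < b") auto
  moreover have "continuous_on {a..c} (\<lambda>t. F t w)" for w
    using assms by (intro continuous_on_Icc_join[of a b _ c]) (auto simp: path_sys_def)
  ultimately show ?thesis by (rule path_sysI[rotated])
qed

lemma hol_sys_continuous: "hol_sys \<Omega> G \<Longrightarrow> continuous_on \<Omega> (\<lambda>z. G z w)"
  by (intro continuous_at_imp_continuous_on ballI) (blast intro: DERIV_isCont hol_sysD)

lemma hol_sys_chain:
  assumes "hol_sys \<Omega> G" "\<gamma> t \<in> \<Omega>" "\<gamma> differentiable (at t)"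
  shows "((\<lambda>t. G (\<gamma> t) w) has_vector_derivative
    - vector_derivative \<gamma> (at t) * (eta (\<gamma> t) \<star> G (\<gamma> t)) w) (at t)"
  using field_vector_diff_chain_at[where f = \<gamma> and g = "\<lambda>z. G z w", OF _ hol_sysD[OF assms(1,2)]] assms(3)
  by (auto simp: vector_derivative_works o_def)

lemma path_sys_compose:
  assumes "hol_sys \<Omega> G" "\<And>t. t \<in> {a..b} \<Longrightarrow> \<gamma> t \<in> \<Omega>" "pdiff \<gamma> a b"
  shows "path_sys \<gamma> a b (\<lambda>t. G (\<gamma> t))"
proof -
  obtain S where S: "finite S" "\<And>t. t \<in> {a<..<b} - S \<Longrightarrow> \<gamma> differentiable (at t)"
    using assms(3) unfolding pdiff_def by blast
  show ?thesis
  proof (rule path_sysI[OF _ S(1)])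
    have "continuous_on {a..b} \<gamma>" "\<gamma> ` {a..b} \<subseteq> \<Omega>"
      using assms(2,3) by (auto simp: pdiff_def)
    then show "continuous_on {a..b} (\<lambda>t. G (\<gamma> t) w)" for w
      by (rule continuous_on_compose2[OF hol_sys_continuous[OF assms(1)]])
    show "((\<lambda>t. G (\<gamma> t) w) has_vector_derivative
        - vector_derivative \<gamma> (at t) * (eta (\<gamma> t) \<star> G (\<gamma> t)) w) (at t)"
      if t: "t \<in> {a<..<b} - S" for t w
      by (rule hol_sys_chain[OF assms(1) assms(2) S(2)[OF t]]) (use t in auto)
  qed
qed

lemma vector_derivative_zero_eq:
  fixes f :: "real \<Rightarrow> complex"
  assumes "finite S" "\<And>t. t \<in> {a<..<b} - S \<Longrightarrow> (f has_vector_derivative 0) (at t)"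
    and "continuous_on {a..b} f" "x \<in> {a..b}" "y \<in> {a..b}"
  shows "f x = f y"
proof -
  have "f x = f y" if "x \<le> y" "x \<in> {a..b}" "y \<in> {a..b}" for x y
  proof -
    have "((\<lambda>_. 0) has_integral (f y - f x)) {x..y}"
      using that by (intro fundamental_theorem_of_calculus_interior_strong[OF assms(1)]
          assms(2) continuous_on_subset[OF assms(3)]) auto
    from has_integral_unique[OF this has_integral_0] show ?thesis by simp
  qed
  then show ?thesis using assms(4,5) by (metis linear)
qed

lemma path_sys_unique:
  assumes F: "path_sys \<gamma> a b F" and G: "path_sys \<gamma> a b G"
    and t0: "t0 \<in> {a..b}" "F t0 = G t0" and t: "t \<in> {a..b}"
  shows "F t = G t"
proof
  obtain S where S: "finite S"
    and d: "\<And>w t. t \<in> {a<..<b} - S \<Longrightarrow> ((\<lambda>t. F t w) has_vector_derivative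
        - vector_derivative \<gamma> (at t) * (eta (\<gamma> t) \<star> F t) w) (at t)"
    using path_sysE[OF F] by blast
  obtain S' where S': "finite S'"
    and d': "\<And>w t. t \<in> {a<..<b} - S' \<Longrightarrow> ((\<lambda>t. G t w) has_vector_derivative
        - vector_derivative \<gamma> (at t) * (eta (\<gamma> t) \<star> G t) w) (at t)"
    using path_sysE[OF G] by blast
  have cont: "continuous_on {a..b} (\<lambda>t. F t w - G t w)" for w
    using F G by (auto simp: path_sys_def intro!: continuous_intros)
  have fin: "finite (S \<union> S')" using S S' by simp
  show "F t w = G t w" for w
    using t
  proof (induction w arbitrary: t)
    case Nil
    have "((\<lambda>t. F t [] - G t []) has_vector_derivative 0) (at t)" if "t \<in> {a<..<b} - (S \<union> S')" for t
      using has_vector_derivative_diff[OF d[of t "[]"] d'[of t "[]"]] that by simp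
    from vector_derivative_zero_eq[OF fin this cont Nil t0(1)] t0(2) show ?case by simp
  next
    case (Cons l w)
    have "((\<lambda>t. F t (l # w) - G t (l # w)) has_vector_derivative 0) (at t)"
      if t: "t \<in> {a<..<b} - (S \<union> S')" for t
      using has_vector_derivative_diff[OF d[of t "l # w"] d'[of t "l # w"]] t Cons.IH[of t]
      by (simp del: conv.simps)
    from vector_derivative_zero_eq[OF fin this cont Cons.prems t0(1)] t0(2) show ?case by simp
  qed
qed

lemma path_sys_conv_right:
  assumes "path_sys \<gamma> a b F"
  shows "path_sys \<gamma> a b (\<lambda>t. F t \<star> C)"
proof -
  obtain S where S: "finite S" "\<And>w t. t \<in> {a<..<b} - S \<Longrightarrow> ((\<lambda>t. F t w) has_vector_derivative
        - vector_derivative \<gamma> (at t) * (eta (\<gamma> t) \<star> F t) w) (at t)"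
    using path_sysE[OF assms(1)] by blast
  have "((\<lambda>t. (F t \<star> C) w) has_vector_derivative
        - vector_derivative \<gamma> (at t) * (eta (\<gamma> t) \<star> (F t \<star> C)) w) (at t)" if t: "t \<in> {a<..<b} - S" for t w
  proof -
    have "((\<lambda>t. (F t \<star> C) w) has_vector_derivative
        ((\<lambda>w. - vector_derivative \<gamma> (at t) * (eta (\<gamma> t) \<star> F t) w) \<star> C) w + (F t \<star> (\<lambda>w. 0)) w) (at t)"
      by (intro has_vector_derivative_conv S(2)[OF t]) auto
    moreover have "((\<lambda>w. - vector_derivative \<gamma> (at t) * (eta (\<gamma> t) \<star> F t) w) \<star> C) w
        = - vector_derivative \<gamma> (at t) * (eta (\<gamma> t) \<star> (F t \<star> C)) w"
      by (simp only: conv_cmult_left conv_assoc)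
    ultimately show ?thesis by simp
  qed
  moreover have "continuous_on {a..b} (\<lambda>t. (F t \<star> C) w)" for w
    using assms by (intro continuous_on_conv) (auto simp: path_sys_def)
  ultimately show ?thesis by (intro path_sysI[OF _ S(1)])
qed

text \<open>Integrating the equation for \<open>l # w\<close> up to \<open>b\<close> reproduces the
  recursion of \<open>iter_int\<close>; the value \<open>wone\<close> at \<open>b\<close> removes
  the boundary term.\<close>

lemma iter_int_path_sys:
  assumes "path_sys \<gamma> a b F" "F b = wone" "t \<in> {a..b}"
  shows "iter_int \<gamma> (map point w) t b = F t w"
  using assms(3)
proof (induction w arbitrary: t)
  case Nil
  obtain S where S: "finite S" "\<And>w t. t \<in> {a<..<b} - S \<Longrightarrow> ((\<lambda>t. F t w) has_vector_derivative
        - vector_derivative \<gamma> (at t) * (eta (\<gamma> t) \<star> F t) w) (at t)"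
    using path_sysE[OF assms(1)] by blast
  have "F t [] = F b []"
    using S(2)[of _ "[]"] assms(1) Nil
    by (intro vector_derivative_zero_eq[OF S(1), where a = a and b = b]) (auto simp: path_sys_def)
  then show ?case by (simp add: assms(2))
next
  case (Cons l w)
  obtain S where S: "finite S" "\<And>w t. t \<in> {a<..<b} - S \<Longrightarrow> ((\<lambda>t. F t w) has_vector_derivative
        - vector_derivative \<gamma> (at t) * (eta (\<gamma> t) \<star> F t) w) (at t)"
    using path_sysE[OF assms(1)] by blast
  have "((\<lambda>s. - vector_derivative \<gamma> (at s) * (eta (\<gamma> s) \<star> F s) (l # w)) has_integral
      (F b (l # w) - F t (l # w))) {t..b}"
    using assms(1) Cons.prems
    by (intro fundamental_theorem_of_calculus_interior_strong[OF S(1)] S(2))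
      (auto simp: path_sys_def intro: continuous_on_subset)
  from has_integral_neg[OF this]
  have "((\<lambda>s. vector_derivative \<gamma> (at s) / (\<gamma> s - point l) * F s w) has_integral F t (l # w)) {t..b}"
    by (simp add: assms(2) del: conv.simps)
  moreover have "iter_int \<gamma> (map point w) s b = F s w" if "s \<in> {t..b}" for s
    using that Cons.prems by (intro Cons.IH) auto
  ultimately show ?case
    using integral_cong[of "{t..b}" "\<lambda>s. vector_derivative \<gamma> (at s) / (\<gamma> s - point l) * iter_int \<gamma> (map point w) s b"]
    by (simp add: integral_unique)
qed

text \<open>Continuation to a nearby path: the germs \<open>N t\<close> of the solution along \<open>\<gamma>\<close> live on discs around
  \<open>\<gamma> t\<close> and agree on overlaps, so \<open>t \<mapsto> N t (\<gamma>' t)\<close> is a solution along \<open>\<gamma>'\<close>.\<close>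

lemma path_sys_nearby:
  assumes F: "path_sys \<gamma> a b F" and \<gamma>: "pdiff \<gamma> a b" and \<gamma>': "pdiff \<gamma>' a b" and "0 < r"
    and ball: "\<And>t. t \<in> {a..b} \<Longrightarrow> 0 \<notin> ball (\<gamma> t) r \<and> 1 \<notin> ball (\<gamma> t) r"
    and near: "\<And>t. t \<in> {a..b} \<Longrightarrow> \<gamma>' t \<in> ball (\<gamma> t) r"
  shows "\<exists>F'. path_sys \<gamma>' a b F' \<and>
    (\<forall>t\<in>{a..b}. \<forall>G. hol_sys (ball (\<gamma> t) r) G \<longrightarrow> G (\<gamma> t) = F t \<longrightarrow> F' t = G (\<gamma>' t))"
proof -
  have "\<exists>N. hol_sys (ball (\<gamma> t) r) N \<and> N (\<gamma> t) = F t" if "t \<in> {a..b}" for t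
    using hol_sys_exists[of "ball (\<gamma> t) r" "\<gamma> t" "F t"] ball[OF that] \<open>0 < r\<close>
      convex_imp_simply_connected[OF convex_ball] by (metis centre_in_ball open_ball)
  then obtain N where N: "\<And>t. t \<in> {a..b} \<Longrightarrow> hol_sys (ball (\<gamma> t) r) (N t)"
    "\<And>t. t \<in> {a..b} \<Longrightarrow> N t (\<gamma> t) = F t"
    by metis
  define F' where "F' t = N t (\<gamma>' t)" for t
  \<comment> \<open>Two discs meet in a convex, hence connected set, so agreement at the single
    point \<open>\<gamma> t\<close> propagates.\<close>
  have agree: "N t z = G z"
    if t: "t \<in> {a..b}" and G: "hol_sys (ball c r) G" "G (\<gamma> t) = F t" "\<gamma> t \<in> ball c r"
      and z: "z \<in> ball (\<gamma> t) r" "z \<in> ball c r" for t c G z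
  proof (rule hol_sys_unique[of "ball (\<gamma> t) r \<inter> ball c r" _ _ "\<gamma> t"])
    show "connected (ball (\<gamma> t) r \<inter> ball c r)"
      by (intro convex_connected convex_Int convex_ball)
  qed (use t G z N[OF t] \<open>0 < r\<close> in \<open>auto intro: hol_sys_subset\<close>)
  have local: "\<exists>e>0. \<forall>t\<in>{a..b}. \<bar>t - t0\<bar> < e \<longrightarrow> F' t = N t0 (\<gamma>' t) \<and> \<gamma>' t \<in> ball (\<gamma> t0) r"
    if t0: "t0 \<in> {a..b}" for t0
  proof -
    have "continuous_on {a..b} \<gamma>" "continuous_on {a..b} \<gamma>'"
      using \<gamma> \<gamma>' by (auto simp: pdiff_def)
    then obtain d d' where d: "0 < d" "0 < d'"
      "\<And>t. t \<in> {a..b} \<Longrightarrow> dist t t0 < d \<Longrightarrow> dist (\<gamma> t) (\<gamma> t0) < r"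
      "\<And>t. t \<in> {a..b} \<Longrightarrow> dist t t0 < d' \<Longrightarrow> dist (\<gamma>' t) (\<gamma>' t0) < r - dist (\<gamma> t0) (\<gamma>' t0)"
      using t0 near[OF t0] \<open>0 < r\<close> unfolding continuous_on_iff
      by (metis diff_gt_0_iff_gt mem_ball)
    have "F' t = N t0 (\<gamma>' t) \<and> \<gamma>' t \<in> ball (\<gamma> t0) r"
      if t: "t \<in> {a..b}" "\<bar>t - t0\<bar> < min d d'" for t
    proof -
      \<comment> \<open>The whole stretch of \<open>\<gamma>\<close> between \<open>t0\<close> and
        \<open>t\<close> stays in the disc, so by uniqueness the germ at \<open>t0\<close>
        reproduces \<open>F\<close> along it.\<close>
      have in_ball: "\<gamma> s \<in> ball (\<gamma> t0) r" if "s \<in> {min t t0..max t t0}" for s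
      proof -
        have "s \<in> {a..b}" "dist s t0 < d" using that t t0 by (auto simp: dist_real_def)
        then show ?thesis using d(3)[of s] by (simp add: dist_commute)
      qed
      have sub: "a \<le> min t t0" "max t t0 \<le> b" using t t0 by auto
      have "path_sys \<gamma> (min t t0) (max t t0) (\<lambda>s. N t0 (\<gamma> s))"
        by (rule path_sys_compose[OF N(1)[OF t0] in_ball pdiff_subset[OF \<gamma> sub]])
      from path_sys_unique[OF this path_sys_subset[OF F sub], of t0 t]
      have "N t0 (\<gamma> t) = F t" using N(2)[OF t0] by simp
      moreover have "\<gamma>' t \<in> ball (\<gamma> t0) r"
        using d(4)[of t] t dist_triangle_less_add[of "\<gamma>' t" "\<gamma>' t0" _ "\<gamma> t0"]
        by (simp add: dist_real_def dist_commute) (smt (verit) dist_commute dist_triangle)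
      ultimately show ?thesis
        using agree[OF t(1) N(1)[OF t0]] in_ball[of t] near[OF t(1)] by (simp add: F'_def)
    qed
    then show ?thesis using d(1,2) by (intro exI[of _ "min d d'"]) auto
  qed
  obtain S where S: "finite S" "\<And>t. t \<in> {a<..<b} - S \<Longrightarrow> \<gamma>' differentiable (at t)"
    using \<gamma>' by (auto simp: pdiff_def)
  have "((\<lambda>t. F' t w) has_vector_derivative
        - vector_derivative \<gamma>' (at t0) * (eta (\<gamma>' t0) \<star> F' t0) w) (at t0)" if t0: "t0 \<in> {a<..<b} - S" for t0 w
  proof -
    have t0': "t0 \<in> {a..b}" using t0 by auto
    then obtain e where e: "0 < e" "\<And>t. t \<in> {a..b} \<Longrightarrow> \<bar>t - t0\<bar> < e \<Longrightarrow> F' t = N t0 (\<gamma>' t)"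
      using local by blast
    have "((\<lambda>t. N t0 (\<gamma>' t) w) has_vector_derivative
        - vector_derivative \<gamma>' (at t0) * (eta (\<gamma>' t0) \<star> N t0 (\<gamma>' t0)) w) (at t0)"
      by (rule hol_sys_chain[OF N(1)[OF t0'] near[OF t0'] S(2)[OF t0]])
    then show ?thesis
      unfolding F'_def[of t0]
      by (rule has_vector_derivative_transform_within_open[where S = "{a<..<b} \<inter> ball t0 e"])
        (use e t0 in \<open>auto simp: dist_real_def\<close>)
  qed
  moreover have "continuous_on {a..b} (\<lambda>t. F' t w)" for w
    unfolding continuous_on_eq_continuous_within
  proof
    fix t0 assume t0: "t0 \<in> {a..b}"
    then obtain e where e: "0 < e" "\<And>t. t \<in> {a..b} \<Longrightarrow> \<bar>t - t0\<bar> < e \<Longrightarrow> F' t = N t0 (\<gamma>' t)"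
      using local by blast
    have "isCont (\<lambda>z. N t0 z w) (\<gamma>' t0)"
      using hol_sysD[OF N(1)[OF t0] near[OF t0]] DERIV_isCont by blast
    then have "continuous (at t0 within {a..b}) (\<lambda>t. N t0 (\<gamma>' t) w)"
      using \<gamma>' t0 by (intro continuous_within_compose3[of \<gamma>' t0 "\<lambda>z. N t0 z w"])
        (auto simp: pdiff_def continuous_on_eq_continuous_within)
    then show "continuous (at t0 within {a..b}) (\<lambda>t. F' t w)"
      by (rule continuous_transform_within[OF _ e(1) t0]) (use e in \<open>auto simp: dist_real_def\<close>)
  qed
  ultimately have "path_sys \<gamma>' a b F'" by (intro path_sysI[OF _ S(1)])
  moreover have "F' t = G (\<gamma>' t)"
    if "t \<in> {a..b}" "hol_sys (ball (\<gamma> t) r) G" "G (\<gamma> t) = F t" for t G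
    unfolding F'_def using that near \<open>0 < r\<close> by (intro agree[of t "\<gamma> t" G]) auto
  ultimately show ?thesis by blast
qed

section \<open>Homotopy invariance of regularized values\<close>

text \<open>The factor 3/4 is 1/2 for the tangency of the paths plus 1/4 for the radius of the discs
  used in continuation.\<close>

lemma plane0_cone:
  assumes "0 < t" "t \<le> 1 / 4" "norm (z - of_real t) \<le> 3 / 4 * t"
  shows "z \<in> plane0"
proof -
  have "\<bar>Re z - t\<bar> \<le> 3 / 4 * t"
    using abs_Re_le_cmod[of "z - of_real t"] assms(3) by simp
  then show ?thesis using assms(1,2) by (auto simp: plane0_def)
qed

text \<open>Continuing \<^const>\<open>sol0\<close> backwards along \<open>\<gamma>\<close> multiplies it by \<^const>\<open>loop_ser\<close>.\<close>

definition has_loop_ser :: "real \<Rightarrow> (real \<Rightarrow> complex) \<Rightarrow> bool" where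
  "has_loop_ser \<delta> \<gamma> \<longleftrightarrow> (\<exists>F. path_sys \<gamma> \<delta> (1 - \<delta>) F \<and>
     F \<delta> = sol0 (\<gamma> \<delta>) \<star> loop_ser \<and> F (1 - \<delta>) = sol0 (\<gamma> (1 - \<delta>)))"

text \<open>The discs at both ends lie in \<open>plane0\<close>, where the germs are
  \<open>sol0 \<star> loop_ser\<close> and \<open>sol0\<close> themselves; so both end conditions
  pass to \<open>\<gamma>'\<close>.\<close>

lemma has_loop_ser_nearby:
  assumes "has_loop_ser \<delta> \<gamma>" "pdiff \<gamma> \<delta> (1 - \<delta>)" "pdiff \<gamma>' \<delta> (1 - \<delta>)" "0 < r" "\<delta> \<le> 1 / 2"
    and "\<And>t. t \<in> {\<delta>..1 - \<delta>} \<Longrightarrow> 0 \<notin> ball (\<gamma> t) r \<and> 1 \<notin> ball (\<gamma> t) r"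
    and "\<And>t. t \<in> {\<delta>..1 - \<delta>} \<Longrightarrow> \<gamma>' t \<in> ball (\<gamma> t) r"
    and "ball (\<gamma> \<delta>) r \<subseteq> plane0" "ball (\<gamma> (1 - \<delta>)) r \<subseteq> plane0"
  shows "has_loop_ser \<delta> \<gamma>'"
proof -
  obtain F where F: "path_sys \<gamma> \<delta> (1 - \<delta>) F" "F \<delta> = sol0 (\<gamma> \<delta>) \<star> loop_ser"
    "F (1 - \<delta>) = sol0 (\<gamma> (1 - \<delta>))"
    using assms(1) by (auto simp: has_loop_ser_def)
  obtain F' where F': "path_sys \<gamma>' \<delta> (1 - \<delta>) F'"
    "\<forall>t\<in>{\<delta>..1 - \<delta>}. \<forall>G. hol_sys (ball (\<gamma> t) r) G \<longrightarrow> G (\<gamma> t) = F t \<longrightarrow> F' t = G (\<gamma>' t)"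
    using path_sys_nearby[OF F(1) assms(2,3,4,6,7)] by blast
  have "hol_sys (ball (\<gamma> \<delta>) r) (\<lambda>z. sol0 z \<star> loop_ser)"
    by (rule hol_sys_conv_right[OF hol_sys_subset[OF hol_sys_sol0 assms(8)]])
  from F'(2)[rule_format, OF _ this] have "F' \<delta> = sol0 (\<gamma>' \<delta>) \<star> loop_ser"
    using F assms(5) by simp
  moreover have "F' (1 - \<delta>) = sol0 (\<gamma>' (1 - \<delta>))"
    using F'(2)[rule_format, OF _ hol_sys_subset[OF hol_sys_sol0 assms(9)]] F assms(5) by simp
  ultimately show ?thesis using F'(1) by (auto simp: has_loop_ser_def)
qed

section \<open>Smooth ends of paths and second-order contact\<close>

lemma smooth_on_interval_subset:
  assumes "smooth_on_interval a b f" "a \<le> c" "d \<le> b"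
  shows "smooth_on_interval c d f"
proof -
  obtain D where "\<forall>x\<in>{a..b}. D 0 x = f x"
    "\<forall>k. \<forall>x\<in>{a..b}. (D k has_vector_derivative D (Suc k) x) (at x within {a..b})"
    using assms(1) unfolding smooth_on_interval_def by blast
  moreover have "{c..d} \<subseteq> {a..b}" using assms by auto
  ultimately show ?thesis
    unfolding smooth_on_interval_def
    by (intro exI[of _ D]) (blast intro: has_vector_derivative_within_subset)
qed

lemma smooth_on_interval_deriv:
  assumes "smooth_on_interval a b f" "x \<in> {a..b}"
  obtains v where "(f has_vector_derivative v) (at x within {a..b})"
proof -
  obtain D where D: "\<And>x. x\<in>{a..b} \<Longrightarrow> D 0 x = f x"
    "\<And>k x. x\<in>{a..b} \<Longrightarrow> (D k has_vector_derivative D (Suc k) x) (at x within {a..b})"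
    using assms(1) unfolding smooth_on_interval_def by blast
  have "(f has_vector_derivative D 1 x) (at x within {a..b})"
    using has_vector_derivative_transform[OF assms(2), of f "D 0"] D assms(2) by fastforce
  then show ?thesis by (rule that)
qed

lemma smooth_on_interval_continuous:
  "smooth_on_interval a b f \<Longrightarrow> continuous_on {a..b} f"
  by (metis continuous_on_eq_continuous_within has_vector_derivative_continuous smooth_on_interval_deriv)

text \<open>\<open>tangential\<close> needs an error O(t) in the quotient by t, more than
  differentiability at the end gives; a bounded second derivative supplies it.\<close>

lemma smooth_second_order:
  assumes f: "smooth_on_interval a b f" and ab: "a < b" and c: "c \<in> {a..b}"
    and v: "(f has_vector_derivative v) (at c within {a..b})"
  obtains K where "\<And>x. x \<in> {a..b} \<Longrightarrow> norm (f x - f c - (x - c) *\<^sub>R v) \<le> K * (x - c)\<^sup>2"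
proof -
  obtain D where D: "\<And>x. x\<in>{a..b} \<Longrightarrow> D 0 x = f x"
    "\<And>k x. x\<in>{a..b} \<Longrightarrow> (D k has_vector_derivative D (Suc k) x) (at x within {a..b})"
    using f unfolding smooth_on_interval_def by blast
  have fD: "(f has_vector_derivative D 1 x) (at x within {a..b})" if "x \<in> {a..b}" for x
    using has_vector_derivative_transform[OF that, of f "D 0"] D that by fastforce
  have vD: "v = D 1 c"
    using vector_derivative_unique_within_closed_interval[of a b c f v "D 1 c"] ab c v fD by simp
  have "continuous_on {a..b} (D 2)"
    unfolding continuous_on_eq_continuous_within
    using D(2)[of _ 2] has_vector_derivative_continuous by blast
  then have "bounded (D 2 ` {a..b})"
    by (intro compact_imp_bounded compact_continuous_image) auto
  then obtain B where B: "\<And>x. x \<in> {a..b} \<Longrightarrow> norm (D 2 x) \<le> B"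
    unfolding bounded_iff by blast
  have seg: "closed_segment c x \<subseteq> {a..b}" if "x \<in> {a..b}" for x
    using that c by (auto simp: closed_segment_eq_real_ivl split: if_splits)
  have D1: "norm (D 1 x - D 1 c) \<le> 3 * B * \<bar>x - c\<bar>" if x: "x \<in> {a..b}" for x
  proof -
    have d: "(D 1 has_vector_derivative D 2 y) (at y within {a..b})" if "y \<in> {a..b}" for y
      using D(2)[OF that, of 1] by (simp add: numeral_2_eq_2)
    have b: "norm (D 2 y - D 2 c) \<le> 2 * B" if "y \<in> {a..b}" for y
      using norm_triangle_ineq4[of "D 2 y" "D 2 c"] B[OF that] B[OF c] by simp
    have "norm (D 1 x - D 1 c - (x - c) *\<^sub>R D 2 c) \<le> norm (x - c) * (2 * B)"
      by (rule vector_differentiable_bound_linearization[OF d seg[OF x] b c])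
    moreover have "norm ((x - c) *\<^sub>R D 2 c) \<le> \<bar>x - c\<bar> * B"
      using B[OF c] by (simp add: mult_left_mono)
    ultimately show ?thesis
      using norm_triangle_ineq[of "D 1 x - D 1 c - (x - c) *\<^sub>R D 2 c" "(x - c) *\<^sub>R D 2 c"]
      by (simp add: algebra_simps)
  qed
  have "0 \<le> B" using B[OF c] norm_ge_zero order_trans by blast
  have "norm (f x - f c - (x - c) *\<^sub>R v) \<le> 3 * B * (x - c)\<^sup>2" if x: "x \<in> {a..b}" for x
  proof -
    have d: "(f has_vector_derivative D 1 y) (at y within closed_segment c x)" if "y \<in> closed_segment c x" for y
      using fD seg[OF x] that by (blast intro: has_vector_derivative_within_subset)
    have b: "norm (D 1 y - D 1 c) \<le> 3 * B * \<bar>x - c\<bar>" if y: "y \<in> closed_segment c x" for y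
    proof -
      have "\<bar>y - c\<bar> \<le> \<bar>x - c\<bar>"
        using y by (auto simp: closed_segment_eq_real_ivl split: if_splits)
      then have "3 * B * \<bar>y - c\<bar> \<le> 3 * B * \<bar>x - c\<bar>"
        using \<open>0 \<le> B\<close> by (intro mult_left_mono) auto
      then show ?thesis using D1[of y] seg[OF x] y by fastforce
    qed
    have "norm (f x - f c - (x - c) *\<^sub>R D 1 c) \<le> norm (x - c) * (3 * B * \<bar>x - c\<bar>)"
      by (rule vector_differentiable_bound_linearization[OF d _ b]) auto
    also have "\<dots> = 3 * B * (\<bar>x - c\<bar>)\<^sup>2"
      by (simp add: power2_eq_square)
    finally show ?thesis by (simp add: vD)
  qed
  then show ?thesis by (rule that)
qed

lemma piecewise_smooth_pdiff:
  assumes "piecewise_smooth \<gamma>" "continuous_on {0..1} \<gamma>"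
  shows "pdiff \<gamma> 0 1"
proof -
  obtain S where S: "finite S" "\<And>a b. 0 \<le> a \<Longrightarrow> a < b \<Longrightarrow> b \<le> 1 \<Longrightarrow> {a<..<b} \<inter> S = {} \<Longrightarrow> smooth_on_interval a b \<gamma>"
    using assms(1) by (auto simp: piecewise_smooth_def)
  have "\<gamma> differentiable (at t)" if t: "t \<in> {0<..<1} - S" for t
  proof -
    obtain d where d: "0 < d" "\<And>x. x \<in> S \<Longrightarrow> x \<noteq> t \<Longrightarrow> d \<le> dist t x"
      using finite_set_avoid[OF S(1), of t] by blast
    define e where "e = min d (min t (1 - t))"
    have e: "0 < e" "e \<le> d" "e \<le> t" "e \<le> 1 - t" using d t by (auto simp: e_def)
    have "{t - e<..<t + e} \<inter> S = {}"
    proof (rule ccontr)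
      assume "{t - e<..<t + e} \<inter> S \<noteq> {}"
      then obtain x where "x \<in> S" "t - e < x" "x < t + e" by auto
      then have x: "x \<in> S" "\<bar>x - t\<bar> < e" by auto
      then have "x \<noteq> t" using t by auto
      with d(2)[OF x(1)] x(2) e show False by (auto simp: dist_real_def)
    qed
    then have "smooth_on_interval (t - e) (t + e) \<gamma>"
      using e by (intro S(2)) auto
    then obtain v where "(\<gamma> has_vector_derivative v) (at t within {t - e..t + e})"
      using e by (auto elim: smooth_on_interval_deriv[of _ _ _ t])
    moreover have "at t within {t - e..t + e} = at t"
      using e by (intro at_within_interior) auto
    ultimately show ?thesis by (auto simp: has_vector_derivative_def differentiable_def)
  qed
  then show ?thesis using S(1) assms(2) by (auto simp: pdiff_def)
qed

lemma tpath_pdiff: "tpath M x y \<gamma> \<Longrightarrow> pdiff \<gamma> 0 1"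
  by (auto simp: tpath_def intro: piecewise_smooth_pdiff)

lemma tangential_second_order:
  assumes "0 < e" "\<And>t. t \<in> {0..e} \<Longrightarrow> norm (\<zeta> t - of_real t) \<le> K * t\<^sup>2"
  shows "tangential \<zeta> 0"
proof -
  have ev: "eventually (\<lambda>t::real. t \<in> {0<..<e}) (at_right 0)"
    by (rule eventually_at_right_real) fact
  then have "eventually (\<lambda>t. norm (\<zeta> t / of_real t - 1) \<le> K * norm (of_real t :: complex)) (at_right 0)"
  proof eventually_elim
    case (elim t)
    then have "\<zeta> t / of_real t - 1 = (\<zeta> t - of_real t) / of_real t"
      by (simp add: field_simps)
    then have "norm (\<zeta> t / of_real t - 1) = norm (\<zeta> t - of_real t) / t"
      using elim by (simp add: norm_divide)
    also have "\<dots> \<le> K * t\<^sup>2 / t"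
      using assms(2)[of t] elim by (intro divide_right_mono) auto
    also have "\<dots> = K * t"
      using elim by (simp add: power2_eq_square)
    finally show ?case using elim by simp
  qed
  then have "(\<lambda>t. \<zeta> t / of_real t - 1) \<in> O[at_right 0](\<lambda>t. of_real t)"
    by (rule bigoI)
  moreover have "eventually (\<lambda>t. \<zeta> t = of_real t * (\<zeta> t / of_real t)) (at_right 0)"
    using ev by eventually_elim auto
  ultimately show ?thesis
    using tangentialI[of "\<lambda>t. \<zeta> t / of_real t" 1 \<zeta>] by simp
qed

lemma tpath_tangential:
  assumes "tpath M tb0 tb0 \<gamma>"
  shows "tangential \<gamma> 0" "tangential (\<lambda>t. \<gamma> (1 - t)) 0"
proof -
  note \<gamma> = assms[unfolded tpath_def tb0_def fst_conv snd_conv]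
  obtain S where S: "finite S" "\<And>a b. 0 \<le> a \<Longrightarrow> a < b \<Longrightarrow> b \<le> 1 \<Longrightarrow> {a<..<b} \<inter> S = {} \<Longrightarrow> smooth_on_interval a b \<gamma>"
    using \<gamma> by (auto simp: piecewise_smooth_def)
  obtain d where d: "0 < d" "\<And>x. x \<in> S \<Longrightarrow> x \<noteq> 0 \<Longrightarrow> d \<le> dist 0 x"
    using finite_set_avoid[OF S(1), of 0] by blast
  obtain d' where d': "0 < d'" "\<And>x. x \<in> S \<Longrightarrow> x \<noteq> 1 \<Longrightarrow> d' \<le> dist 1 x"
    using finite_set_avoid[OF S(1), of 1] by blast
  define e where "e = min 1 (min d d')"
  have e: "0 < e" "e \<le> 1" "e \<le> d" "e \<le> d'" using d d' by (auto simp: e_def)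
  have sm: "smooth_on_interval 0 e \<gamma>" "smooth_on_interval (1 - e) 1 \<gamma>"
  proof -
    show "smooth_on_interval 0 e \<gamma>"
      using e d(2) by (intro S(2)) (force simp: dist_real_def)+
    show "smooth_on_interval (1 - e) 1 \<gamma>"
      using e d'(2) by (intro S(2)) (force simp: dist_real_def)+
  qed
  have "(\<gamma> has_vector_derivative 1) (at 0 within {0..e})"
    using \<gamma> e by (auto intro: has_vector_derivative_within_subset)
  then obtain K where K: "\<And>x. x \<in> {0..e} \<Longrightarrow> norm (\<gamma> x - \<gamma> 0 - (x - 0) *\<^sub>R 1) \<le> K * (x - 0)\<^sup>2"
    using smooth_second_order[OF sm(1) e(1), of 0 1] e by auto
  show "tangential \<gamma> 0"
    using K \<gamma> by (intro tangential_second_order[OF e(1), of _ K]) (auto simp: scaleR_conv_of_real)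
  have "(\<gamma> has_vector_derivative -1) (at 1 within {1 - e..1})"
    using \<gamma> e by (auto intro: has_vector_derivative_within_subset)
  then obtain K where K: "\<And>x. x \<in> {1 - e..1} \<Longrightarrow> norm (\<gamma> x - \<gamma> 1 - (x - 1) *\<^sub>R (-1)) \<le> K * (x - 1)\<^sup>2"
    using smooth_second_order[OF sm(2) _, of 1 "-1"] e by auto
  show "tangential (\<lambda>t. \<gamma> (1 - t)) 0"
    using K[of "1 - _"] \<gamma> by (intro tangential_second_order[OF e(1), of _ K]) (auto simp: scaleR_conv_of_real)
qed

lemma compact_uniform_bound:
  fixes f :: "'a::metric_space \<Rightarrow> 'b::metric_space"
  assumes "compact K" "continuous_on K f" "0 < e"
  shows "\<exists>d>0. \<forall>x\<in>K. \<forall>y\<in>K. dist y x < d \<longrightarrow> dist (f y) (f x) < e"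
  using compact_uniformly_continuous[OF assms(2,1)] assms(3)
  unfolding uniformly_continuous_on_def by blast

text \<open>The difference quotients extend continuously by 1, so by compactness one
  \<open>\<delta>\<close> confines the ends of all paths of the homotopy to the cone of
  \<open>plane0_cone\<close>. The middle part is moved in finitely many small steps of
  \<open>s\<close>.\<close>

lemma homotopic_has_loop_ser:
  assumes H: "tpath_homotopic (UNIV - {0, 1}) tb0 tb0 \<gamma> \<gamma>'"
  obtains \<delta> where "0 < \<delta>" "\<delta> < 1 / 4" "\<And>t. t \<in> {0<..\<delta>} \<Longrightarrow> \<gamma>' t \<in> plane0"
    "\<And>t. t \<in> {0<..\<delta>} \<Longrightarrow> \<gamma>' (1 - t) \<in> plane0" "has_loop_ser \<delta> \<gamma> \<Longrightarrow> has_loop_ser \<delta> \<gamma>'"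
proof -
  define I where "I = {0..1::real}"
  obtain H :: "real \<times> real \<Rightarrow> complex" where H': "continuous_on ({0..1} \<times> {0..1}) H"
    "\<forall>t\<in>{0..1}. H (0, t) = \<gamma> t \<and> H (1, t) = \<gamma>' t"
    "\<forall>s\<in>{0..1}. tpath (UNIV - {0, 1}) tb0 tb0 (\<lambda>t. H (s, t))"
    "continuous_on ({0..1} \<times> {0..1})
      (\<lambda>(s, t). if t = 0 then snd tb0 else (H (s, t) - fst tb0) / of_real t)"
    "continuous_on ({0..1} \<times> {0..1})
      (\<lambda>(s, t). if t = 1 then snd tb0 else (H (s, t) - fst tb0) / of_real (1 - t))"
    using H unfolding tpath_homotopic_def by blast
  have contH: "continuous_on (I \<times> I) H"
    and H01: "\<And>t. t \<in> I \<Longrightarrow> H (0, t) = \<gamma> t" "\<And>t. t \<in> I \<Longrightarrow> H (1, t) = \<gamma>' t"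
    and tp: "\<And>s. s \<in> I \<Longrightarrow> tpath (UNIV - {0, 1}) tb0 tb0 (\<lambda>t. H (s, t))"
    and q0: "continuous_on (I \<times> I) (\<lambda>(s, t). if t = 0 then 1 else H (s, t) / of_real t)"
    and q1: "continuous_on (I \<times> I) (\<lambda>(s, t). if t = 1 then 1 else H (s, t) / of_real (1 - t))"
    using H'(1-3) H'(4,5)[unfolded tb0_def fst_conv snd_conv diff_zero]
    unfolding I_def by blast+
  have comp: "compact (I \<times> I)" unfolding I_def by (intro compact_Times) auto
  define f0 where "f0 = (\<lambda>(s::real, t). if t = 0 then 1 else H (s, t) / of_real t)"
  define f1 where "f1 = (\<lambda>(s::real, t). if t = 1 then 1 else H (s, t) / of_real (1 - t))"
  obtain d0 where d0: "0 < d0"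
    "\<And>x y. x \<in> I \<times> I \<Longrightarrow> y \<in> I \<times> I \<Longrightarrow> dist y x < d0 \<Longrightarrow> dist (f0 y) (f0 x) < 1 / 2"
    using compact_uniform_bound[OF comp, of f0 "1 / 2"] q0 unfolding f0_def by auto
  obtain d1 where d1: "0 < d1"
    "\<And>x y. x \<in> I \<times> I \<Longrightarrow> y \<in> I \<times> I \<Longrightarrow> dist y x < d1 \<Longrightarrow> dist (f1 y) (f1 x) < 1 / 2"
    using compact_uniform_bound[OF comp, of f1 "1 / 2"] q1 unfolding f1_def by auto
  define \<delta> where "\<delta> = min (1 / 8) (min d0 d1 / 2)"
  have \<delta>: "0 < \<delta>" "\<delta> < 1 / 4" "\<delta> < d0" "\<delta> < d1" using d0(1) d1(1) by (auto simp: \<delta>_def)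
  have quot: "norm (z - of_real t) \<le> 1 / 2 * t" if "dist (z / of_real t) 1 < 1 / 2" "0 < t" for z :: complex and t :: real
  proof -
    have "z - of_real t = (z / of_real t - 1) * of_real t"
      using that(2) by (simp add: field_simps)
    then have "norm (z - of_real t) = norm (z / of_real t - 1) * t"
      using that(2) by (simp add: norm_mult)
    also have "\<dots> \<le> 1 / 2 * t"
      using that by (intro mult_right_mono) (auto simp: dist_norm)
    finally show ?thesis .
  qed
  have near0: "norm (H (s, t) - of_real t) \<le> 1 / 2 * t" if "s \<in> I" "t \<in> {0<..\<delta>}" for s t
    using d0(2)[of "(s, 0)" "(s, t)"] that \<delta> by (intro quot) (auto simp: f0_def I_def dist_Pair_Pair)
  have near1: "norm (H (s, 1 - t) - of_real t) \<le> 1 / 2 * t" if "s \<in> I" "t \<in> {0<..\<delta>}" for s t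
    using d1(2)[of "(s, 1)" "(s, 1 - t)"] that \<delta> by (intro quot) (auto simp: f1_def I_def dist_Pair_Pair dist_real_def)
  have in_plane0: "H (s, t) \<in> plane0" "H (s, 1 - t) \<in> plane0" if "s \<in> I" "t \<in> {0<..\<delta>}" for s t
    using near0[OF that] near1[OF that] that \<delta> by (auto intro!: plane0_cone[of t])
  have "compact (H ` (I \<times> {\<delta>..1 - \<delta>}))"
    by (intro compact_continuous_image continuous_on_subset[OF contH] compact_Times)
      (use \<delta> in \<open>auto simp: I_def\<close>)
  moreover have "open (UNIV - {0, 1 :: complex})" by auto
  moreover have "H ` (I \<times> {\<delta>..1 - \<delta>}) \<subseteq> UNIV - {0, 1}"
  proof
    fix z assume "z \<in> H ` (I \<times> {\<delta>..1 - \<delta>})"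
    then obtain s t where st: "z = H (s, t)" "s \<in> I" "t \<in> {\<delta>..1 - \<delta>}" by auto
    then have "t \<in> {0<..<1}" using \<delta> by auto
    then show "z \<in> UNIV - {0, 1}"
      using tp[OF st(2)] st(1) by (fastforce simp: tpath_def)
  qed
  ultimately obtain r0 where r0: "0 < r0" "(\<Union>x\<in>H ` (I \<times> {\<delta>..1 - \<delta>}). ball x r0) \<subseteq> UNIV - {0, 1}"
    by (rule compact_subset_open_imp_ball_epsilon_subset)
  \<comment> \<open>\<open>r0\<close> keeps the discs away from 0 and 1; \<open>\<delta> / 4\<close>
    keeps the end discs in the cone.\<close>
  define r where "r = min r0 (\<delta> / 4)"
  have r: "0 < r" "r \<le> r0" "r \<le> \<delta> / 4" using r0 \<delta> by (auto simp: r_def)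
  obtain e where e: "0 < e"
    "\<And>x y. x \<in> I \<times> I \<Longrightarrow> y \<in> I \<times> I \<Longrightarrow> dist y x < e \<Longrightarrow> dist (H y) (H x) < r"
    using compact_uniform_bound[OF comp contH r(1)] by blast
  have step: "has_loop_ser \<delta> g"
    if L: "has_loop_ser \<delta> f" and pd: "pdiff f 0 1" "pdiff g 0 1" and s: "s \<in> I"
      and f: "\<And>t. t \<in> {\<delta>..1 - \<delta>} \<Longrightarrow> f t = H (s, t)"
      and g: "\<And>t. t \<in> {\<delta>..1 - \<delta>} \<Longrightarrow> dist (H (s, t)) (g t) < r" for f g s
  proof (rule has_loop_ser_nearby[OF L])
    show "pdiff f \<delta> (1 - \<delta>)" "pdiff g \<delta> (1 - \<delta>)"
      using pd \<delta> by (auto intro: pdiff_subset)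
    show "0 < r" by fact
    show "\<delta> \<le> 1 / 2" using \<delta> by simp
    fix t assume t: "t \<in> {\<delta>..1 - \<delta>}"
    have "ball (H (s, t)) r \<subseteq> ball (H (s, t)) r0" using r by auto
    also have "\<dots> \<subseteq> UNIV - {0, 1}" using r0(2) s t by blast
    finally show "0 \<notin> ball (f t) r \<and> 1 \<notin> ball (f t) r" unfolding f[OF t] by blast
    show "g t \<in> ball (f t) r" using f[OF t] g[OF t] by simp
  next
    have "z \<in> plane0" if "z \<in> ball c r" "norm (c - of_real \<delta>) \<le> 1 / 2 * \<delta>" for z c
    proof -
      have "norm (z - of_real \<delta>) \<le> 3 / 4 * \<delta>"
        using that r \<delta> norm_triangle_ineq[of "z - c" "c - of_real \<delta>"]
        by (simp add: dist_norm norm_minus_commute)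
      then show "z \<in> plane0" using \<delta> by (intro plane0_cone[of \<delta>]) auto
    qed
    then show "ball (f \<delta>) r \<subseteq> plane0" "ball (f (1 - \<delta>)) r \<subseteq> plane0"
      using near0[OF s, of \<delta>] near1[OF s, of \<delta>] f[of \<delta>] f[of "1 - \<delta>"] \<delta> by auto
  qed
  have all: "has_loop_ser \<delta> (\<lambda>t. H (s, t))" if "has_loop_ser \<delta> (\<lambda>t. H (0, t))" "s \<in> I" "s \<le> n * (e / 2)" for n :: nat and s
    using that(2,3)
  proof (induction n arbitrary: s)
    case 0
    then have "s = 0" by (simp add: I_def)
    then show ?case using that by simp
  next
    case (Suc n)
    \<comment> \<open>A step of \<open>e / 2\<close> is within the modulus of continuity
      \<open>e\<close>; truncation keeps \<open>s'\<close> in \<open>I\<close>.\<close>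
    define s' where "s' = max 0 (s - e / 2)"
    have "s' \<in> I" "s' \<le> n * (e / 2)" "\<bar>s' - s\<bar> < e"
      using Suc.prems e(1) by (auto simp: s'_def I_def algebra_simps max_def)
    note s' = this
    have "dist (H (s', t)) (H (s, t)) < r" if "t \<in> {\<delta>..1 - \<delta>}" for t
      using e(2)[of "(s, t)" "(s', t)"] s' that Suc.prems \<delta> by (auto simp: I_def dist_Pair_Pair dist_real_def)
    then show ?case
      using Suc.IH[OF s'(1,2)] s'(1) Suc.prems(1) tp tpath_pdiff
      by (intro step[of "\<lambda>t. H (s', t)" "\<lambda>t. H (s, t)" s']) blast+
  qed
  have "has_loop_ser \<delta> \<gamma>'" if "has_loop_ser \<delta> \<gamma>"
  proof -
    obtain n :: nat where "1 / (e / 2) < n" using reals_Archimedean2 by blast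
    then have "1 \<le> n * (e / 2)" using e(1) by (simp add: field_simps)
    moreover have 01: "0 \<in> I" "1 \<in> I" and sub: "{\<delta>..1 - \<delta>} \<subseteq> I" using \<delta> by (auto simp: I_def)
    moreover have pd: "pdiff \<gamma> 0 1" "pdiff \<gamma>' 0 1"
      using H by (auto simp: tpath_homotopic_def intro: tpath_pdiff)
    have "has_loop_ser \<delta> (\<lambda>t. H (0, t))"
      by (rule step[OF that pd(1) tpath_pdiff[OF tp[OF 01(1)]] 01(1)]) (use H01 sub r in auto)
    ultimately have "has_loop_ser \<delta> (\<lambda>t. H (1, t))"
      using all[of 1 n] by blast
    then show ?thesis
      by (rule step[OF _ tpath_pdiff[OF tp[OF 01(2)]] pd(2) 01(2)]) (use H01 sub r in auto)
  qed
  moreover have "\<gamma>' t \<in> plane0" "\<gamma>' (1 - t) \<in> plane0" if "t \<in> {0<..\<delta>}" for t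
    using in_plane0[of 1 t] H01(2)[of t] H01(2)[of "1 - t"] that \<delta> by (auto simp: I_def)
  ultimately show ?thesis using \<delta>(1,2) that by blast
qed

section \<open>Regularized values as constant terms\<close>

lemma is_reg_value_asy:
  assumes "asy (length as) (\<lambda>t. iter_int \<gamma> as t (1 - t)) p"
  shows "is_reg_value \<gamma> as (poly p 0)"
proof -
  have "(\<Sum>k\<le>length as. coeff p k * of_real (ln t ^ k)) = poly p (of_real (ln t))" for t
  proof -
    have "(\<Sum>k\<le>length as. coeff p k * of_real (ln t ^ k)) = (\<Sum>k\<le>degree p. coeff p k * of_real (ln t ^ k))"
      using assms by (intro sum.mono_neutral_right) (auto simp: asy_def coeff_eq_0)
    then show ?thesis by (simp add: poly_altdef)
  qed
  moreover have "(\<lambda>t. iter_int \<gamma> as t (1 - t) - poly p (of_real (ln t))) \<in> O[at_right 0](\<lambda>t. of_real (t * ln t ^ (length as + 1)))"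
    using assms landau_o.big_trans[OF _ t_ln_power_bigo[of "length as" "length as + 1"]] by (simp add: asy_def)
  ultimately show ?thesis
    unfolding is_reg_value_def by (intro exI[of _ "coeff p"]) (simp add: poly_0_coeff_0)
qed

lemma is_reg_value_unique:
  assumes "is_reg_value \<gamma> as c" "is_reg_value \<gamma> as c'"
  shows "c = c'"
proof -
  \<comment> \<open>The extra 1 matches the error term of \<open>is_reg_value\<close>, one logarithm
    weaker than what the solutions satisfy.\<close>
  have "\<exists>p. poly p 0 = c \<and> asy (length as + 1) (\<lambda>t. iter_int \<gamma> as t (1 - t)) p"
    if "is_reg_value \<gamma> as c" for c
  proof -
    obtain f where f: "f 0 = c" "(\<lambda>t. iter_int \<gamma> as t (1 - t) - (\<Sum>k\<le>length as. f k * of_real (ln t ^ k)))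
          \<in> O[at_right 0](\<lambda>t. of_real (t * ln t ^ (length as + 1)))"
      using \<open>is_reg_value \<gamma> as c\<close> unfolding is_reg_value_def by blast
    define p where "p = (\<Sum>k\<le>length as. monom (f k) k)"
    have "degree p \<le> length as"
      unfolding p_def by (rule degree_sum_le) (auto intro: order_trans[OF degree_monom_le])
    moreover have "poly p x = (\<Sum>k\<le>length as. f k * x ^ k)" for x
      by (simp add: p_def poly_sum poly_monom)
    moreover have "(\<Sum>k\<le>length as. f k * 0 ^ k) = c"
      using f(1) by (subst sum.remove[of _ 0]) (auto simp: power_0_left)
    ultimately show ?thesis using f(2) by (intro exI[of _ p]) (simp add: asy_def)
  qed
  from this[OF assms(1)] this[OF assms(2)] show ?thesis using asy_unique by metis
qed

text \<open>In the expansion of the integral from \<open>t\<close> to \<open>1 - t\<close>,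
  \<open>loop_ser\<close> stands between \<open>lam\<close> and its antipode. At
  \<open>ln t = 0\<close> both are \<open>wone\<close>, which leaves \<open>loop_ser\<close> as the
  constant term.\<close>

lemma is_reg_value_loop_ser:
  assumes tp: "tpath M tb0 tb0 \<gamma>" and \<delta>: "0 < \<delta>" "\<delta> < 1 / 4" and L: "has_loop_ser \<delta> \<gamma>"
    and pl: "\<And>t. t \<in> {0<..\<delta>} \<Longrightarrow> \<gamma> t \<in> plane0" "\<And>t. t \<in> {0<..\<delta>} \<Longrightarrow> \<gamma> (1 - t) \<in> plane0"
  shows "is_reg_value \<gamma> (map point w) (loop_ser w)"
proof -
  obtain F where F: "path_sys \<gamma> \<delta> (1 - \<delta>) F" "F \<delta> = sol0 (\<gamma> \<delta>) \<star> loop_ser"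
    "F (1 - \<delta>) = sol0 (\<gamma> (1 - \<delta>))"
    using L by (auto simp: has_loop_ser_def)
  define F' where "F' t = (if t \<le> \<delta> then sol0 (\<gamma> t) \<star> loop_ser else if t \<le> 1 - \<delta> then F t else sol0 (\<gamma> t))" for t
  have iter: "iter_int \<gamma> (map point w) t (1 - t) = (sol0 (\<gamma> t) \<star> loop_ser \<star> antip (sol0 (\<gamma> (1 - t)))) w"
    if t: "t \<in> {0<..<\<delta>}" for t
  proof -
    have pd: "pdiff \<gamma> t \<delta>" "pdiff \<gamma> (1 - \<delta>) (1 - t)"
      using pdiff_subset[OF tpath_pdiff[OF tp]] t \<delta> by auto
    have "path_sys \<gamma> t \<delta> (\<lambda>t. sol0 (\<gamma> t) \<star> loop_ser)"
      using t by (intro path_sys_conv_right path_sys_compose[OF hol_sys_sol0] pl pd) auto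
    then have 1: "path_sys \<gamma> t \<delta> F'"
      by (rule path_sys_cong) (simp add: F'_def)
    have 2: "path_sys \<gamma> \<delta> (1 - \<delta>) F'"
      by (rule path_sys_cong[OF F(1)]) (use F(2) in \<open>auto simp: F'_def\<close>)
    have "path_sys \<gamma> (1 - \<delta>) (1 - t) (\<lambda>t. sol0 (\<gamma> t))"
      using t pl(2)[of "1 - _"] by (intro path_sys_compose[OF hol_sys_sol0] pd) auto
    then have 3: "path_sys \<gamma> (1 - \<delta>) (1 - t) F'"
      by (rule path_sys_cong) (use F(3) \<delta> in \<open>auto simp: F'_def\<close>)
    have "path_sys \<gamma> t (1 - t) F'"
      using t \<delta> by (intro path_sys_join[OF path_sys_join[OF 1 2] 3]) auto
    \<comment> \<open>The inverse of the value at the upper end normalizes the solution to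
      \<open>wone\<close> there.\<close>
    then have "path_sys \<gamma> t (1 - t) (\<lambda>s. F' s \<star> antip (F' (1 - t)))"
      by (rule path_sys_conv_right)
    moreover have "F' (1 - t) = sol0 (\<gamma> (1 - t))" "F' t = sol0 (\<gamma> t) \<star> loop_ser"
      using t \<delta> by (auto simp: F'_def)
    ultimately show ?thesis
      using iter_int_path_sys[of \<gamma> t "1 - t" "\<lambda>s. F' s \<star> antip (F' (1 - t))" t w] t \<delta>
        sol0_inverse(2)[OF pl(2), of t] by simp
  qed
  define p where "p = lam_asy 0 \<star> (\<lambda>w. [:loop_ser w:]) \<star> antip (lam_asy 0)"
  have "asy (length w) (\<lambda>t. (sol0 (\<gamma> t) \<star> loop_ser \<star> antip (sol0 (\<gamma> (1 - t)))) w) (p w)"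
    unfolding p_def
    by (intro asy_conv asy_antip asy_const asy_sol0 tpath_tangential[OF tp])
  moreover have "eventually (\<lambda>t. t \<in> {0<..<\<delta>}) (at_right 0)"
    by (rule eventually_at_right_real) fact
  then have "eventually (\<lambda>t. (sol0 (\<gamma> t) \<star> loop_ser \<star> antip (sol0 (\<gamma> (1 - t)))) w
      = iter_int \<gamma> (map point w) t (1 - t)) (at_right 0)"
    by eventually_elim (simp add: iter)
  ultimately have "asy (length (map point w)) (\<lambda>t. iter_int \<gamma> (map point w) t (1 - t)) (p w)"
    using asy_cong by simp
  from is_reg_value_asy[OF this] show ?thesis
    by (simp add: p_def poly_conv poly_antip poly_lam_asy lam_0)
qed

section \<open>The loop \<open>\<beta>\<close>\<close>

lemma smooth_entire:
  fixes f :: "complex \<Rightarrow> complex"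
  assumes "f holomorphic_on UNIV"
  shows "smooth_on_interval a b (\<lambda>t. f (of_real t))"
  unfolding smooth_on_interval_def
proof (intro exI[of _ "\<lambda>k t. (deriv ^^ k) f (of_real t)"] conjI ballI allI)
  fix k t
  have "(deriv ^^ k) f holomorphic_on UNIV"
    using assms by (intro holomorphic_higher_deriv) auto
  then have "((deriv ^^ k) f has_field_derivative (deriv ^^ Suc k) f (of_real t)) (at (of_real t))"
    by (simp add: holomorphic_derivI)
  then show "((\<lambda>t. (deriv ^^ k) f (of_real t)) has_vector_derivative (deriv ^^ Suc k) f (of_real t)) (at t within {a..b})"
    by (rule has_vector_derivative_real_field)
qed simp

lemma smooth_on_interval_cong:
  assumes "smooth_on_interval a b f" "\<And>t. t \<in> {a..b} \<Longrightarrow> f t = g t"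
  shows "smooth_on_interval a b g"
  using assms unfolding smooth_on_interval_def by metis

definition beta0 :: "real \<Rightarrow> complex" where
  "beta0 = tcomp (tcomp dch alpha) (reversepath dch)"

text \<open>Unfolding the compositions evaluates \<open>alpha\<close> at
  \<open>4 * t - 5 / 4\<close>. Its phase minus pi is \<open>16 * pi * t - 6 * pi\<close>, running
  from 0 to 2 pi as t runs from 3/8 to 1/2; the factor for pi gives the minus sign.\<close>

definition circ :: "complex \<Rightarrow> complex" where
  "circ z = 1 - exp (\<i> * (16 * of_real pi * z - 6 * of_real pi)) / 4"

text \<open>The intervals are closed so that both formulas hold at a break point, as continuity and
  one-sided smoothness require.\<close>

lemma beta0_eq:
  "t \<in> {0..1/4} \<Longrightarrow> beta0 t = of_real t"
  "t \<in> {1/4..3/8} \<Longrightarrow> beta0 t = 4 * of_real t - 3 / 4"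
  "t \<in> {3/8..1/2} \<Longrightarrow> beta0 t = circ (of_real t)"
  "t \<in> {1/2..3/4} \<Longrightarrow> beta0 t = 7 / 4 - 2 * of_real t"
  "t \<in> {3/4..1} \<Longrightarrow> beta0 t = 1 - of_real t"
proof -
  have circle: "1 + exp (4 * of_real pi * \<i> * of_real (4 * t - 5 / 4)) / 4 = circ (of_real t)" for t
  proof -
    have "4 * of_real pi * \<i> * of_real (4 * t - 5 / 4)
        = \<i> * (16 * of_real pi * of_real t - 6 * of_real pi) + \<i> * of_real pi"
      by (simp add: algebra_simps)
    then show ?thesis by (simp only: exp_add circ_def) simp
  qed
  show "t \<in> {0..1/4} \<Longrightarrow> beta0 t = of_real t"
    by (simp add: beta0_def tcomp_def dch_def)
  show "t \<in> {1/4..3/8} \<Longrightarrow> beta0 t = 4 * of_real t - 3 / 4"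
  proof (cases "t = 1/4")
    case True
    show ?thesis unfolding True by (simp add: beta0_def tcomp_def dch_def)
  qed (auto simp: beta0_def tcomp_def dch_def)
  show "t \<in> {1/2..3/4} \<Longrightarrow> beta0 t = 7 / 4 - 2 * of_real t"
  proof (cases "t = 1/2")
    case True
    have "exp (4 * of_real pi * \<i> * of_real (3 / 4)) = -1"
    proof -
      have "4 * of_real pi * \<i> * of_real (3 / 4) = 2 * of_real pi * \<i> + \<i> * of_real pi"
        by (simp add: algebra_simps)
      then show ?thesis by (simp only: exp_add exp_two_pi_i) simp
    qed
    then show ?thesis unfolding True by (simp add: beta0_def tcomp_def alpha_def)
  qed (auto simp: beta0_def tcomp_def dch_def reversepath_def)
  show "t \<in> {3/4..1} \<Longrightarrow> beta0 t = 1 - of_real t"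
  proof (cases "t = 3/4")
    case True
    show ?thesis unfolding True by (simp add: beta0_def tcomp_def dch_def reversepath_def)
  qed (auto simp: beta0_def tcomp_def dch_def reversepath_def)
  show "t \<in> {3/8..1/2} \<Longrightarrow> beta0 t = circ (of_real t)"
  proof (cases "t = 3/8")
    case True
    show ?thesis unfolding True by (simp add: beta0_def tcomp_def dch_def circ_def)
  next
    case False
    moreover assume "t \<in> {3/8..1/2}"
    ultimately have "beta0 t = 1 + exp (4 * of_real pi * \<i> * of_real (4 * t - 5 / 4)) / 4"
      by (auto simp: beta0_def tcomp_def alpha_def)
    then show ?thesis by (simp only: circle)
  qed
qed

lemma beta0_smooth:
  "smooth_on_interval 0 (1/4) beta0" "smooth_on_interval (1/4) (3/8) beta0"
  "smooth_on_interval (3/8) (1/2) beta0" "smooth_on_interval (1/2) (3/4) beta0"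
  "smooth_on_interval (3/4) 1 beta0"
proof -
  have smooth: "smooth_on_interval a b beta0"
    if "f holomorphic_on UNIV" "\<And>t. t \<in> {a..b} \<Longrightarrow> beta0 t = f (of_real t)" for a b f
    by (rule smooth_on_interval_cong[OF smooth_entire[OF that(1)]]) (simp add: that(2))
  show "smooth_on_interval 0 (1/4) beta0"
    by (rule smooth[of "\<lambda>z. z"]) (auto simp: beta0_eq)
  show "smooth_on_interval (1/4) (3/8) beta0"
    by (rule smooth[of "\<lambda>z. 4 * z - 3 / 4"]) (auto simp: beta0_eq intro!: holomorphic_intros)
  show "smooth_on_interval (3/8) (1/2) beta0"
    by (rule smooth[of circ]) (auto simp: beta0_eq circ_def[abs_def] intro!: holomorphic_intros)
  show "smooth_on_interval (1/2) (3/4) beta0"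
    by (rule smooth[of "\<lambda>z. 7 / 4 - 2 * z"]) (auto simp: beta0_eq intro!: holomorphic_intros)
  show "smooth_on_interval (3/4) 1 beta0"
    by (rule smooth[of "\<lambda>z. 1 - z"]) (auto simp: beta0_eq intro!: holomorphic_intros)
qed

lemma circ_of_real:
  "Re (circ (of_real t)) = 1 - cos (16 * pi * t - 6 * pi) / 4"
  "Im (circ (of_real t)) = - sin (16 * pi * t - 6 * pi) / 4"
proof -
  have "circ (of_real t) = 1 - cis (16 * pi * t - 6 * pi) / 4"
    by (simp add: circ_def cis_conv_exp)
  then show "Re (circ (of_real t)) = 1 - cos (16 * pi * t - 6 * pi) / 4"
    "Im (circ (of_real t)) = - sin (16 * pi * t - 6 * pi) / 4"
    by simp_all
qed

lemma beta0_cases: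
  fixes t :: real
  assumes "t \<in> {0..1}"
  obtains "t \<in> {0..1/4}" | "t \<in> {1/4..3/8}" | "t \<in> {3/8..1/2}" | "t \<in> {1/2..3/4}" | "t \<in> {3/4..1}"
  using assms by (cases "t \<le> 1/4"; cases "t \<le> 3/8"; cases "t \<le> 1/2"; cases "t \<le> 3/4") auto

lemma beta0_avoids:
  assumes "t \<in> {0<..<1}"
  shows "beta0 t \<noteq> 0" "beta0 t \<noteq> 1"
proof -
  have c: "circ z = 0 \<Longrightarrow> exp (\<i> * (16 * of_real pi * z - 6 * of_real pi)) = 4" for z
    by (simp add: circ_def)
  have nz: "circ (of_real t) \<noteq> 0"
  proof
    assume "circ (of_real t) = 0"
    from arg_cong[OF c[OF this], of norm] show False by (simp add: norm_exp_eq_Re)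
  qed
  have no: "circ (of_real t) \<noteq> 1" by (simp add: circ_def)
  have "t \<in> {0..1}" using assms by auto
  then have "beta0 t \<noteq> 0 \<and> beta0 t \<noteq> 1"
  proof (cases t rule: beta0_cases)
    case 3
    then show ?thesis using nz no by (simp add: beta0_eq)
  qed (use assms in \<open>auto simp: beta0_eq complex_eq_iff\<close>)
  then show "beta0 t \<noteq> 0" "beta0 t \<noteq> 1" by auto
qed

lemma beta0_continuous: "continuous_on {0..1} beta0"
proof -
  note pieces = beta0_smooth[THEN smooth_on_interval_continuous]
  show ?thesis
    by (rule continuous_on_Icc_join[OF continuous_on_Icc_join[OF continuous_on_Icc_join[OF
            continuous_on_Icc_join[OF pieces(1,2)] pieces(3)] pieces(4)] pieces(5)]) simp_all
qed

lemma beta0_piecewise_smooth: "piecewise_smooth beta0"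
  unfolding piecewise_smooth_def
proof (intro exI[of _ "{1/4, 3/8, 1/2, 3/4}"] conjI allI impI)
  fix a b :: real
  assume "0 \<le> a \<and> a < b \<and> b \<le> 1 \<and> {a<..<b} \<inter> {1/4, 3/8, 1/2, 3/4} = {}"
  then consider "0 \<le> a" "b \<le> 1/4" | "1/4 \<le> a" "b \<le> 3/8" | "3/8 \<le> a" "b \<le> 1/2"
    | "1/2 \<le> a" "b \<le> 3/4" | "3/4 \<le> a" "b \<le> 1"
    by fastforce
  then show "smooth_on_interval a b beta0"
    by cases (blast intro: smooth_on_interval_subset[OF beta0_smooth(1)]
        smooth_on_interval_subset[OF beta0_smooth(2)] smooth_on_interval_subset[OF beta0_smooth(3)]
        smooth_on_interval_subset[OF beta0_smooth(4)] smooth_on_interval_subset[OF beta0_smooth(5)])+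
qed simp

lemma tpath_beta0: "tpath (UNIV - {0, 1}) tb0 tb0 beta0"
proof -
  have "((\<lambda>t. of_real t) has_vector_derivative (1 :: complex)) (at 0 within {0..1})"
    by (rule has_vector_derivative_real_field) simp
  then have "(beta0 has_vector_derivative 1) (at 0 within {0..1})"
    by (rule has_vector_derivative_transform_within[where d = "1/4"]) (auto simp: beta0_eq dist_real_def)
  moreover have "((\<lambda>z. 1 - z) has_field_derivative (- 1)) (at (of_real 1 :: complex))"
    by (auto intro!: derivative_eq_intros)
  then have "((\<lambda>t. 1 - of_real t) has_vector_derivative (- 1 :: complex)) (at 1 within {0..1})"
    by (rule has_vector_derivative_real_field)
  then have "(beta0 has_vector_derivative - 1) (at 1 within {0..1})"
    by (rule has_vector_derivative_transform_within[where d = "1/4"]) (auto simp: beta0_eq dist_real_def)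
  ultimately show ?thesis
    using beta0_avoids beta0_continuous beta0_piecewise_smooth
    by (auto simp: tpath_def tb0_def beta0_eq)
qed

text \<open>The constant homotopy works: \<open>beta0\<close> is straight near its ends, so the
  difference quotients are constantly 1 there.\<close>

lemma homotopic_beta0: "tpath_homotopic (UNIV - {0, 1}) tb0 tb0 beta0 beta0"
proof -
  have snd: "continuous_on ({0..1} \<times> {0..1}) (\<lambda>(s, t). f t)" if "continuous_on {0..1} f"
    for f :: "real \<Rightarrow> complex"
    unfolding case_prod_unfold
    by (rule continuous_on_compose2[OF that]) (auto intro: continuous_intros)
  have "continuous_on {0..1} (\<lambda>t. if t = 0 then 1 else beta0 t / of_real t)"
  proof (rule continuous_on_Icc_join[of 0 "1/4" _ 1])
    have "continuous_on {0..1/4} (\<lambda>t::real. 1 :: complex)" by simp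
    then show "continuous_on {0..1/4} (\<lambda>t. if t = 0 then 1 else beta0 t / of_real t)"
      by (rule continuous_on_eq) (auto simp: beta0_eq)
    have "continuous_on {1/4..1} (\<lambda>t. beta0 t / of_real t)"
      by (intro continuous_intros continuous_on_subset[OF beta0_continuous]) auto
    then show "continuous_on {1/4..1} (\<lambda>t. if t = 0 then 1 else beta0 t / of_real t)"
      by (rule continuous_on_eq) auto
  qed auto
  moreover have "continuous_on {0..1} (\<lambda>t. if t = 1 then 1 else beta0 t / of_real (1 - t))"
  proof (rule continuous_on_Icc_join[of 0 "3/4" _ 1])
    have "continuous_on {3/4..1} (\<lambda>t::real. 1 :: complex)" by simp
    then show "continuous_on {3/4..1} (\<lambda>t. if t = 1 then 1 else beta0 t / of_real (1 - t))"
      by (rule continuous_on_eq) (auto simp: beta0_eq)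
    have "continuous_on {0..3/4} (\<lambda>t. beta0 t / of_real (1 - t))"
      by (intro continuous_intros continuous_on_subset[OF beta0_continuous]) (auto simp del: of_real_diff)
    then show "continuous_on {0..3/4} (\<lambda>t. if t = 1 then 1 else beta0 t / of_real (1 - t))"
      by (rule continuous_on_eq) auto
  qed auto
  ultimately show ?thesis
    using tpath_beta0 snd[OF beta0_continuous]
    unfolding tpath_homotopic_def tb0_def fst_conv snd_conv diff_zero
    by (intro conjI exI[of _ "\<lambda>(s, t). beta0 t"]) (auto dest!: snd)
qed

text \<open>At 13/32 and 15/32 the phase is pi/2 and 3 pi/2: the lowest and the highest point of the
  circle, in the half planes where the two slit planes overlap.\<close>

lemma beta0_regions:
  "t \<in> {0<..13/32} \<Longrightarrow> beta0 t \<in> plane0" "t \<in> {15/32..<1} \<Longrightarrow> beta0 t \<in> plane0"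
  "t \<in> {13/32..15/32} \<Longrightarrow> beta0 t \<in> plane1" "beta0 (13/32) \<in> lower" "beta0 (15/32) \<in> upper"
proof -
  define x where "x = 16 * pi * t - 6 * pi"
  have c: "Re (circ (of_real t)) = 1 - cos x / 4" "Im (circ (of_real t)) = - sin x / 4"
    by (simp_all add: circ_of_real x_def)
  show "beta0 t \<in> plane0" if t: "t \<in> {0<..13/32}"
  proof -
    have c_in: "circ (of_real t) \<in> plane0" if "3/8 \<le> t"
    proof (cases "t = 3/8")
      case True
      have "x = 0" unfolding x_def True by simp
      then show ?thesis using c by (simp add: plane0_def)
    next
      case False
      then have "0 < x" using \<open>3/8 \<le> t\<close> by (simp add: x_def)
      moreover have "16 * pi * t \<le> 16 * pi * (13/32)" using t by (intro mult_left_mono) auto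
      then have "x < pi" by (simp add: x_def)
      ultimately have "0 < sin x" by (rule sin_gt_zero)
      then show ?thesis using c by (simp add: plane0_def)
    qed
    have "t \<in> {0..1}" using t by auto
    then show ?thesis
    proof (cases t rule: beta0_cases)
      case 3
      then show ?thesis using c_in by (simp add: beta0_eq)
    qed (use t in \<open>auto simp: beta0_eq plane0_def\<close>)
  qed
  show "beta0 t \<in> plane0" if t: "t \<in> {15/32..<1}"
  proof -
    have c_in: "circ (of_real t) \<in> plane0" if "t \<le> 1/2"
    proof (cases "t = 1/2")
      case True
      have "x = 2 * pi" unfolding x_def True by simp
      then show ?thesis using c by (simp add: plane0_def)
    next
      case False
      then have "x < 2 * pi" using \<open>t \<le> 1/2\<close> by (simp add: x_def)
      moreover have "16 * pi * (15/32) \<le> 16 * pi * t" using t by (intro mult_left_mono) auto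
      then have "pi < x" by (simp add: x_def)
      ultimately have "sin x < 0" by (intro sin_lt_zero)
      then show ?thesis using c by (simp add: plane0_def)
    qed
    have "t \<in> {0..1}" using t by auto
    then show ?thesis
    proof (cases t rule: beta0_cases)
      case 3
      then show ?thesis using c_in by (simp add: beta0_eq)
    qed (use t in \<open>auto simp: beta0_eq plane0_def\<close>)
  qed
  show "beta0 t \<in> plane1" if t: "t \<in> {13/32..15/32}"
  proof -
    define y where "y = pi * t"
    have "pi * (13/32) \<le> y" "y \<le> pi * (15/32)"
      unfolding y_def using t by (intro mult_left_mono; auto)+
    moreover have "x = 16 * y - 6 * pi" by (simp add: x_def y_def)
    ultimately have "0 \<le> cos (x - pi)" by (intro cos_ge_zero) auto
    then have "cos x \<le> 0" by simp
    moreover have "sin x = 0 \<Longrightarrow> cos x = 1 \<or> cos x = - 1"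
      using sin_cos_squared_add[of x] by (auto simp: power2_eq_1_iff)
    ultimately show ?thesis using c t by (auto simp: beta0_eq plane1_def)
  qed
  have "beta0 (13/32) = circ (of_real (13/32))" "beta0 (15/32) = circ (of_real (15/32))"
    by (rule beta0_eq; simp)+
  moreover have "16 * pi * (13 / 32) - 6 * pi = pi / 2" "16 * pi * (15 / 32) - 6 * pi = 3 / 2 * pi"
    by simp_all
  ultimately show "beta0 (13/32) \<in> lower" "beta0 (15/32) \<in> upper"
    unfolding lower_def upper_def mem_Collect_eq
    by (simp_all only: circ_of_real sin_3over2_pi sin_pi_half)
qed

text \<open>Three branches are glued at the points just found, where \<open>sol1_lower\<close> and
  \<open>sol1_upper\<close> match their values. Normalization is at the final end, so the factor
  \<open>loop_ser\<close> appears at the start.\<close>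

lemma has_loop_ser_beta0:
  assumes "0 < \<delta>" "\<delta> < 1/4"
  shows "has_loop_ser \<delta> beta0"
proof -
  define F where "F t = (if t \<le> 13/32 then sol0 (beta0 t) \<star> loop_ser
    else if t \<le> 15/32 then sol1 (beta0 t) else sol0 (beta0 t))" for t
  have pd: "pdiff beta0 a b" if "0 \<le> a" "b \<le> 1" for a b
    using pdiff_subset[OF tpath_pdiff[OF tpath_beta0]] that by auto
  have "path_sys beta0 \<delta> (13/32) (\<lambda>t. sol0 (beta0 t) \<star> loop_ser)"
    using assms by (intro path_sys_conv_right path_sys_compose[OF hol_sys_sol0] beta0_regions pd) auto
  then have 1: "path_sys beta0 \<delta> (13/32) F"
    by (rule path_sys_cong) (simp add: F_def)
  have "path_sys beta0 (13/32) (15/32) (\<lambda>t. sol1 (beta0 t))"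
    by (intro path_sys_compose[OF sol1(1)] beta0_regions pd) auto
  then have 2: "path_sys beta0 (13/32) (15/32) F"
  proof (rule path_sys_cong)
    show "sol1 (beta0 t) = F t" if "t \<in> {13/32..15/32}" for t
    proof (cases "t = 13/32")
      case True
      show ?thesis unfolding True by (simp add: F_def sol1_lower beta0_regions)
    qed (use that in \<open>auto simp: F_def\<close>)
  qed
  have "path_sys beta0 (15/32) (1 - \<delta>) (\<lambda>t. sol0 (beta0 t))"
    using assms by (intro path_sys_compose[OF hol_sys_sol0] beta0_regions pd) auto
  then have 3: "path_sys beta0 (15/32) (1 - \<delta>) F"
  proof (rule path_sys_cong)
    show "sol0 (beta0 t) = F t" if "t \<in> {15/32..1 - \<delta>}" for t
    proof (cases "t = 15/32")
      case True
      show ?thesis unfolding True by (simp add: F_def sol1_upper beta0_regions)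
    qed (use that in \<open>auto simp: F_def\<close>)
  qed
  have "path_sys beta0 \<delta> (1 - \<delta>) F"
    using assms by (intro path_sys_join[OF path_sys_join[OF 1 2] 3]) auto
  then show ?thesis
    unfolding has_loop_ser_def using assms by (intro exI[of _ F]) (auto simp: F_def)
qed

text \<open>The definite description is legitimate: all representatives share the value, and
  \<open>beta0\<close>, being one of them, forces uniqueness.\<close>

lemma reg_iter_int_beta: "reg_iter_int beta (map point w) = loop_ser w"
proof -
  have reg: "is_reg_value \<gamma> (map point w) (loop_ser w)" if "\<gamma> \<in> beta" for \<gamma>
  proof -
    have H: "tpath_homotopic (UNIV - {0, 1}) tb0 tb0 beta0 \<gamma>"
      using that by (simp add: beta_def tpath_class_def beta0_def)
    obtain \<delta> where \<delta>: "0 < \<delta>" "\<delta> < 1 / 4" "\<And>t. t \<in> {0<..\<delta>} \<Longrightarrow> \<gamma> t \<in> plane0"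
      "\<And>t. t \<in> {0<..\<delta>} \<Longrightarrow> \<gamma> (1 - t) \<in> plane0" "has_loop_ser \<delta> beta0 \<Longrightarrow> has_loop_ser \<delta> \<gamma>"
      using homotopic_has_loop_ser[OF H] by blast
    have "tpath (UNIV - {0, 1}) tb0 tb0 \<gamma>"
      using H by (simp add: tpath_homotopic_def)
    then show ?thesis
      using \<delta> has_loop_ser_beta0 by (intro is_reg_value_loop_ser[where \<delta> = \<delta>]) auto
  qed
  have "beta0 \<in> beta"
    using homotopic_beta0 by (simp add: beta_def tpath_class_def beta0_def)
  then show ?thesis
    unfolding reg_iter_int_def using reg is_reg_value_unique by (intro the_equality) blast+
qed

section \<open>Linear extension to the free algebra\<close>

definition lin_ext :: "(letter list \<Rightarrow> complex) \<Rightarrow> free_alg \<Rightarrow> complex" where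
  "lin_ext L f = (\<Sum>w\<in>Poly_Mapping.keys f. of_rat (Poly_Mapping.lookup f w) * L w)"

lemma ZRS_eq: "ZRS f = 1 / (2 * of_real pi * \<i>) * lin_ext loop_ser f"
  unfolding ZRS_def lin_ext_def reg_iter_int_beta sum_distrib_left
  by (intro sum.cong) auto

lemma lin_ext_single [simp]: "lin_ext L (Poly_Mapping.single w c) = of_rat c * L w"
  by (simp add: lin_ext_def)

lemma lin_ext_add: "lin_ext L (f + g) = lin_ext L f + lin_ext L g"
proof -
  define S where "S = Poly_Mapping.keys f \<union> Poly_Mapping.keys g"
  have "lin_ext L h = (\<Sum>w\<in>S. of_rat (Poly_Mapping.lookup h w) * L w)"
    if "Poly_Mapping.keys h \<subseteq> S" for h
    unfolding lin_ext_def using that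
    by (intro sum.mono_neutral_left) (auto simp: S_def in_keys_iff)
  then show ?thesis
    using Poly_Mapping.keys_add[of f g]
    by (simp add: S_def lookup_add of_rat_add distrib_right sum.distrib)
qed

lemma lin_ext_uminus: "lin_ext L (- f) = - lin_ext L f"
  using lin_ext_add[of L f "- f"] by (simp add: eq_neg_iff_add_eq_0 add.commute) (simp add: lin_ext_def)

lemma lin_ext_diff: "lin_ext L (f - g) = lin_ext L f - lin_ext L g"
  using lin_ext_add[of L f "- g"] by (simp add: lin_ext_uminus)

lemma lin_ext_gen_mult: "lin_ext L (gen a * f) = lin_ext (\<lambda>w. L (a # w)) f"
  by (induction f rule: free_alg_induct)
    (simp_all add: gen_def mult_single plus_list_def distrib_left lin_ext_add)

lemma lin_ext_mult_gen: "lin_ext L (f * gen a) = lin_ext (\<lambda>w. L (w @ [a])) f"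
  by (induction f rule: free_alg_induct)
    (simp_all add: gen_def mult_single plus_list_def distrib_right lin_ext_add)

lemma lin_ext_scalar_mult: "lin_ext L (scalar c * f) = of_rat c * lin_ext L f"
  by (induction f rule: free_alg_induct)
    (simp_all add: scalar_def mult_single plus_list_def distrib_left lin_ext_add of_rat_mult)

lemma lin_ext_phi: "lin_ext L (phi f) = lin_ext (subst_phi L) f"
proof (induction f rule: free_alg_induct)
  case (single w c)
  have "lin_ext L (prod_list (map (\<lambda>a. case a of E0 \<Rightarrow> gen E0 - gen E1 | E1 \<Rightarrow> - gen E1) w)) = subst_phi L w"
  proof (induction w arbitrary: L)
    case Nil
    then show ?case by (simp add: lin_ext_def flip: single_one) (simp add: zero_list_def)
  next
    case (Cons a w)
    then show ?case
      by (cases a) (simp_all add: left_diff_distrib lin_ext_diff lin_ext_uminus lin_ext_gen_mult)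
  qed
  then show ?case by (simp add: phi_def hom_ext_single lin_ext_scalar_mult)
next
  case (add f g)
  then show ?case by (simp add: phi_def hom_ext_add lin_ext_add)
qed

lemma lin_ext_tau: "lin_ext L (tau f) = lin_ext (antip L) f"
proof (induction f rule: free_alg_induct)
  case (single w c)
  have "lin_ext L (prod_list (map (\<lambda>a. - gen a) v)) = (- 1) ^ length v * L v" for v
  proof (induction v arbitrary: L)
    case Nil
    then show ?case by (simp add: lin_ext_def flip: single_one) (simp add: zero_list_def)
  next
    case (Cons a v)
    then show ?case by (simp add: lin_ext_uminus lin_ext_gen_mult)
  qed
  then show ?case by (simp add: tau_def antihom_ext_single lin_ext_scalar_mult antip_def)
next
  case (add f g)
  then show ?case by (simp add: tau_def antihom_ext_add lin_ext_add)
qed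

lemma cnj_lin_ext: "cnj (lin_ext L f) = lin_ext (ucnj L) f"
proof -
  have "cnj (of_rat r) = of_rat r" for r
    by (cases r) (simp add: of_rat_rat)
  then show ?thesis by (simp add: lin_ext_def)
qed

text \<open>The prefactor is purely imaginary, so its conjugation absorbs the minus sign.\<close>

lemma cnj_ZRS: "- cnj (ZRS f) = 1 / (2 * of_real pi * \<i>) * lin_ext (ucnj loop_ser) f"
  by (simp add: ZRS_eq cnj_lin_ext)

theorem theorem3p2:
  shows "(\<forall>w\<in>frakh0. ZRS (phi w) = - cnj (ZRS w)) \<and>
         (\<forall>w\<in>frakh. ZRS (tau w) = - cnj (ZRS w))"
proof (intro conjI ballI)
  fix x assume "x \<in> frakh0"
  then obtain c u where x: "x = gen E1 * scalar c + gen E1 * u * gen E1"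
    by (auto simp: frakh0_def)
  \<comment> \<open>Only the words treated in \<open>loop_ser_phi_coeff\<close> occur in
    \<open>x\<close>.\<close>
  have "lin_ext L x = of_rat c * L [E1] + lin_ext (\<lambda>w. L (E1 # w @ [E1])) u" for L
    unfolding x by (simp add: lin_ext_add mult.assoc lin_ext_gen_mult lin_ext_mult_gen scalar_def)
  then have "lin_ext (subst_phi loop_ser) x = lin_ext (ucnj loop_ser) x"
    by (simp add: loop_ser_phi_coeff del: subst_phi.simps)
  then show "ZRS (phi x) = - cnj (ZRS x)"
    by (simp only: ZRS_eq[of "phi x"] cnj_ZRS lin_ext_phi)
next
  fix x
  show "ZRS (tau x) = - cnj (ZRS x)"
    by (simp only: ZRS_eq[of "tau x"] cnj_ZRS lin_ext_tau loop_ser_antip)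
qed

end
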